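(* Let $\Gamma$ be a framed graph and $\Delta,\Delta'$ two maximal cliques of routes. Then $\Delta\le\Delta'$ in the framing lattice $\mathcal L_\Gamma$ if and only if $\mathrm{CC}_L(\Delta,c)\le\mathrm{CC}_L(\Delta',c)$ for every left corner $c$ of $\Gamma$.
   Context: A flow graph $G$ is a finite directed acyclic graph with vertex set $[n]$ and a finite multiset of edges, each directed from a smaller to a larger vertex. Sources (resp. sinks) have no incoming (resp. outgoing) edge; other vertices are internal. A route is a directed path from a source to a sink. A framing assigns to every internal vertex $v$ total orders $<_{\mathrm{in}(v)}$ on incoming edges and $<_{\mathrm{out}(v)}$ on outgoing edges of $v$; $\Gamma=(G,F)$ is a framed graph. Routes through an internal vertex $v$ are compared by the outgoing preorder $\le^+_v$ (lexicographic comparison of the suffixes from $v$, using the orders $<_{\mathrm{out}}$) and the incoming preorder $\le^-_v$ (lexicographic comparison of the prefixes ending at $v$, read backwards, using the orders $<_{\mathrm{in}}$). $p$ is clockwise to $q$ at $v$ if $p<^-_v q$ and $p>^+_v q$; routes are coherent if neither is clockwise to the other at any shared internal vertex; if incoherent at $v$, their maximal common subpath containing $v$ is a subroute of conflict. A maximal clique is an inclusion-maximal set of pairwise coherent routes. Adjacent maximal cliques share all but one route; for adjacent $\Delta,\Delta'$ with $r\in\Delta\setminus\Delta'$, $r'\in\Delta'\setminus\Delta$ it is known that $r,r'$ have a unique subroute of conflict $s$. The framing lattice $\mathcal L_\Gamma$ is the lattice on maximal cliques with cover relations $\Delta\lessdot\Delta'$ for adjacent $\Delta,\Delta'$ with $r$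 clockwise to $r'$ at $s$. A left corner is $c=(c^\bullet,c^\downarrow,c^\uparrow)$ with $c^\bullet$ internal and $c^\downarrow<_{\mathrm{in}(c^\bullet)}c^\uparrow$ consecutive incoming edges of $c^\bullet$. A left-cornered route with corner $c$ is the corner $c$ followed by a directed path from $c^\bullet$ to a sink; left-cornered routes with corner $c$ are totally ordered by the outgoing order at $c^\bullet$ (lexicographic comparison of their paths from $c^\bullet$ using the orders $<_{\mathrm{out}}$). In a maximal clique $\Delta$, routes through $v$ are totally ordered by $p\preceq q$ iff $p\le^-_vq$ and $p\le^+_vq$; the upper cornering route $r^\uparrow_c(\Delta)$ is the $\preceq$-smallest route of $\Delta$ using $c^\uparrow$ and the lower cornering route $r^\downarrow_c(\Delta)$ is the $\preceq$-largest route of $\Delta$ using $c^\downarrow$ (at $v=c^\bullet$); they coincide after $c^\bullet$, and $\bar s_c(\Delta)$ is the left-cornered route consisting of $c$ followed by this common part. The left cubical coordinate $\mathrm{CC}_L(\Delta,c)$ is the corank of $\bar s_c(\Delta)$ in the outgoing order at $c^\bullet$, i.e. the number of left-cornered routes with corner $c$ strictly greater than $\bar s_c(\Delta)$. *)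

theory Defs
  imports "Graph_Theory.Arc_Walk"
begin

text \<open>
  The arcs of a \<open>pre_digraph\<close> are abstract objects with a tail and a head, so parallel arcs are
  distinct: this models a multiset of edges. The relations \<open>in_ord \<Gamma> v\<close> and \<open>out_ord \<Gamma> v\<close> are the
  strict orders of the framing at \<open>v\<close>.
\<close>

record 'e framed_digraph =
  graph :: "(nat, 'e) pre_digraph"
  in_ord :: "nat \<Rightarrow> 'e rel"
  out_ord :: "nat \<Rightarrow> 'e rel"

definition flow_graph :: "(nat, 'e) pre_digraph \<Rightarrow> bool" where
  "flow_graph G \<longleftrightarrow> fin_digraph G \<and> (\<exists>n. verts G = {1..n}) \<and> (\<forall>e\<in>arcs G. tail G e < head G e)"

definition is_source :: "(nat, 'e) pre_digraph \<Rightarrow> nat \<Rightarrow> bool" where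
  "is_source G v \<longleftrightarrow> v \<in> verts G \<and> in_arcs G v = {}"

definition is_sink :: "(nat, 'e) pre_digraph \<Rightarrow> nat \<Rightarrow> bool" where
  "is_sink G v \<longleftrightarrow> v \<in> verts G \<and> out_arcs G v = {}"

definition internal :: "(nat, 'e) pre_digraph \<Rightarrow> nat \<Rightarrow> bool" where
  "internal G v \<longleftrightarrow> v \<in> verts G \<and> \<not> is_source G v \<and> \<not> is_sink G v"

definition framed_graph :: "'e framed_digraph \<Rightarrow> bool" where
  "framed_graph \<Gamma> \<longleftrightarrow> flow_graph (graph \<Gamma>) \<and>
     (\<forall>v. internal (graph \<Gamma>) v \<longrightarrow>
        in_ord \<Gamma> v \<subseteq> in_arcs (graph \<Gamma>) v \<times> in_arcs (graph \<Gamma>) v \<and>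
        strict_linear_order_on (in_arcs (graph \<Gamma>) v) (in_ord \<Gamma> v) \<and>
        out_ord \<Gamma> v \<subseteq> out_arcs (graph \<Gamma>) v \<times> out_arcs (graph \<Gamma>) v \<and>
        strict_linear_order_on (out_arcs (graph \<Gamma>) v) (out_ord \<Gamma> v))"


text \<open>
  A directed path is given by its initial vertex and its list of arcs; the initial vertex is
  recorded so that paths without arcs are represented too. As a flow graph is acyclic, its walks
  are paths.
\<close>

type_synonym 'e dipath = "nat \<times> 'e list"

definition dipath :: "(nat, 'e) pre_digraph \<Rightarrow> 'e dipath \<Rightarrow> nat \<Rightarrow> bool" where
  "dipath G p w \<longleftrightarrow> pre_digraph.awalk G (fst p) (snd p) w"

definition path_verts :: "(nat, 'e) pre_digraph \<Rightarrow> 'e dipath \<Rightarrow> nat set" where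
  "path_verts G p = set (pre_digraph.awalk_verts G (fst p) (snd p))"

definition route :: "'e framed_digraph \<Rightarrow> 'e dipath \<Rightarrow> bool" where
  "route \<Gamma> p \<longleftrightarrow> is_source (graph \<Gamma>) (fst p) \<and> (\<exists>t. is_sink (graph \<Gamma>) t \<and> dipath (graph \<Gamma>) p t)"

definition subpath :: "(nat, 'e) pre_digraph \<Rightarrow> 'e dipath \<Rightarrow> 'e dipath \<Rightarrow> bool" where
  "subpath G s p \<longleftrightarrow> (\<exists>xs ys w t. snd p = xs @ snd s @ ys \<and>
     dipath G (fst p, xs) (fst s) \<and> dipath G s w \<and> dipath G (w, ys) t)"

text \<open>
  The parts of a route before and after a vertex \<open>v\<close> on it. An internal vertex on a route is the
  tail of exactly one arc of the route.
\<close>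

definition prefix_to :: "'e framed_digraph \<Rightarrow> nat \<Rightarrow> 'e dipath \<Rightarrow> 'e list" where
  "prefix_to \<Gamma> v p = takeWhile (\<lambda>e. tail (graph \<Gamma>) e \<noteq> v) (snd p)"

definition suffix_from :: "'e framed_digraph \<Rightarrow> nat \<Rightarrow> 'e dipath \<Rightarrow> 'e list" where
  "suffix_from \<Gamma> v p = dropWhile (\<lambda>e. tail (graph \<Gamma>) e \<noteq> v) (snd p)"

text \<open>
  Two paths leaving \<open>v\<close> first differ in two outgoing arcs of a common internal vertex, so the
  lexicographic comparison by the orders at the individual vertices is the lexicographic comparison
  by the union of these orders; dually for paths ending at \<open>v\<close> and read backwards. The clause of
  \<open>lexord\<close> making a proper prefix smaller never applies to paths that end in sinks
  (respectively start in sources).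
\<close>

definition out_rel :: "'e framed_digraph \<Rightarrow> 'e rel" where
  "out_rel \<Gamma> = (\<Union>w\<in>{w. internal (graph \<Gamma>) w}. out_ord \<Gamma> w)"

definition in_rel :: "'e framed_digraph \<Rightarrow> 'e rel" where
  "in_rel \<Gamma> = (\<Union>w\<in>{w. internal (graph \<Gamma>) w}. in_ord \<Gamma> w)"

definition out_less :: "'e framed_digraph \<Rightarrow> nat \<Rightarrow> 'e dipath \<Rightarrow> 'e dipath \<Rightarrow> bool" where
  "out_less \<Gamma> v p q \<longleftrightarrow> (suffix_from \<Gamma> v p, suffix_from \<Gamma> v q) \<in> lexord (out_rel \<Gamma>)"

definition out_le :: "'e framed_digraph \<Rightarrow> nat \<Rightarrow> 'e dipath \<Rightarrow> 'e dipath \<Rightarrow> bool" where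
  "out_le \<Gamma> v p q \<longleftrightarrow> suffix_from \<Gamma> v p = suffix_from \<Gamma> v q \<or> out_less \<Gamma> v p q"

definition in_less :: "'e framed_digraph \<Rightarrow> nat \<Rightarrow> 'e dipath \<Rightarrow> 'e dipath \<Rightarrow> bool" where
  "in_less \<Gamma> v p q \<longleftrightarrow> (rev (prefix_to \<Gamma> v p), rev (prefix_to \<Gamma> v q)) \<in> lexord (in_rel \<Gamma>)"

definition in_le :: "'e framed_digraph \<Rightarrow> nat \<Rightarrow> 'e dipath \<Rightarrow> 'e dipath \<Rightarrow> bool" where
  "in_le \<Gamma> v p q \<longleftrightarrow> prefix_to \<Gamma> v p = prefix_to \<Gamma> v q \<or> in_less \<Gamma> v p q"

definition shared_internal :: "'e framed_digraph \<Rightarrow> 'e dipath \<Rightarrow> 'e dipath \<Rightarrow> nat \<Rightarrow> bool" where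
  "shared_internal \<Gamma> p q v \<longleftrightarrow>
     internal (graph \<Gamma>) v \<and> v \<in> path_verts (graph \<Gamma>) p \<and> v \<in> path_verts (graph \<Gamma>) q"

definition clockwise :: "'e framed_digraph \<Rightarrow> nat \<Rightarrow> 'e dipath \<Rightarrow> 'e dipath \<Rightarrow> bool" where
  "clockwise \<Gamma> v p q \<longleftrightarrow> in_less \<Gamma> v p q \<and> out_less \<Gamma> v q p"

definition incoherent_at :: "'e framed_digraph \<Rightarrow> nat \<Rightarrow> 'e dipath \<Rightarrow> 'e dipath \<Rightarrow> bool" where
  "incoherent_at \<Gamma> v p q \<longleftrightarrow> shared_internal \<Gamma> p q v \<and> (clockwise \<Gamma> v p q \<or> clockwise \<Gamma> v q p)"

definition coherent :: "'e framed_digraph \<Rightarrow> 'e dipath \<Rightarrow> 'e dipath \<Rightarrow> bool" where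
  "coherent \<Gamma> p q \<longleftrightarrow> (\<forall>v. \<not> incoherent_at \<Gamma> v p q)"

definition clique :: "'e framed_digraph \<Rightarrow> 'e dipath set \<Rightarrow> bool" where
  "clique \<Gamma> \<Delta> \<longleftrightarrow> (\<forall>p\<in>\<Delta>. route \<Gamma> p) \<and> (\<forall>p\<in>\<Delta>. \<forall>q\<in>\<Delta>. coherent \<Gamma> p q)"

definition maximal_clique :: "'e framed_digraph \<Rightarrow> 'e dipath set \<Rightarrow> bool" where
  "maximal_clique \<Gamma> \<Delta> \<longleftrightarrow> clique \<Gamma> \<Delta> \<and> (\<forall>\<Delta>'. clique \<Gamma> \<Delta>' \<and> \<Delta> \<subseteq> \<Delta>' \<longrightarrow> \<Delta>' = \<Delta>)"


text \<open>
  \<open>s\<close> is a subroute of conflict of \<open>p\<close> and \<open>q\<close>: a maximal common subpath through a vertex at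
  which they are incoherent.
\<close>

definition common_subpath :: "'e framed_digraph \<Rightarrow> 'e dipath \<Rightarrow> 'e dipath \<Rightarrow> 'e dipath \<Rightarrow> bool" where
  "common_subpath \<Gamma> p q s \<longleftrightarrow> subpath (graph \<Gamma>) s p \<and> subpath (graph \<Gamma>) s q"

definition conflict_subroute :: "'e framed_digraph \<Rightarrow> 'e dipath \<Rightarrow> 'e dipath \<Rightarrow> 'e dipath \<Rightarrow> bool" where
  "conflict_subroute \<Gamma> p q s \<longleftrightarrow>
     (\<exists>v\<in>path_verts (graph \<Gamma>) s. incoherent_at \<Gamma> v p q) \<and>
     common_subpath \<Gamma> p q s \<and>
     (\<forall>s'. common_subpath \<Gamma> p q s' \<and> subpath (graph \<Gamma>) s s' \<longrightarrow> s' = s)"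

text \<open>
  The direction of the conflict is the same at all vertices of a subroute of conflict. The
  subroute of conflict of the two routes exchanged between adjacent maximal cliques is unique.
\<close>

definition clockwise_on :: "'e framed_digraph \<Rightarrow> 'e dipath \<Rightarrow> 'e dipath \<Rightarrow> 'e dipath \<Rightarrow> bool" where
  "clockwise_on \<Gamma> s p q \<longleftrightarrow> (\<forall>v\<in>path_verts (graph \<Gamma>) s. clockwise \<Gamma> v p q)"

definition framing_cover :: "'e framed_digraph \<Rightarrow> 'e dipath set \<Rightarrow> 'e dipath set \<Rightarrow> bool" where
  "framing_cover \<Gamma> \<Delta> \<Delta>' \<longleftrightarrow> maximal_clique \<Gamma> \<Delta> \<and> maximal_clique \<Gamma> \<Delta>' \<and>
     (\<exists>r r' s. \<Delta> - \<Delta>' = {r} \<and> \<Delta>' - \<Delta> = {r'} \<and>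
        conflict_subroute \<Gamma> r r' s \<and> clockwise_on \<Gamma> s r r')"

definition framing_le :: "'e framed_digraph \<Rightarrow> 'e dipath set \<Rightarrow> 'e dipath set \<Rightarrow> bool" where
  "framing_le \<Gamma> = (framing_cover \<Gamma>)\<^sup>*\<^sup>*"


text \<open>A corner \<open>(v, d, u)\<close> has vertex \<open>v\<close>, lower arc \<open>d\<close> and upper arc \<open>u\<close>.\<close>

type_synonym 'e corner = "nat \<times> 'e \<times> 'e"

fun left_corner :: "'e framed_digraph \<Rightarrow> 'e corner \<Rightarrow> bool" where
  "left_corner \<Gamma> (v, d, u) \<longleftrightarrow> internal (graph \<Gamma>) v \<and>
     d \<in> in_arcs (graph \<Gamma>) v \<and> u \<in> in_arcs (graph \<Gamma>) v \<and> (d, u) \<in> in_ord \<Gamma> v \<and>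
     \<not> (\<exists>e\<in>in_arcs (graph \<Gamma>) v. (d, e) \<in> in_ord \<Gamma> v \<and> (e, u) \<in> in_ord \<Gamma> v)"

text \<open>A left-cornered route is its corner together with the arcs of its path to a sink.\<close>

type_synonym 'e cornered = "'e corner \<times> 'e list"

definition left_cornered_routes :: "'e framed_digraph \<Rightarrow> 'e corner \<Rightarrow> 'e cornered set" where
  "left_cornered_routes \<Gamma> c =
     {(c, p) | p. \<exists>t. is_sink (graph \<Gamma>) t \<and> dipath (graph \<Gamma>) (fst c, p) t}"

definition cornered_less :: "'e framed_digraph \<Rightarrow> 'e cornered \<Rightarrow> 'e cornered \<Rightarrow> bool" where
  "cornered_less \<Gamma> s t \<longleftrightarrow> (snd s, snd t) \<in> lexord (out_rel \<Gamma>)"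

definition route_le :: "'e framed_digraph \<Rightarrow> nat \<Rightarrow> 'e dipath \<Rightarrow> 'e dipath \<Rightarrow> bool" where
  "route_le \<Gamma> v p q \<longleftrightarrow> in_le \<Gamma> v p q \<and> out_le \<Gamma> v p q"

fun upper_cornering :: "'e framed_digraph \<Rightarrow> 'e dipath set \<Rightarrow> 'e corner \<Rightarrow> 'e dipath" where
  "upper_cornering \<Gamma> \<Delta> (v, d, u) =
     (THE r. r \<in> \<Delta> \<and> u \<in> set (snd r) \<and> (\<forall>q\<in>\<Delta>. u \<in> set (snd q) \<longrightarrow> route_le \<Gamma> v r q))"

fun lower_cornering :: "'e framed_digraph \<Rightarrow> 'e dipath set \<Rightarrow> 'e corner \<Rightarrow> 'e dipath" where
  "lower_cornering \<Gamma> \<Delta> (v, d, u) =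
     (THE r. r \<in> \<Delta> \<and> d \<in> set (snd r) \<and> (\<forall>q\<in>\<Delta>. d \<in> set (snd q) \<longrightarrow> route_le \<Gamma> v q r))"

text \<open>The two cornering routes of a maximal clique coincide after the vertex of the corner.\<close>

definition cornering_subroute :: "'e framed_digraph \<Rightarrow> 'e dipath set \<Rightarrow> 'e corner \<Rightarrow> 'e cornered" where
  "cornering_subroute \<Gamma> \<Delta> c =
     (c, THE p. p = suffix_from \<Gamma> (fst c) (upper_cornering \<Gamma> \<Delta> c) \<and>
                p = suffix_from \<Gamma> (fst c) (lower_cornering \<Gamma> \<Delta> c))"

definition CC_L :: "'e framed_digraph \<Rightarrow> 'e dipath set \<Rightarrow> 'e corner \<Rightarrow> nat" where
  "CC_L \<Gamma> \<Delta> c = card {t \<in> left_cornered_routes \<Gamma> c. cornered_less \<Gamma> (cornering_subroute \<Gamma> \<Delta> c) t}"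

end

theory Submission
  imports Defs "HOL-Library.Sublist"
begin

text \<open>
  A maximal clique is determined by its cornering suffixes, one for each left corner, and the
  left cubical coordinates compare these suffixes. In an exchange of \<open>r\<close> for \<open>r'\<close> with \<open>r\<close> clockwise
  to \<open>r'\<close>, a cornering suffix could only grow if \<open>r\<close> and \<open>r'\<close> were also in conflict in the opposite
  direction; this is impossible, because the resolvent of \<open>r\<close> and \<open>r'\<close> at their last conflict
  belongs to both cliques.

  Conversely, if \<open>\<Delta> \<noteq> \<Delta>'\<close> and all cornering suffixes of \<open>\<Delta>\<close> are at least those of \<open>\<Delta>'\<close>, choose
  among the corners with a strict difference one whose lower cornering route in \<open>\<Delta>\<close> is smallest
  when read backwards from its sink. Replacing the suffix of this corner by the next smaller suffix that
  \<open>\<Delta>\<close> combines with the same prefix is an exchange of one route. It changes no other corner, and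
  the new suffix is still at least the one of \<open>\<Delta>'\<close>. Iterating leads from \<open>\<Delta>\<close> to \<open>\<Delta>'\<close>.
\<close>

text \<open>Membership in a maximal clique is mostly proved by splicing: the prefix of one route up
  to \<open>v\<close> is joined to the suffix of another, and \<open>coh_splice\<close> reduces
  coherence with a route that is coherent with both parents to the vertex \<open>v\<close> alone.
  There only two linear orders, one on prefixes and one on suffixes, have to be compared. The order
  is generated by covers, so an inequality of coordinates has to be turned into a chain of
  exchanges. The obstacle is that a corner with a strict difference need not admit a downward
  exchange: the prefix of its lower cornering route may occur in \<Delta> with no smaller suffix. In
  that case a route with a smaller prefix joins this route, and where the two part, going backwards,
  there is another corner, whose lower cornering route is smaller. Either the cliques differ at that
  corner too, or their agreement there contradicts the difference at the first corner. Hence the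
  choice of a smallest lower cornering route.\<close>

section \<open>Lexicographic comparison of lists with a common beginning\<close>

lemma lexord_swap:
  assumes "irrefl r" "\<not> prefix m d" "\<not> prefix d m"
  shows "(d, m @ x) \<in> lexord r \<longleftrightarrow> (d, m @ y) \<in> lexord r"
    "(m @ x, d) \<in> lexord r \<longleftrightarrow> (m @ y, d) \<in> lexord r"
proof -
  from assms(2,3) have "m \<parallel> d" by blast
  then obtain as b bs c cs where "b \<noteq> c" "m = as @ b # bs" "d = as @ c # cs"
    using parallel_decomp by blast
  then show "(d, m @ x) \<in> lexord r \<longleftrightarrow> (d, m @ y) \<in> lexord r"
    "(m @ x, d) \<in> lexord r \<longleftrightarrow> (m @ y, d) \<in> lexord r"
    using assms(1) by auto
qed

text \<open>At an entry where \<open>t\<close> leaves \<open>m\<close>, it would lie on the same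
  side of both bounds. This recovers a common beginning of suffixes from inequalities between
  them.\<close>

lemma lexord_between:
  assumes "irrefl r" "trans r" "(m @ x, t) \<in> lexord r" "(t, m @ y) \<in> lexord r"
  shows "\<exists>t'. t = m @ t'"
  using assms(3,4)
proof (induction m arbitrary: t)
  case (Cons e m)
  then obtain f t' where t: "t = f # t'" by (cases t) auto
  have "e = f" using Cons.prems assms(1,2) unfolding t irrefl_def trans_def by auto
  with Cons t assms(1) show ?case by (auto simp: irrefl_def)
qed simp

section \<open>Splitting routes at internal vertices\<close>

locale framed = fin_digraph "graph \<Gamma>" for \<Gamma> :: "'e framed_digraph" +
  assumes fg: "framed_graph \<Gamma>"
begin

abbreviation "G \<equiv> graph \<Gamma>"

abbreviation in_lex :: "'e list \<Rightarrow> 'e list \<Rightarrow> bool" where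
  "in_lex a b \<equiv> (rev a, rev b) \<in> lexord (in_rel \<Gamma>)"

abbreviation out_lex :: "'e list \<Rightarrow> 'e list \<Rightarrow> bool" where
  "out_lex a b \<equiv> (a, b) \<in> lexord (out_rel \<Gamma>)"

abbreviation src_path :: "'e list \<Rightarrow> nat \<Rightarrow> bool" where
  "src_path a v \<equiv> \<exists>s. is_source G s \<and> awalk s a v"

abbreviation snk_path :: "nat \<Rightarrow> 'e list \<Rightarrow> bool" where
  "snk_path v b \<equiv> \<exists>t. is_sink G t \<and> awalk v b t"

section \<open>Framing orders and walks in a flow graph\<close>

lemma tail_less_head: "e \<in> arcs G \<Longrightarrow> tail G e < head G e"
  using fg unfolding framed_graph_def flow_graph_def by blast

lemma verts_eq: "\<exists>n. verts G = {1..n}"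
  using fg unfolding framed_graph_def flow_graph_def by blast

lemma framing_orders:
  assumes "internal G v"
  shows "in_ord \<Gamma> v \<subseteq> in_arcs G v \<times> in_arcs G v"
    "trans (in_ord \<Gamma> v)" "irrefl (in_ord \<Gamma> v)" "total_on (in_arcs G v) (in_ord \<Gamma> v)"
    "out_ord \<Gamma> v \<subseteq> out_arcs G v \<times> out_arcs G v"
    "trans (out_ord \<Gamma> v)" "irrefl (out_ord \<Gamma> v)" "total_on (out_arcs G v) (out_ord \<Gamma> v)"
  using fg assms unfolding framed_graph_def strict_linear_order_on_def by blast+

lemma in_rel_iff:
  "(d, e) \<in> in_rel \<Gamma> \<longleftrightarrow> internal G (head G e) \<and> (d, e) \<in> in_ord \<Gamma> (head G e)"
  unfolding in_rel_def using framing_orders(1) by fastforce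

lemma out_rel_iff:
  "(d, e) \<in> out_rel \<Gamma> \<longleftrightarrow> internal G (tail G e) \<and> (d, e) \<in> out_ord \<Gamma> (tail G e)"
  unfolding out_rel_def using framing_orders(5) by fastforce

lemma in_ordD:
  assumes "internal G v" "(d, e) \<in> in_ord \<Gamma> v"
  shows "d \<in> arcs G" "e \<in> arcs G" "head G d = v" "head G e = v" "d \<noteq> e" "(e, d) \<notin> in_ord \<Gamma> v"
    "(d, e) \<in> in_rel \<Gamma>"
  using framing_orders[OF assms(1)] assms unfolding in_rel_def irrefl_def trans_def by fastforce+

lemma out_ordD:
  assumes "internal G v" "(d, e) \<in> out_ord \<Gamma> v"
  shows "d \<in> arcs G" "e \<in> arcs G" "tail G d = v" "tail G e = v" "d \<noteq> e" "(e, d) \<notin> out_ord \<Gamma> v"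
    "(d, e) \<in> out_rel \<Gamma>"
  using framing_orders[OF assms(1)] assms unfolding out_rel_def irrefl_def trans_def by fastforce+

lemma irrefl_in_rel: "irrefl (in_rel \<Gamma>)"
  unfolding irrefl_def by (metis in_ordD(5) in_rel_iff)

lemma irrefl_out_rel: "irrefl (out_rel \<Gamma>)"
  unfolding irrefl_def by (metis out_ordD(5) out_rel_iff)

lemma trans_in_rel: "trans (in_rel \<Gamma>)"
proof (rule transI)
  fix x y z assume "(x, y) \<in> in_rel \<Gamma>" "(y, z) \<in> in_rel \<Gamma>"
  then show "(x, z) \<in> in_rel \<Gamma>"
    by (metis framing_orders(2) in_ordD(3) in_rel_iff transE)
qed

lemma trans_out_rel: "trans (out_rel \<Gamma>)"
proof (rule transI)
  fix x y z assume "(x, y) \<in> out_rel \<Gamma>" "(y, z) \<in> out_rel \<Gamma>"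
  then show "(x, z) \<in> out_rel \<Gamma>"
    by (metis framing_orders(6) out_ordD(3) out_rel_iff transE)
qed

lemma in_lex_irrefl [simp]: "(xs, xs) \<notin> lexord (in_rel \<Gamma>)"
  using irrefl_in_rel by (simp add: irrefl_def lexord_irreflexive)

lemma out_lex_irrefl [simp]: "(xs, xs) \<notin> lexord (out_rel \<Gamma>)"
  using irrefl_out_rel by (simp add: irrefl_def lexord_irreflexive)

lemma in_lex_trans: "in_lex a b \<Longrightarrow> in_lex b c \<Longrightarrow> in_lex a c"
  using lexord_trans trans_in_rel by blast

lemma out_lex_trans: "out_lex a b \<Longrightarrow> out_lex b c \<Longrightarrow> out_lex a c"
  using lexord_trans trans_out_rel by blast

lemma in_lex_asym: "in_lex a b \<Longrightarrow> \<not> in_lex b a"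
  using in_lex_trans in_lex_irrefl by blast

lemma out_lex_asym: "out_lex a b \<Longrightarrow> \<not> out_lex b a"
  using out_lex_trans out_lex_irrefl by blast

lemma out_lex_cancel [simp]: "out_lex (m @ b) (m @ b') \<longleftrightarrow> out_lex b b'"
  using irrefl_out_rel by simp

lemma in_lex_cancel [simp]: "(rev m @ rev a, rev m @ rev a') \<in> lexord (in_rel \<Gamma>) \<longleftrightarrow> in_lex a a'"
  using irrefl_in_rel by simp

lemma awalk_append: "awalk u (p @ q) v \<longleftrightarrow> (\<exists>w. awalk u p w \<and> awalk w q v)"
  using awalk_append_iff awlast_of_awalk by blast

lemma awalk_le: "awalk u p v \<Longrightarrow> u \<le> v"
proof (induction p arbitrary: u)
  case (Cons e p)
  then show ?case using tail_less_head by (fastforce simp: awalk_simps)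
qed (simp add: awalk_simps)

lemma awalk_tails: "awalk u p v \<Longrightarrow> e \<in> set p \<Longrightarrow> tail G e < v"
proof (induction p arbitrary: u)
  case (Cons f p)
  then show ?case using tail_less_head[of f] awalk_le[of "head G f" p v] by (auto simp: awalk_simps)
qed simp

lemma awalk_cycle: "awalk v p v \<longleftrightarrow> p = [] \<and> v \<in> verts G"
  by (cases p) (auto simp: awalk_simps dest!: tail_less_head awalk_le)

lemma awalk_last: "awalk u p v \<Longrightarrow> p \<noteq> [] \<Longrightarrow> last p \<in> arcs G \<and> head G (last p) = v"
  by (induction p arbitrary: u) (auto simp: awalk_simps)

lemma awalk_hd: "awalk u p v \<Longrightarrow> p \<noteq> [] \<Longrightarrow> hd p \<in> arcs G \<and> tail G (hd p) = u"
  by (cases p) (auto simp: awalk_simps)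

lemma awalk_start: "awalk u p v \<Longrightarrow> awalk u' p v \<Longrightarrow> u = u'"
  by (cases p) (auto simp: awalk_simps)

lemma awalk_end: "awalk u p v \<Longrightarrow> awalk u p v' \<Longrightarrow> v = v'"
  using awlast_of_awalk by blast

lemma source_not_internal: "is_source G v \<Longrightarrow> \<not> internal G v"
  by (simp add: internal_def)

lemma sink_not_internal: "is_sink G v \<Longrightarrow> \<not> internal G v"
  by (simp add: internal_def)

lemma sink_no_tail: "is_sink G t \<Longrightarrow> e \<in> arcs G \<Longrightarrow> tail G e \<noteq> t"
  by (auto simp: is_sink_def)

lemma source_no_head: "is_source G t \<Longrightarrow> e \<in> arcs G \<Longrightarrow> head G e \<noteq> t"
  by (auto simp: is_source_def)

lemma internalI:
  assumes "e \<in> arcs G" "f \<in> arcs G" "head G e = v" "tail G f = v"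
  shows "internal G v"
  using assms sink_no_tail source_no_head head_in_verts unfolding internal_def by blast

text \<open>Internality of \<open>v\<close> makes both halves nonempty, so the two arc lists alone
  determine the route (\<open>split_at_same\<close>), and prefixes and suffixes can be handled as
  plain lists.\<close>

definition split_at :: "'e dipath \<Rightarrow> nat \<Rightarrow> 'e list \<Rightarrow> 'e list \<Rightarrow> bool" where
  "split_at r v a b \<longleftrightarrow> route \<Gamma> r \<and> internal G v \<and> snd r = a @ b \<and> awalk (fst r) a v"

lemma split_atD:
  assumes "split_at r v a b"
  shows "route \<Gamma> r" "internal G v" "snd r = a @ b" "awalk (fst r) a v" "src_path a v" "snk_path v b"
    "a \<noteq> []" "b \<noteq> []" "last a \<in> arcs G" "head G (last a) = v" "hd b \<in> arcs G" "tail G (hd b) = v"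
    "r = (tail G (hd a), a @ b)"
proof -
  show 1: "route \<Gamma> r" "internal G v" "snd r = a @ b" "awalk (fst r) a v"
    using assms unfolding split_at_def by auto
  then show 2: "src_path a v" "snk_path v b"
    unfolding route_def dipath_def by (auto simp: awalk_append dest: awalk_end)
  from 1 2 show 3: "a \<noteq> []" "b \<noteq> []"
    unfolding route_def
    by (auto simp: awalk_simps dest!: source_not_internal sink_not_internal)
  from 2 3 show "last a \<in> arcs G" "head G (last a) = v" "hd b \<in> arcs G" "tail G (hd b) = v"
    using awalk_last awalk_hd by blast+
  show "r = (tail G (hd a), a @ b)" using 1 3 awalk_hd by (metis prod.collapse)
qed

lemma split_at_same: "split_at r v a b \<Longrightarrow> split_at q v a b \<Longrightarrow> r = q"
  using split_atD(13) by metis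

lemma split_at_splice: "split_at p v a b \<Longrightarrow> split_at q v a' b' \<Longrightarrow> split_at (fst p, a @ b') v a b'"
  using split_atD(6)[of q v a' b'] unfolding split_at_def route_def dipath_def by (auto simp: awalk_append)

lemma split_at_fwd: "split_at r v a (m @ b) \<Longrightarrow> awalk v m w \<Longrightarrow> internal G w \<Longrightarrow> split_at r w (a @ m) b"
  unfolding split_at_def by (auto simp: awalk_append)

lemma split_at_bwd:
  assumes "split_at r w (a @ m) b" "awalk v m w" "internal G v"
  shows "split_at r v a (m @ b)"
proof -
  from assms(1) obtain x where x: "awalk (fst r) a x" "awalk x m w"
    unfolding split_at_def by (auto simp: awalk_append)
  with assms(2) have "x = v" using awalk_start by blast
  with x assms show ?thesis unfolding split_at_def by auto
qed

text \<open>Vertex numbers grow along arcs, so the numerical order of two cut points is their order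
  on the walk. Positions in the list never have to be mentioned.\<close>

lemma awalk_split_order:
  assumes "a @ b = c @ d" "awalk s a v" "awalk s c w" "v \<le> w"
  shows "\<exists>m. c = a @ m \<and> b = m @ d \<and> awalk v m w"
proof -
  from assms(1) obtain m where "(a = c @ m \<and> d = m @ b) \<or> (c = a @ m \<and> b = m @ d)"
    by (metis append_eq_append_conv2)
  then show ?thesis
  proof
    assume h: "a = c @ m \<and> d = m @ b"
    with assms have "awalk w m v" by (metis awalk_append awalk_end)
    with assms(4) have "v = w" using awalk_le by fastforce
    with \<open>awalk w m v\<close> have "m = []" by (simp add: awalk_cycle)
    with h \<open>awalk w m v\<close> \<open>v = w\<close> show ?thesis by auto
  next
    assume h: "c = a @ m \<and> b = m @ d"
    with assms show ?thesis by (metis awalk_append awalk_end)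
  qed
qed

lemma split_at_order:
  assumes "split_at r v a b" "split_at r w c d" "v \<le> w"
  shows "\<exists>m. c = a @ m \<and> b = m @ d \<and> awalk v m w"
  using awalk_split_order[of a b c d "fst r" v w] assms unfolding split_at_def by auto

lemma split_at_unique: "split_at r v a b \<Longrightarrow> split_at r v c d \<Longrightarrow> a = c \<and> b = d"
  using split_at_order[of r v a b v c d] by (auto simp: awalk_cycle)

lemma split_at_prefix: "split_at r v a b \<Longrightarrow> prefix_to \<Gamma> v r = a"
  and split_at_suffix: "split_at r v a b \<Longrightarrow> suffix_from \<Gamma> v r = b"
proof -
  assume h: "split_at r v a b"
  then have "\<And>e. e \<in> set a \<Longrightarrow> tail G e \<noteq> v" "b \<noteq> []" "tail G (hd b) = v" "snd r = a @ b"
    using split_atD[OF h] awalk_tails by blast+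
  then show "prefix_to \<Gamma> v r = a" "suffix_from \<Gamma> v r = b"
    unfolding prefix_to_def suffix_from_def
    by (cases b; auto simp: takeWhile_append2 dropWhile_append2)+
qed

lemma set_awalk_verts_split: "awalk u p t \<Longrightarrow> v \<in> set (awalk_verts u p) \<longleftrightarrow> (\<exists>a b. p = a @ b \<and> awalk u a v)"
proof (induction p arbitrary: u)
  case Nil
  then show ?case by (auto simp: awalk_simps)
next
  case (Cons e p)
  then have e: "e \<in> arcs G" "u = tail G e" "awalk (head G e) p t" by (auto simp: awalk_simps)
  have "v \<in> set (awalk_verts u (e # p)) \<longleftrightarrow> v = u \<or> (\<exists>a b. p = a @ b \<and> awalk (head G e) a v)"
    using Cons.IH[OF e(3)] e by auto
  also have "\<dots> \<longleftrightarrow> (\<exists>a b. e # p = a @ b \<and> awalk u a v)" (is "?l \<longleftrightarrow> ?r")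
  proof
    assume ?l
    then show ?r
    proof
      assume "v = u"
      then have "e # p = [] @ e # p \<and> awalk u [] v" using e by (auto simp: awalk_simps)
      then show ?r by blast
    next
      assume "\<exists>a b. p = a @ b \<and> awalk (head G e) a v"
      then obtain a b where "p = a @ b" "awalk (head G e) a v" by blast
      then have "e # p = (e # a) @ b \<and> awalk u (e # a) v" using e by (auto simp: awalk_simps)
      then show ?r by blast
    qed
  next
    assume ?r
    then show ?l using e by (auto simp: Cons_eq_append_conv awalk_simps)
  qed
  finally show ?case .
qed

lemma path_verts_split_at:
  assumes "route \<Gamma> r" "internal G v"
  shows "v \<in> path_verts G r \<longleftrightarrow> (\<exists>a b. split_at r v a b)"
  using assms set_awalk_verts_split unfolding path_verts_def split_at_def route_def dipath_def by blast

lemma path_verts_arc: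
  assumes "route \<Gamma> r" "internal G v" "e \<in> set (snd r)" "head G e = v"
  shows "\<exists>a b. split_at r v a b \<and> last a = e"
proof -
  from assms obtain xs ys where x: "snd r = (xs @ [e]) @ ys" by (metis append.assoc append_Cons append_Nil split_list)
  with assms have "awalk (fst r) (xs @ [e]) v"
    unfolding route_def dipath_def by (auto simp: awalk_append awalk_simps)
  with x assms have "split_at r v (xs @ [e]) ys \<and> last (xs @ [e]) = e" unfolding split_at_def by simp
  then show ?thesis by blast
qed

lemma split_at_in_arc: "split_at r v a b \<Longrightarrow> e \<in> in_arcs G v \<Longrightarrow> e \<in> set (snd r) \<longleftrightarrow> last a = e"
proof
  assume h: "split_at r v a b" "e \<in> in_arcs G v" "e \<in> set (snd r)"
  then obtain a' b' where "split_at r v a' b'" "last a' = e"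
    using path_verts_arc split_atD(1,2) by (metis in_in_arcs_conv)
  then show "last a = e" using h split_at_unique by blast
next
  assume h: "split_at r v a b" "e \<in> in_arcs G v" "last a = e"
  then show "e \<in> set (snd r)" using split_atD[OF h(1)] by auto
qed

section \<open>Conflicts in terms of prefixes and suffixes\<close>

text \<open>The lists compared by \<open>clockwise\<close> exist at every number \<open>v\<close>,
  on the routes or not. Demanding the splittings makes \<open>v\<close> a shared internal vertex, so
  coherence becomes the mere absence of \<open>cw\<close>.\<close>

definition cw :: "nat \<Rightarrow> 'e dipath \<Rightarrow> 'e dipath \<Rightarrow> bool" where
  "cw v r t \<longleftrightarrow> (\<exists>a b a' b'. split_at r v a b \<and> split_at t v a' b' \<and> in_lex a a' \<and> out_lex b' b)"

lemma cw_split_at: "split_at r v a b \<Longrightarrow> split_at t v a' b' \<Longrightarrow> cw v r t \<longleftrightarrow> in_lex a a' \<and> out_lex b' b"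
  unfolding cw_def using split_at_unique by metis

lemma cw_asym: "cw v r t \<Longrightarrow> \<not> cw v t r"
  unfolding cw_def using split_at_unique in_lex_asym by metis

lemma clockwise_split_at: "split_at r v a b \<Longrightarrow> split_at t v a' b' \<Longrightarrow> clockwise \<Gamma> v r t \<longleftrightarrow> in_lex a a' \<and> out_lex b' b"
  unfolding clockwise_def in_less_def out_less_def by (simp add: split_at_prefix split_at_suffix)

lemma incoherent_at_iff:
  assumes "route \<Gamma> r" "route \<Gamma> t"
  shows "incoherent_at \<Gamma> v r t \<longleftrightarrow> cw v r t \<or> cw v t r"
proof
  assume h: "incoherent_at \<Gamma> v r t"
  then have v: "internal G v" "v \<in> path_verts G r" "v \<in> path_verts G t"
    unfolding incoherent_at_def shared_internal_def by simp_all
  obtain a b where r: "split_at r v a b" using path_verts_split_at[OF assms(1) v(1)] v(2) by blast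
  obtain a' b' where t: "split_at t v a' b'" using path_verts_split_at[OF assms(2) v(1)] v(3) by blast
  from h show "cw v r t \<or> cw v t r"
    unfolding incoherent_at_def clockwise_split_at[OF r t] clockwise_split_at[OF t r] cw_split_at[OF r t] cw_split_at[OF t r]
    by simp
next
  assume h: "cw v r t \<or> cw v t r"
  then obtain a b a' b' where r: "split_at r v a b" and t: "split_at t v a' b'" unfolding cw_def by blast
  then have "shared_internal \<Gamma> r t v"
    unfolding shared_internal_def
    using path_verts_split_at[OF assms(1) split_atD(2)[OF r]] path_verts_split_at[OF assms(2) split_atD(2)[OF r]] split_atD(2)[OF r]
    by blast
  with h show "incoherent_at \<Gamma> v r t"
    unfolding incoherent_at_def clockwise_split_at[OF r t] clockwise_split_at[OF t r] cw_split_at[OF r t] cw_split_at[OF t r]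
    by simp
qed

lemma coherent_iff:
  assumes "route \<Gamma> r" "route \<Gamma> t"
  shows "coherent \<Gamma> r t \<longleftrightarrow> (\<forall>v. \<not> cw v r t \<and> \<not> cw v t r)"
  unfolding coherent_def using incoherent_at_iff[OF assms] by blast

section \<open>First divergence of paths, and totality of the path orders\<close>

text \<open>No arc leaves a sink. Two different paths from \<open>v\<close> to sinks are therefore
  incomparable as prefixes and have a genuine first divergence, which \<open>snk_split\<close>
  extracts.\<close>

lemma snk_prefix: "snk_path v b \<Longrightarrow> awalk v (b @ z) w \<Longrightarrow> z = []"
proof (cases z)
  case (Cons e y)
  assume "snk_path v b" "awalk v (b @ z) w"
  then obtain t where "is_sink G t" "awalk t z w" by (auto simp: awalk_append dest: awalk_end)
  with Cons show ?thesis using sink_no_tail by (auto simp: awalk_simps)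
qed

lemma src_suffix: "src_path a v \<Longrightarrow> awalk u (z @ a) v \<Longrightarrow> z = []"
proof (cases z rule: rev_cases)
  case (snoc y e)
  assume "src_path a v" "awalk u (z @ a) v"
  then obtain t where "is_source G t" "awalk u z t"
    by (auto simp: awalk_append dest: awalk_start)
  with snoc show ?thesis using source_no_head awalk_last[of u z t] by auto
qed

lemma internal_fwd: "internal G v \<Longrightarrow> awalk v m w \<Longrightarrow> e \<in> arcs G \<Longrightarrow> tail G e = w \<Longrightarrow> internal G w"
  by (cases "m = []") (auto simp: awalk_simps intro: internalI dest: awalk_last)

lemma internal_bwd: "internal G v \<Longrightarrow> awalk w m v \<Longrightarrow> e \<in> arcs G \<Longrightarrow> head G e = w \<Longrightarrow> internal G w"
  by (cases "m = []") (auto simp: awalk_simps intro: internalI dest: awalk_hd)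

lemma snk_split:
  assumes "snk_path v b" "snk_path v b'" "b \<noteq> b'" "internal G v"
  obtains m w e f x y where "b = m @ e # x" "b' = m @ f # y" "e \<noteq> f" "awalk v m w" "internal G w"
    "e \<in> out_arcs G w" "f \<in> out_arcs G w"
proof -
  have "b \<parallel> b'" using assms snk_prefix unfolding prefix_def by (metis append_Nil2 parallelI prefixE)
  then obtain m e x f y where d: "e \<noteq> f" "b = m @ e # x" "b' = m @ f # y" using parallel_decomp by blast
  with assms obtain w where w: "awalk v m w" "e \<in> arcs G" "tail G e = w"
    by (auto simp: awalk_append awalk_simps)
  moreover from d assms w have "f \<in> arcs G" "tail G f = w"
    by (auto simp: awalk_append awalk_simps dest: awalk_end)
  moreover have "internal G w" using internal_fwd assms w by blast
  ultimately show ?thesis using that d by auto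
qed

text \<open>The divergence is found on the reversed lists. Two distinct arcs enter its vertex
  \<open>w\<close>, and this is where later arguments find a left corner.\<close>

lemma src_split:
  assumes "src_path a v" "src_path a' v" "a \<noteq> a'" "internal G v"
  obtains m w a1 a1' where "a = a1 @ m" "a' = a1' @ m" "a1 \<noteq> []" "a1' \<noteq> []" "last a1 \<noteq> last a1'"
    "awalk w m v" "internal G w" "last a1 \<in> in_arcs G w" "last a1' \<in> in_arcs G w"
    "src_path a1 w" "src_path a1' w"
proof -
  have "rev a \<parallel> rev a'"
    using assms src_suffix unfolding parallel_def suffix_to_prefix[symmetric] suffix_def
    by (metis append_Nil)
  then obtain m e x f y where "e \<noteq> f" "rev a = m @ e # x" "rev a' = m @ f # y"
    using parallel_decomp by blast
  then have d: "e \<noteq> f" "a = (rev x @ [e]) @ rev m" "a' = (rev y @ [f]) @ rev m"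
    by (simp_all add: rev_swap)
  with assms obtain w where w: "awalk w (rev m) v" "e \<in> arcs G" "head G e = w"
      "src_path (rev x @ [e]) w"
    by (fastforce simp: awalk_append awalk_simps)
  moreover from d assms obtain w' where w': "awalk w' (rev m) v" "f \<in> arcs G" "head G f = w'"
      "src_path (rev y @ [f]) w'"
    by (fastforce simp: awalk_append awalk_simps)
  moreover have "w = w'" using w w' awalk_start by blast
  moreover have "internal G w" using internal_bwd assms w by blast
  ultimately show ?thesis using that[of "rev x @ [e]" "rev m" "rev y @ [f]" w] d by auto
qed

lemma out_total: "internal G v \<Longrightarrow> e \<in> out_arcs G v \<Longrightarrow> f \<in> out_arcs G v \<Longrightarrow> e \<noteq> f \<Longrightarrow>
    (e, f) \<in> out_rel \<Gamma> \<or> (f, e) \<in> out_rel \<Gamma>"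
  using framing_orders(8) unfolding total_on_def by (metis out_rel_iff in_out_arcs_conv)

lemma in_total: "internal G v \<Longrightarrow> e \<in> in_arcs G v \<Longrightarrow> f \<in> in_arcs G v \<Longrightarrow> e \<noteq> f \<Longrightarrow>
    (e, f) \<in> in_rel \<Gamma> \<or> (f, e) \<in> in_rel \<Gamma>"
  using framing_orders(4) unfolding total_on_def by (metis in_rel_iff in_in_arcs_conv)

lemma in_lex_lastI: "a \<noteq> [] \<Longrightarrow> a' \<noteq> [] \<Longrightarrow> (last a, last a') \<in> in_rel \<Gamma> \<Longrightarrow> in_lex a a'"
  by (cases a rule: rev_cases; cases a' rule: rev_cases) auto

lemma in_lex_lastD: "in_lex a a' \<Longrightarrow> a \<noteq> [] \<Longrightarrow> a' \<noteq> [] \<Longrightarrow> last a = last a' \<or> (last a, last a') \<in> in_rel \<Gamma>"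
  by (cases a rule: rev_cases; cases a' rule: rev_cases) auto

lemma out_lex_hdI: "b \<noteq> [] \<Longrightarrow> b' \<noteq> [] \<Longrightarrow> (hd b, hd b') \<in> out_rel \<Gamma> \<Longrightarrow> out_lex b b'"
  by (cases b; cases b') auto

lemma out_lex_hdD: "out_lex b b' \<Longrightarrow> b \<noteq> [] \<Longrightarrow> b' \<noteq> [] \<Longrightarrow> hd b = hd b' \<or> (hd b, hd b') \<in> out_rel \<Gamma>"
  by (cases b; cases b') auto

lemma out_lex_total:
  assumes "snk_path v b" "snk_path v b'" "b \<noteq> b'" "internal G v"
  shows "out_lex b b' \<or> out_lex b' b"
proof -
  from assms obtain m w e f x y where "b = m @ e # x" "b' = m @ f # y" "e \<noteq> f" "internal G w"
    "e \<in> out_arcs G w" "f \<in> out_arcs G w" by (rule snk_split)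
  then show ?thesis using out_total[of w e f] by auto
qed

lemma in_lex_total:
  assumes "src_path a v" "src_path a' v" "a \<noteq> a'" "internal G v"
  shows "in_lex a a' \<or> in_lex a' a"
proof -
  from assms obtain m w a1 a1' where d: "a = a1 @ m" "a' = a1' @ m" "a1 \<noteq> []" "a1' \<noteq> []"
    "last a1 \<noteq> last a1'" "internal G w" "last a1 \<in> in_arcs G w" "last a1' \<in> in_arcs G w"
    by (rule src_split)
  then have "in_lex a1 a1' \<or> in_lex a1' a1" using in_total[of w] in_lex_lastI by blast
  with d show ?thesis by auto
qed

lemma split_at_out_lex_total: "split_at p v a b \<Longrightarrow> split_at q v c d \<Longrightarrow> b \<noteq> d \<Longrightarrow> out_lex b d \<or> out_lex d b"
  using out_lex_total split_atD(2,6) by metis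

lemma split_at_in_lex_total: "split_at p v a b \<Longrightarrow> split_at q v c d \<Longrightarrow> a \<noteq> c \<Longrightarrow> in_lex a c \<or> in_lex c a"
  using in_lex_total split_atD(2,5) by metis

section \<open>Coherence of spliced routes\<close>

text \<open>A conflict before \<open>v\<close> only sees the part of a route after \<open>v\<close> if the other route follows it to \<open>v\<close>.\<close>

lemma swap_suffix:
  assumes t: "split_at t v a b1" and p: "split_at p v a b" and yv: "y \<le> v"
  shows "cw y t z \<Longrightarrow> cw y p z \<or> (cw v t z \<and> (y < v \<longrightarrow> (\<forall>c d. split_at z v c d \<longrightarrow> last c = last a)))" (is "?A \<Longrightarrow> ?A'")
    and "cw y z t \<Longrightarrow> cw y z p \<or> (cw v z t \<and> (y < v \<longrightarrow> (\<forall>c d. split_at z v c d \<longrightarrow> last c = last a)))" (is "?B \<Longrightarrow> ?B'")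
proof -
  have *: "(?A \<longrightarrow> ?A') \<and> (?B \<longrightarrow> ?B')" if ty: "split_at t y a0 b0" and zy: "split_at z y c d" for a0 b0 c d
  proof -
    obtain m where m: "a = a0 @ m" "b0 = m @ b1" "awalk y m v" using split_at_order[OF ty t yv] by blast
    have py: "split_at p y a0 (m @ b)" using split_at_bwd[OF _ m(3)] p m(1) split_atD(2)[OF ty] by blast
    \<comment> \<open>\<open>z\<close> either follows \<open>m\<close> from \<open>y\<close> to
      \<open>v\<close>, which carries the conflict to \<open>v\<close>, or leaves it earlier, and
      then the comparison is settled before the suffixes of \<open>t\<close> and \<open>p\<close>
      begin.\<close>
    show ?thesis
    proof (cases "prefix m d")
      case True
      then obtain d' where d: "d = m @ d'" by (auto simp: prefix_def)
      then have zv: "split_at z v (c @ m) d'" using split_at_fwd zy m(3) split_atD(2)[OF t] by blast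
      have l: "last (c @ m) = last a" if "y < v"
      proof -
        from that m(3) have "m \<noteq> []" by (auto simp: awalk_simps)
        then show ?thesis using m(1) by simp
      qed
      show ?thesis unfolding cw_split_at[OF ty zy] cw_split_at[OF zy ty] cw_split_at[OF t zv] cw_split_at[OF zv t]
        using l split_at_unique[OF zv] by (auto simp: m d)
    next
      case False
      have "\<not> prefix d m"
      proof
        assume "prefix d m"
        then obtain x where "m = d @ x" by (auto simp: prefix_def)
        with m(3) snk_prefix split_atD(6)[OF zy] have "m = d" by blast
        with False show False by simp
      qed
      from lexord_swap[OF irrefl_out_rel False this, of b b1] show ?thesis
        unfolding cw_split_at[OF ty zy] cw_split_at[OF zy ty] cw_split_at[OF py zy] cw_split_at[OF zy py] m by simp
    qed
  qed
  show "?A \<Longrightarrow> ?A'" using * unfolding cw_def[of y t z] by blast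
  show "?B \<Longrightarrow> ?B'" using * unfolding cw_def[of y z t] by blast
qed

text \<open>The dual transport, for conflicts after \<open>v\<close>. In both lemmas the clause on
  last arcs records that a conflict moved by a positive distance comes from routes sharing an arc;
  in \<open>corner_suffix_other\<close> it confines a changed corner to one vertex.\<close>

lemma swap_prefix:
  assumes t: "split_at t v a1 b" and q: "split_at q v a b" and vy: "v \<le> y"
  shows "cw y t z \<Longrightarrow> cw y q z \<or> (cw v t z \<and>
      (v < y \<longrightarrow> (\<forall>c d a0 b0. split_at z y c d \<longrightarrow> split_at t y a0 b0 \<longrightarrow> last c = last a0)))" (is "?A \<Longrightarrow> ?A'")
    and "cw y z t \<Longrightarrow> cw y z q \<or> (cw v z t \<and>
      (v < y \<longrightarrow> (\<forall>c d a0 b0. split_at z y c d \<longrightarrow> split_at t y a0 b0 \<longrightarrow> last c = last a0)))" (is "?B \<Longrightarrow> ?B'")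
proof -
  have *: "(?A \<longrightarrow> ?A') \<and> (?B \<longrightarrow> ?B')" if ty: "split_at t y a0 b0" and zy: "split_at z y c d" for a0 b0 c d
  proof -
    obtain m where m: "a0 = a1 @ m" "b = m @ b0" "awalk v m y" using split_at_order[OF t ty vy] by blast
    have qy: "split_at q y (a @ m) b0" using split_at_fwd[OF _ m(3)] q m(2) split_atD(2)[OF ty] by blast
    show ?thesis
    proof (cases "suffix m c")
      case True
      then obtain c' where c: "c = c' @ m" by (auto simp: suffix_def)
      then have zv: "split_at z v c' (m @ d)" using split_at_bwd zy m(3) split_atD(2)[OF t] by blast
      have l: "last c = last a0" if "v < y"
      proof -
        from that m(3) have "m \<noteq> []" by (auto simp: awalk_simps)
        then show ?thesis using m(1) c by simp
      qed
      show ?thesis unfolding cw_split_at[OF ty zy] cw_split_at[OF zy ty] cw_split_at[OF t zv] cw_split_at[OF zv t]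
        using l split_at_unique[OF zy] split_at_unique[OF ty] by (auto simp: m c)
    next
      case False
      have "\<not> suffix c m"
      proof
        assume "suffix c m"
        then obtain x where "m = x @ c" by (auto simp: suffix_def)
        with m(3) src_suffix split_atD(5)[OF zy] have "m = c" by blast
        with False show False by simp
      qed
      from lexord_swap[OF irrefl_in_rel False[unfolded suffix_to_prefix] this[unfolded suffix_to_prefix], of "rev a" "rev a1"]
      show ?thesis
        unfolding cw_split_at[OF ty zy] cw_split_at[OF zy ty] cw_split_at[OF qy zy] cw_split_at[OF zy qy] m by simp
    qed
  qed
  show "?A \<Longrightarrow> ?A'" using * unfolding cw_def[of y t z] by blast
  show "?B \<Longrightarrow> ?B'" using * unfolding cw_def[of y z t] by blast
qed

abbreviation coh :: "'e dipath \<Rightarrow> 'e dipath \<Rightarrow> bool" where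
  "coh r t \<equiv> \<forall>v. \<not> cw v r t \<and> \<not> cw v t r"

text \<open>Up to \<open>v\<close> the splice \<open>t\<close> agrees with \<open>p\<close>, from
  \<open>v\<close> on with \<open>q\<close>. A conflict away from \<open>v\<close> is thus inherited
  from one of them, or it moves to \<open>v\<close> along a common stretch.\<close>

lemma coh_splice:
  assumes "\<not> cw v t z \<and> \<not> cw v z t"
    and t: "split_at t v a b'" and p: "split_at p v a b" and q: "split_at q v a' b'" and "coh z p" "coh z q"
  shows "coh t z"
proof
  fix y show "\<not> cw y t z \<and> \<not> cw y z t"
    using swap_suffix[OF t p, of y z] swap_prefix[OF t q, of y z] assms(1,5,6) by (meson linear)
qed

lemma cliqueD:
  assumes "clique \<Gamma> \<Delta>"
  shows "r \<in> \<Delta> \<Longrightarrow> route \<Gamma> r" "r \<in> \<Delta> \<Longrightarrow> t \<in> \<Delta> \<Longrightarrow> coh r t"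
  using assms coherent_iff unfolding clique_def by blast+

lemma cliqueI:
  assumes "\<And>r. r \<in> \<Delta> \<Longrightarrow> route \<Gamma> r" "\<And>r t. r \<in> \<Delta> \<Longrightarrow> t \<in> \<Delta> \<Longrightarrow> coh r t"
  shows "clique \<Gamma> \<Delta>"
  unfolding clique_def
proof (intro conjI ballI)
  fix p q assume "p \<in> \<Delta>" "q \<in> \<Delta>"
  then show "coherent \<Gamma> p q" using coherent_iff[OF assms(1) assms(1), of p q] assms(2) by simp
qed (rule assms(1))

lemma coh_sym: "coh r t \<Longrightarrow> coh t r"
  by simp

lemma coh_self: "coh r r"
  using cw_asym by blast

lemma maximal_memI:
  assumes "maximal_clique \<Gamma> \<Delta>" "route \<Gamma> t" "\<And>z. z \<in> \<Delta> \<Longrightarrow> coh t z"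
  shows "t \<in> \<Delta>"
proof -
  have "clique \<Gamma> (insert t \<Delta>)"
  proof (rule cliqueI)
    have c: "clique \<Gamma> \<Delta>" using assms(1) by (simp add: maximal_clique_def)
    fix r q assume "r \<in> insert t \<Delta>" "q \<in> insert t \<Delta>"
    then show "coh r q" using cliqueD(2)[OF c] assms(3) coh_self by blast
  next
    fix r assume "r \<in> insert t \<Delta>"
    then show "route \<Gamma> r" using assms(1,2) cliqueD(1) unfolding maximal_clique_def by blast
  qed
  then show ?thesis using assms unfolding maximal_clique_def by blast
qed

lemma maximalD: "maximal_clique \<Gamma> \<Delta> \<Longrightarrow> clique \<Gamma> \<Delta>"
  by (simp add: maximal_clique_def)

lemma clique_out_lex:
  assumes "clique \<Gamma> \<Delta>" "r \<in> \<Delta>" "t \<in> \<Delta>" "split_at r v a b" "split_at t v a' b'" "in_lex a a'"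
  shows "b = b' \<or> out_lex b b'"
  using cliqueD(2)[OF assms(1-3)] cw_split_at[OF assms(4,5)] split_at_out_lex_total[OF assms(4,5)] assms(6) by blast

lemma clique_in_lex:
  assumes "clique \<Gamma> \<Delta>" "r \<in> \<Delta>" "t \<in> \<Delta>" "split_at r v a b" "split_at t v a' b'" "out_lex b b'"
  shows "a = a' \<or> in_lex a a'"
  using cliqueD(2)[OF assms(1-3)] cw_split_at[OF assms(5,4)] split_at_in_lex_total[OF assms(4,5)] assms(6) by blast

section \<open>Finiteness and extremal paths\<close>

lemma awalk_distinct: "awalk u p v \<Longrightarrow> distinct p"
proof (induction p arbitrary: u)
  case (Cons e p)
  then have "e \<in> arcs G" "awalk (head G e) p v" by (auto simp: awalk_simps)
  moreover have "e \<notin> set p"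
  proof
    assume "e \<in> set p"
    then obtain x y where "p = x @ e # y" by (meson split_list)
    with \<open>awalk (head G e) p v\<close> have "awalk (head G e) x (tail G e)"
      by (auto simp: awalk_append awalk_simps)
    then show False using awalk_le tail_less_head[OF \<open>e \<in> arcs G\<close>] by fastforce
  qed
  ultimately show ?case using Cons.IH by simp
qed simp

lemma finite_routes: "finite {r. route \<Gamma> r}"
proof (rule finite_subset)
  show "{r. route \<Gamma> r} \<subseteq> verts G \<times> {xs. set xs \<subseteq> arcs G \<and> distinct xs}"
    unfolding route_def dipath_def using awalk_distinct by (auto simp: awalk_def)
  have "finite {xs. set xs \<subseteq> arcs G \<and> distinct xs}" by (simp add: finite_subset_distinct)
  then show "finite (verts G \<times> {xs. set xs \<subseteq> arcs G \<and> distinct xs})" by simp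
qed

lemma finite_snk_paths: "finite {b. snk_path v b}"
proof (rule finite_subset)
  show "{b. snk_path v b} \<subseteq> {xs. set xs \<subseteq> arcs G \<and> distinct xs}"
    using awalk_distinct by (auto simp: awalk_def)
qed (simp add: finite_subset_distinct)

lemma finite_src_paths: "finite {a. src_path a v}"
proof (rule finite_subset)
  show "{a. src_path a v} \<subseteq> {xs. set xs \<subseteq> arcs G \<and> distinct xs}"
    using awalk_distinct by (auto simp: awalk_def)
qed (simp add: finite_subset_distinct)

lemma ex_in_lex_min_max:
  assumes "S \<noteq> {}" "S \<subseteq> {a. src_path a v}" "internal G v"
  shows "\<exists>m\<in>S. \<forall>x\<in>S. x = m \<or> in_lex m x" "\<exists>m\<in>S. \<forall>x\<in>S. x = m \<or> in_lex x m"
proof -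
  have f: "finite S" using assms(2) finite_src_paths finite_subset by blast
  have a: "asymp_on S in_lex" "transp_on S in_lex"
    unfolding asymp_on_def transp_on_def using in_lex_asym in_lex_trans by blast+
  have t: "x = m \<or> in_lex m x \<or> in_lex x m" if "x \<in> S" "m \<in> S" for x m
    using in_lex_total assms(2,3) that by blast
  show "\<exists>m\<in>S. \<forall>x\<in>S. x = m \<or> in_lex m x"
    using Finite_Set.bex_min_element[OF f a assms(1)] t by blast
  show "\<exists>m\<in>S. \<forall>x\<in>S. x = m \<or> in_lex x m"
    using Finite_Set.bex_max_element[OF f a assms(1)] t by blast
qed

lemma ex_out_lex_min_max:
  assumes "S \<noteq> {}" "S \<subseteq> {b. snk_path v b}" "internal G v"
  shows "\<exists>m\<in>S. \<forall>x\<in>S. x = m \<or> out_lex m x" "\<exists>m\<in>S. \<forall>x\<in>S. x = m \<or> out_lex x m"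
proof -
  have f: "finite S" using assms(2) finite_snk_paths finite_subset by blast
  have a: "asymp_on S out_lex" "transp_on S out_lex"
    unfolding asymp_on_def transp_on_def using out_lex_asym out_lex_trans by blast+
  have t: "x = m \<or> out_lex m x \<or> out_lex x m" if "x \<in> S" "m \<in> S" for x m
    using out_lex_total assms(2,3) that by blast
  show "\<exists>m\<in>S. \<forall>x\<in>S. x = m \<or> out_lex m x"
    using Finite_Set.bex_min_element[OF f a assms(1)] t by blast
  show "\<exists>m\<in>S. \<forall>x\<in>S. x = m \<or> out_lex x m"
    using Finite_Set.bex_max_element[OF f a assms(1)] t by blast
qed

section \<open>Arcs and corners in a maximal clique\<close>

text \<open>
  To extend an unused arc without conflicts, follow the route of \<open>\<Delta>\<close> next to it in the framing of its
  end vertex; through vertices that \<open>\<Delta>\<close> does not visit, any arc will do.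
\<close>

lemma arc_left_extension:
  assumes cl: "clique \<Gamma> \<Delta>" and "e \<in> arcs G" "\<forall>z\<in>\<Delta>. e \<notin> set (snd z)"
  shows "\<exists>s a. is_source G s \<and> awalk s a (tail G e) \<and>
    (\<forall>b z y. route \<Gamma> (s, a @ e # b) \<longrightarrow> z \<in> \<Delta> \<longrightarrow> y \<le> tail G e \<longrightarrow>
      \<not> cw y (s, a @ e # b) z \<and> \<not> cw y z (s, a @ e # b))"
  using assms(2,3)
proof (induction "tail G e" arbitrary: e rule: less_induct)
  case less
  let ?v = "tail G e"
  have vv: "?v \<in> verts G" using less.prems by simp
  show ?case
  proof (cases "is_source G ?v")
    case True
    have "\<not> cw y (?v, e # b) z \<and> \<not> cw y z (?v, e # b)" if "y \<le> ?v" for b z y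
    proof -
      have "\<not> split_at (?v, e # b) y c d" for c d
      proof
        assume h: "split_at (?v, e # b) y c d"
        then have "?v \<le> y" using split_atD(4) awalk_le by fastforce
        with that have "y = ?v" by simp
        with h True source_not_internal split_atD(2) show False by blast
      qed
      then show ?thesis unfolding cw_def by blast
    qed
    with True vv show ?thesis by (intro exI[of _ ?v] exI[of _ "[]"]) (auto simp: awalk_simps)
  next
    case False
    then have iv: "internal G ?v" using vv less.prems(1) sink_no_tail unfolding internal_def by blast
    show ?thesis
    proof (cases "\<exists>z\<in>\<Delta>. \<exists>c d. split_at z ?v c d")
      case True
      have ne: "hd d \<noteq> e" if "z \<in> \<Delta>" "split_at z ?v c d" for z c d
        using less.prems(2) split_atD(3,8)[OF that(2)] that(1) by auto
      \<comment> \<open>\<open>p\<close> sits next to \<open>e\<close>: among the routes leaving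
        \<open>v\<close> by an arc below \<open>e\<close> it has the largest prefix, and if there
        are none it has the smallest prefix of all. Either way the routes leaving above
        \<open>e\<close> have prefixes at least as large.\<close>
      obtain p a b where p: "p \<in> \<Delta>" "split_at p ?v a b"
        and lo: "\<And>z c d. z \<in> \<Delta> \<Longrightarrow> split_at z ?v c d \<Longrightarrow> (hd d, e) \<in> out_rel \<Gamma> \<Longrightarrow> \<not> in_lex a c"
        and hi: "\<And>z c d. z \<in> \<Delta> \<Longrightarrow> split_at z ?v c d \<Longrightarrow> (e, hd d) \<in> out_rel \<Gamma> \<Longrightarrow> \<not> in_lex c a"
      proof -
        let ?S1 = "{c. \<exists>z d. z \<in> \<Delta> \<and> split_at z ?v c d \<and> (hd d, e) \<in> out_rel \<Gamma>}"
        let ?S0 = "{c. \<exists>z d. z \<in> \<Delta> \<and> split_at z ?v c d}"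
        show ?thesis
        proof (cases "?S1 = {}")
          case S1: False
          have "?S1 \<subseteq> {a. src_path a ?v}" using split_atD(5) by blast
          from ex_in_lex_min_max(2)[OF S1 this iv] obtain a where a: "a \<in> ?S1" "\<forall>x\<in>?S1. x = a \<or> in_lex x a"
            by blast
          from a(1) obtain p b where p: "p \<in> \<Delta>" "split_at p ?v a b" "(hd b, e) \<in> out_rel \<Gamma>" by blast
          show ?thesis
          proof (rule that[OF p(1,2)])
            fix z c d assume z: "z \<in> \<Delta>" "split_at z ?v c d"
            show "\<not> in_lex a c" if "(hd d, e) \<in> out_rel \<Gamma>"
            proof -
              have "c \<in> ?S1" using z that by blast
              with a(2) show ?thesis using in_lex_asym by fastforce
            qed
            show "\<not> in_lex c a" if "(e, hd d) \<in> out_rel \<Gamma>"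
            proof -
              have "(hd b, hd d) \<in> out_rel \<Gamma>" using transD[OF trans_out_rel] p(3) that by blast
              then have "out_lex b d" using out_lex_hdI split_atD(8) p(2) z(2) by blast
              then show ?thesis using clique_in_lex[OF cl p(1) z(1) p(2) z(2)] in_lex_asym by fastforce
            qed
          qed
        next
          case S1: True
          have "?S0 \<noteq> {}" "?S0 \<subseteq> {a. src_path a ?v}" using True split_atD(5) by blast+
          from ex_in_lex_min_max(1)[OF this iv] obtain a where a: "a \<in> ?S0" "\<forall>x\<in>?S0. x = a \<or> in_lex a x"
            by blast
          from a(1) obtain p b where p: "p \<in> \<Delta>" "split_at p ?v a b" by blast
          show ?thesis
          proof (rule that[OF p(1,2)])
            fix z c d assume z: "z \<in> \<Delta>" "split_at z ?v c d"
            show "\<not> in_lex a c" if "(hd d, e) \<in> out_rel \<Gamma>" using z that S1 by blast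
            have "c \<in> ?S0" using z by blast
            with a(2) show "\<not> in_lex c a" using in_lex_asym by fastforce
          qed
        qed
      qed
      have "\<not> cw y (fst p, a @ e # b') z \<and> \<not> cw y z (fst p, a @ e # b')"
        if t: "route \<Gamma> (fst p, a @ e # b')" and z: "z \<in> \<Delta>" and y: "y \<le> ?v" for b' z y
      proof -
        have tv: "split_at (fst p, a @ e # b') ?v a (e # b')"
          unfolding split_at_def using t iv split_atD(4)[OF p(2)] by simp
        have "\<not> cw ?v (fst p, a @ e # b') z \<and> \<not> cw ?v z (fst p, a @ e # b')"
        proof (cases "\<exists>c d. split_at z ?v c d")
          case True
          then obtain c d where zv: "split_at z ?v c d" by blast
          have d: "d \<noteq> []" using split_atD(8)[OF zv] .
          show ?thesis
            unfolding cw_split_at[OF tv zv] cw_split_at[OF zv tv]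
            using lo[OF z zv] hi[OF z zv] ne[OF z zv] out_lex_hdD[of d "e # b'"] out_lex_hdD[of "e # b'" d] d by auto
        qed (auto simp: cw_def)
        then show ?thesis
          using swap_suffix[OF tv p(2) y] cliqueD(2)[OF cl p(1) z] by blast
      qed
      moreover have "is_source G (fst p)" "awalk (fst p) a ?v"
        using split_atD(1,4)[OF p(2)] by (auto simp: route_def)
      ultimately show ?thesis by blast
    next
      case unvisited: False
      from False vv obtain f where f: "f \<in> arcs G" "head G f = ?v"
        unfolding is_source_def by auto
      have fu: "\<forall>z\<in>\<Delta>. f \<notin> set (snd z)"
        using path_verts_arc[OF cliqueD(1)[OF cl] iv _ f(2)] unvisited by blast
      obtain s a where sa: "is_source G s" "awalk s a (tail G f)"
        and IH: "\<And>b z y. route \<Gamma> (s, a @ f # b) \<Longrightarrow> z \<in> \<Delta> \<Longrightarrow> y \<le> tail G f \<Longrightarrow>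
          \<not> cw y (s, a @ f # b) z \<and> \<not> cw y z (s, a @ f # b)"
        using less.hyps[of f] tail_less_head[OF f(1)] f fu by (metis (no_types, lifting))
      have af: "awalk s (a @ [f]) ?v" using sa f vv by (auto simp: awalk_append awalk_simps)
      have "\<not> cw y (s, (a @ [f]) @ e # b) z \<and> \<not> cw y z (s, (a @ [f]) @ e # b)"
        if t: "route \<Gamma> (s, (a @ [f]) @ e # b)" and z: "z \<in> \<Delta>" and y: "y \<le> ?v" for b z y
      proof (rule ccontr)
        assume "\<not> ?thesis"
        then have h: "cw y (s, (a @ [f]) @ e # b) z \<or> cw y z (s, (a @ [f]) @ e # b)" by blast
        then obtain a0 b0 c d where t0: "split_at (s, (a @ [f]) @ e # b) y a0 b0" and z0: "split_at z y c d"
          unfolding cw_def by blast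
        show False
        proof (cases "y = ?v")
          case True
          with z0 z unvisited show False by blast
        next
          case False
          \<comment> \<open>No vertex of the route lies strictly between the ends of
            \<open>f\<close>, so the conflict is within reach of the induction hypothesis.\<close>
          have "y \<le> tail G f"
          proof (rule ccontr)
            assume "\<not> y \<le> tail G f"
            then have "tail G f \<le> y" by simp
            moreover have "a @ f # e # b = a0 @ b0" "awalk s a0 y" using split_atD(3,4)[OF t0] by simp_all
            ultimately obtain m where m: "f # e # b = m @ b0" "awalk (tail G f) m y"
              using awalk_split_order[of a "f # e # b" a0 b0 s "tail G f" y] sa(2) by blast
            with \<open>\<not> y \<le> tail G f\<close> obtain m' where "m = f # m'" by (cases m) (auto simp: awalk_simps)
            with m(2) have "head G f \<le> y" using awalk_le by (auto simp: awalk_simps)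
            with False f(2) y show False by simp
          qed
          then show False using IH[of "e # b" z y] t z h by simp
        qed
      qed
      with sa(1) af show ?thesis by blast
    qed
  qed
qed

text \<open>Mirror image of \<open>arc_left_extension\<close>: the induction climbs towards the
  largest vertex \<open>n\<close>, and the neighbouring route is selected by its incoming arc and
  lends its suffix.\<close>

lemma arc_right_extension:
  assumes cl: "clique \<Gamma> \<Delta>" and "e \<in> arcs G" "\<forall>z\<in>\<Delta>. e \<notin> set (snd z)"
  shows "\<exists>s b. is_sink G s \<and> awalk (head G e) b s \<and>
    (\<forall>u a z y. route \<Gamma> (u, a @ e # b) \<longrightarrow> awalk u (a @ [e]) (head G e) \<longrightarrow> z \<in> \<Delta> \<longrightarrow> head G e \<le> y \<longrightarrow>
      \<not> cw y (u, a @ e # b) z \<and> \<not> cw y z (u, a @ e # b))"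
proof -
  obtain n where n: "verts G = {1..n}" using verts_eq by blast
  show ?thesis
  using assms(2,3)
proof (induction "n - head G e" arbitrary: e rule: less_induct)
  case less
  let ?v = "head G e"
  have vv: "?v \<in> verts G" using less.prems by simp
  show ?case
  proof (cases "is_sink G ?v")
    case True
    have "\<not> cw y (u, a @ e # []) z \<and> \<not> cw y z (u, a @ e # [])" if "?v \<le> y" "awalk u (a @ [e]) ?v" for u a z y
    proof -
      have "\<not> split_at (u, a @ e # []) y c d" for c d
      proof
        assume h: "split_at (u, a @ e # []) y c d"
        have "d = []" using awalk_split_order[of "a @ [e]" "[]" c d u ?v y] split_atD(3,4)[OF h] that by auto
        with split_atD(8)[OF h] show False by blast
      qed
      then show ?thesis unfolding cw_def by blast
    qed
    with True vv show ?thesis by (intro exI[of _ ?v] exI[of _ "[]"]) (auto simp: awalk_simps)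
  next
    case False
    then have iv: "internal G ?v" using vv less.prems(1) source_no_head unfolding internal_def by blast
    show ?thesis
    proof (cases "\<exists>z\<in>\<Delta>. \<exists>c d. split_at z ?v c d")
      case True
      have ne: "last c \<noteq> e" if "z \<in> \<Delta>" "split_at z ?v c d" for z c d
        using less.prems(2) split_atD(3,7)[OF that(2)] that(1) by auto
      obtain p a b where p: "p \<in> \<Delta>" "split_at p ?v a b"
        and lo: "\<And>z c d. z \<in> \<Delta> \<Longrightarrow> split_at z ?v c d \<Longrightarrow> (last c, e) \<in> in_rel \<Gamma> \<Longrightarrow> \<not> out_lex b d"
        and hi: "\<And>z c d. z \<in> \<Delta> \<Longrightarrow> split_at z ?v c d \<Longrightarrow> (e, last c) \<in> in_rel \<Gamma> \<Longrightarrow> \<not> out_lex d b"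
      proof -
        let ?S1 = "{d. \<exists>z c. z \<in> \<Delta> \<and> split_at z ?v c d \<and> (last c, e) \<in> in_rel \<Gamma>}"
        let ?S0 = "{d. \<exists>z c. z \<in> \<Delta> \<and> split_at z ?v c d}"
        show ?thesis
        proof (cases "?S1 = {}")
          case S1: False
          have "?S1 \<subseteq> {b. snk_path ?v b}" using split_atD(6) by blast
          from ex_out_lex_min_max(2)[OF S1 this iv] obtain b where b: "b \<in> ?S1" "\<forall>x\<in>?S1. x = b \<or> out_lex x b"
            by blast
          from b(1) obtain p a where p: "p \<in> \<Delta>" "split_at p ?v a b" "(last a, e) \<in> in_rel \<Gamma>" by blast
          show ?thesis
          proof (rule that[OF p(1,2)])
            fix z c d assume z: "z \<in> \<Delta>" "split_at z ?v c d"
            show "\<not> out_lex b d" if "(last c, e) \<in> in_rel \<Gamma>"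
            proof -
              have "d \<in> ?S1" using z that by blast
              with b(2) show ?thesis using out_lex_asym by fastforce
            qed
            show "\<not> out_lex d b" if "(e, last c) \<in> in_rel \<Gamma>"
            proof -
              have "(last a, last c) \<in> in_rel \<Gamma>" using transD[OF trans_in_rel] p(3) that by blast
              then have "in_lex a c" using in_lex_lastI split_atD(7) p(2) z(2) by blast
              then show ?thesis using clique_out_lex[OF cl p(1) z(1) p(2) z(2)] out_lex_asym by fastforce
            qed
          qed
        next
          case S1: True
          have "?S0 \<noteq> {}" "?S0 \<subseteq> {b. snk_path ?v b}" using True split_atD(6) by blast+
          from ex_out_lex_min_max(1)[OF this iv] obtain b where b: "b \<in> ?S0" "\<forall>x\<in>?S0. x = b \<or> out_lex b x"
            by blast
          from b(1) obtain p a where p: "p \<in> \<Delta>" "split_at p ?v a b" by blast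
          show ?thesis
          proof (rule that[OF p(1,2)])
            fix z c d assume z: "z \<in> \<Delta>" "split_at z ?v c d"
            show "\<not> out_lex b d" if "(last c, e) \<in> in_rel \<Gamma>" using z that S1 by blast
            have "d \<in> ?S0" using z by blast
            with b(2) show "\<not> out_lex d b" using out_lex_asym by fastforce
          qed
        qed
      qed
      have "\<not> cw y (u, a' @ e # b) z \<and> \<not> cw y z (u, a' @ e # b)"
        if t: "route \<Gamma> (u, a' @ e # b)" and u: "awalk u (a' @ [e]) ?v" and z: "z \<in> \<Delta>" and y: "?v \<le> y" for u a' z y
      proof -
        have tv: "split_at (u, a' @ e # b) ?v (a' @ [e]) b"
          unfolding split_at_def using t iv u by simp
        have "\<not> cw ?v (u, a' @ e # b) z \<and> \<not> cw ?v z (u, a' @ e # b)"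
        proof (cases "\<exists>c d. split_at z ?v c d")
          case True
          then obtain c d where zv: "split_at z ?v c d" by blast
          have c: "c \<noteq> []" using split_atD(7)[OF zv] .
          show ?thesis
            unfolding cw_split_at[OF tv zv] cw_split_at[OF zv tv]
            using lo[OF z zv] hi[OF z zv] ne[OF z zv] in_lex_lastD[of c "a' @ [e]"] in_lex_lastD[of "a' @ [e]" c] c by auto
        qed (auto simp: cw_def)
        then show ?thesis
          using swap_prefix[OF tv p(2) y] cliqueD(2)[OF cl p(1) z] by blast
      qed
      moreover have "snk_path ?v b" using split_atD(6)[OF p(2)] .
      ultimately show ?thesis by blast
    next
      case unvisited: False
      from False vv obtain f where f: "f \<in> arcs G" "tail G f = ?v"
        unfolding is_sink_def by auto
      have fu: "\<forall>z\<in>\<Delta>. f \<notin> set (snd z)"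
      proof
        fix z assume z: "z \<in> \<Delta>"
        show "f \<notin> set (snd z)"
        proof
          assume "f \<in> set (snd z)"
          then obtain x y where xy: "snd z = x @ f # y" by (meson split_list)
          with cliqueD(1)[OF cl z] have "awalk (fst z) x ?v"
            unfolding route_def dipath_def using f(2) by (auto simp: awalk_append awalk_simps)
          then have "split_at z ?v x (f # y)" unfolding split_at_def using xy cliqueD(1)[OF cl z] iv by blast
          with unvisited z show False by blast
        qed
      qed
      have "head G f \<in> verts G" using f by simp
      then have "n - head G f < n - head G e" using tail_less_head[OF f(1)] f(2) n by auto
      then obtain s b where sb: "is_sink G s" "awalk (head G f) b s"
        and IH: "\<And>u a z y. route \<Gamma> (u, a @ f # b) \<Longrightarrow> awalk u (a @ [f]) (head G f) \<Longrightarrow> z \<in> \<Delta> \<Longrightarrow> head G f \<le> y \<Longrightarrow>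
          \<not> cw y (u, a @ f # b) z \<and> \<not> cw y z (u, a @ f # b)"
        using less.hyps[of f] f fu by (metis (no_types, lifting))
      have fb: "awalk ?v (f # b) s" using sb f by (auto simp: awalk_simps)
      have "\<not> cw y (u, a @ e # f # b) z \<and> \<not> cw y z (u, a @ e # f # b)"
        if t: "route \<Gamma> (u, a @ e # f # b)" and u: "awalk u (a @ [e]) ?v" and z: "z \<in> \<Delta>" and y: "?v \<le> y" for u a z y
      proof (rule ccontr)
        assume "\<not> ?thesis"
        then have h: "cw y (u, a @ e # f # b) z \<or> cw y z (u, a @ e # f # b)" by blast
        then obtain a0 b0 c d where t0: "split_at (u, a @ e # f # b) y a0 b0" and z0: "split_at z y c d"
          unfolding cw_def by blast
        show False
        proof (cases "y = ?v")
          case True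
          with z0 z unvisited show False by blast
        next
          case False
          have "(a @ [e]) @ f # b = a0 @ b0" "awalk u a0 y" using split_atD(3,4)[OF t0] by simp_all
          then obtain m where m: "f # b = m @ b0" "awalk ?v m y"
            using awalk_split_order[of "a @ [e]" "f # b" a0 b0 u ?v y] u y by blast
          with False obtain m' where "m = f # m'" by (cases m) (auto simp: awalk_simps)
          with m(2) have "head G f \<le> y" using awalk_le by (auto simp: awalk_simps)
          moreover have "awalk u ((a @ [e]) @ [f]) (head G f)"
            using u f \<open>head G f \<in> verts G\<close> awalk_append[of u "a @ [e]" "[f]"] by (auto simp: awalk_simps)
          ultimately show False using IH[of u "a @ [e]" z y] t z h by simp
        qed
      qed
      with sb(1) fb show ?thesis by blast
    qed
  qed
qed
qed

lemma maximal_arc_used: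
  assumes mc: "maximal_clique \<Gamma> \<Delta>" and e: "e \<in> arcs G"
  shows "\<exists>r\<in>\<Delta>. e \<in> set (snd r)"
proof (rule ccontr)
  assume "\<not> ?thesis"
  then have un: "\<forall>z\<in>\<Delta>. e \<notin> set (snd z)" by blast
  have cl: "clique \<Gamma> \<Delta>" using mc maximalD by blast
  obtain s a where a: "is_source G s" "awalk s a (tail G e)"
    and L: "\<And>b z y. route \<Gamma> (s, a @ e # b) \<Longrightarrow> z \<in> \<Delta> \<Longrightarrow> y \<le> tail G e \<Longrightarrow>
      \<not> cw y (s, a @ e # b) z \<and> \<not> cw y z (s, a @ e # b)"
    using arc_left_extension[OF cl e un] by blast
  obtain t b where b: "is_sink G t" "awalk (head G e) b t"
    and R: "\<And>u a z y. route \<Gamma> (u, a @ e # b) \<Longrightarrow> awalk u (a @ [e]) (head G e) \<Longrightarrow> z \<in> \<Delta> \<Longrightarrow> head G e \<le> y \<Longrightarrow>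
      \<not> cw y (u, a @ e # b) z \<and> \<not> cw y z (u, a @ e # b)"
    using arc_right_extension[OF cl e un] by blast
  let ?t = "(s, a @ e # b)"
  have ae: "awalk s (a @ [e]) (head G e)" using a(2) e head_in_verts[OF e] by (auto simp: awalk_append awalk_simps)
  have "awalk s (a @ e # b) t" using a(2) b(2) e by (auto simp: awalk_append awalk_simps)
  then have rt: "route \<Gamma> ?t" unfolding route_def dipath_def using a(1) b(1) by auto
  have "?t \<in> \<Delta>"
  proof (rule maximal_memI[OF mc rt], rule allI)
    fix z y assume z: "z \<in> \<Delta>"
    show "\<not> cw y ?t z \<and> \<not> cw y z ?t"
    proof (rule ccontr)
      assume h: "\<not> ?thesis"
      then obtain a0 b0 where t0: "split_at ?t y a0 b0" unfolding cw_def by blast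
      have n: "\<not> y \<le> tail G e" "\<not> head G e \<le> y" using h L[OF rt z] R[OF rt ae z] by blast+
      have "a @ e # b = a0 @ b0" "awalk s a0 y" using split_atD(3,4)[OF t0] by simp_all
      then obtain m where m: "e # b = m @ b0" "awalk (tail G e) m y"
        using awalk_split_order[of a "e # b" a0 b0 s "tail G e" y] a(2) n(1) by auto
      with n(1) obtain m' where "m = e # m'" by (cases m) (auto simp: awalk_simps)
      with m(2) have "head G e \<le> y" using awalk_le by (auto simp: awalk_simps)
      with n(2) show False by simp
    qed
  qed
  with un show False by auto
qed

lemma maximal_in_arc:
  assumes "maximal_clique \<Gamma> \<Delta>" "internal G v" "e \<in> in_arcs G v"
  obtains r a b where "r \<in> \<Delta>" "split_at r v a b" "last a = e"
proof -
  obtain r where "r \<in> \<Delta>" "e \<in> set (snd r)" using maximal_arc_used[OF assms(1), of e] assms(3) by fastforce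
  moreover have "route \<Gamma> r" using cliqueD(1) maximalD assms(1) \<open>r \<in> \<Delta>\<close> by blast
  ultimately show ?thesis using path_verts_arc[OF _ assms(2)] assms(3) that by (metis in_in_arcs_conv)
qed

lemma maximal_out_arc:
  assumes "maximal_clique \<Gamma> \<Delta>" "internal G v" "e \<in> out_arcs G v"
  obtains r a b where "r \<in> \<Delta>" "split_at r v a b" "hd b = e"
proof -
  obtain r where r: "r \<in> \<Delta>" "e \<in> set (snd r)" using maximal_arc_used[OF assms(1), of e] assms(3) by fastforce
  then have rt: "route \<Gamma> r" using cliqueD(1) maximalD assms(1) by blast
  obtain x y where xy: "snd r = x @ e # y" using r(2) by (meson split_list)
  with rt have "awalk (fst r) x v"
    unfolding route_def dipath_def using assms(3) by (auto simp: awalk_append awalk_simps)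
  then have "split_at r v x (e # y)" unfolding split_at_def using xy rt assms(2) by blast
  with r(1) show ?thesis using that by simp
qed

section \<open>Cornering suffixes and the coordinates they determine\<close>

text \<open>A relational stand-in for \<open>cornering_subroute\<close>. No extremality of the two
  routes is asked for: in a clique, any suffix shared by a route through \<open>d\<close> and a
  route through \<open>u\<close> is already the right one
  (\<open>corner_suffix_unique\<close>).\<close>

definition corner_suffix :: "'e dipath set \<Rightarrow> nat \<Rightarrow> 'e \<Rightarrow> 'e \<Rightarrow> 'e list \<Rightarrow> bool" where
  "corner_suffix \<Delta> v d u \<sigma> \<longleftrightarrow> (\<exists>r\<in>\<Delta>. \<exists>q\<in>\<Delta>. \<exists>a a'. split_at r v a \<sigma> \<and> split_at q v a' \<sigma> \<and> last a = d \<and> last a' = u)"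

lemma left_cornerD:
  assumes "left_corner \<Gamma> (v, d, u)"
  shows "internal G v" "d \<in> in_arcs G v" "u \<in> in_arcs G v" "(d, u) \<in> in_rel \<Gamma>"
    "e \<in> in_arcs G v \<Longrightarrow> e = d \<or> e = u \<or> (e, d) \<in> in_rel \<Gamma> \<or> (u, e) \<in> in_rel \<Gamma>"
proof -
  show 1: "internal G v" "d \<in> in_arcs G v" "u \<in> in_arcs G v" "(d, u) \<in> in_rel \<Gamma>"
    using assms in_ordD(7) by auto
  assume e: "e \<in> in_arcs G v"
  then have "\<not> ((d, e) \<in> in_rel \<Gamma> \<and> (e, u) \<in> in_rel \<Gamma>)"
    using assms by (auto simp: in_rel_iff)
  then show "e = d \<or> e = u \<or> (e, d) \<in> in_rel \<Gamma> \<or> (u, e) \<in> in_rel \<Gamma>"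
    using in_total[OF 1(1) e 1(2)] in_total[OF 1(1) e 1(3)] by blast
qed

text \<open>\<open>x\<close> is compared with the witness that enters by the opposite arc
  \<open>u\<close>. That prefix is strictly larger even if \<open>x\<close> itself enters by
  \<open>d\<close>, so coherence orders the suffixes.\<close>

lemma corner_suffix_lower:
  assumes cl: "clique \<Gamma> \<Delta>" and c: "corner_suffix \<Delta> v d u \<sigma>" and du: "(d, u) \<in> in_rel \<Gamma>"
    and x: "x \<in> \<Delta>" "split_at x v a b" "last a = d \<or> (last a, d) \<in> in_rel \<Gamma>"
  shows "b = \<sigma> \<or> out_lex b \<sigma>"
proof -
  obtain q a' where q: "q \<in> \<Delta>" "split_at q v a' \<sigma>" "last a' = u" using c unfolding corner_suffix_def by blast
  have "(last a, u) \<in> in_rel \<Gamma>" using x(3) du transD[OF trans_in_rel] by blast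
  then have "in_lex a a'" using in_lex_lastI[of a a'] split_atD(7)[OF x(2)] split_atD(7)[OF q(2)] q(3) by simp
  then show ?thesis using clique_out_lex[OF cl x(1) q(1) x(2) q(2)] by blast
qed

lemma corner_suffix_upper:
  assumes cl: "clique \<Gamma> \<Delta>" and c: "corner_suffix \<Delta> v d u \<sigma>" and du: "(d, u) \<in> in_rel \<Gamma>"
    and x: "x \<in> \<Delta>" "split_at x v a b" "last a = u \<or> (u, last a) \<in> in_rel \<Gamma>"
  shows "b = \<sigma> \<or> out_lex \<sigma> b"
proof -
  obtain q a' where q: "q \<in> \<Delta>" "split_at q v a' \<sigma>" "last a' = d" using c unfolding corner_suffix_def by blast
  have "(d, last a) \<in> in_rel \<Gamma>" using x(3) du transD[OF trans_in_rel] by blast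
  then have "in_lex a' a" using in_lex_lastI[of a' a] split_atD(7)[OF x(2)] split_atD(7)[OF q(2)] q(3) by simp
  then show ?thesis using clique_out_lex[OF cl q(1) x(1) q(2) x(2)] by blast
qed

lemma corner_suffix_unique:
  assumes cl: "clique \<Gamma> \<Delta>" and c: "corner_suffix \<Delta> v d u \<sigma>" "corner_suffix \<Delta> v d u \<tau>" and du: "(d, u) \<in> in_rel \<Gamma>"
  shows "\<sigma> = \<tau>"
proof -
  obtain r a q a' where "r \<in> \<Delta>" "split_at r v a \<tau>" "last a = d" "q \<in> \<Delta>" "split_at q v a' \<tau>" "last a' = u"
    using c(2) unfolding corner_suffix_def by blast
  then show ?thesis using corner_suffix_lower[OF cl c(1) du] corner_suffix_upper[OF cl c(1) du] out_lex_asym by blast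
qed

text \<open>Maximality is what makes the two cornering routes coincide after \<open>v\<close>: if
  the suffix of the upper one were larger, it could be attached to the prefix of the lower one
  without conflict, and the lower one would not be extremal.\<close>

lemma corner_suffix_extremal:
  assumes mc: "maximal_clique \<Gamma> \<Delta>" and lc: "left_corner \<Gamma> (v, d, u)"
  obtains r q a a' \<sigma> where "r \<in> \<Delta>" "q \<in> \<Delta>" "split_at r v a \<sigma>" "split_at q v a' \<sigma>" "last a = d" "last a' = u"
    "\<forall>x\<in>\<Delta>. \<forall>c y. split_at x v c y \<longrightarrow> last c = d \<longrightarrow> (c = a \<or> in_lex c a) \<and> (y = \<sigma> \<or> out_lex y \<sigma>)"
    "\<forall>x\<in>\<Delta>. \<forall>c y. split_at x v c y \<longrightarrow> last c = u \<longrightarrow> (a' = c \<or> in_lex a' c) \<and> (\<sigma> = y \<or> out_lex \<sigma> y)"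
    "corner_suffix \<Delta> v d u \<sigma>"
proof -
  note lcD = left_cornerD[OF lc]
  note iv = lcD(1)
  have cl: "clique \<Gamma> \<Delta>" using mc maximalD by blast
  let ?A = "{c. \<exists>x y. x \<in> \<Delta> \<and> split_at x v c y \<and> last c = d}"
  have "?A \<noteq> {}" "?A \<subseteq> {a. src_path a v}"
    using maximal_in_arc[OF mc iv lcD(2)] split_atD(5) by blast+
  from ex_in_lex_min_max(2)[OF this iv] obtain a where a: "a \<in> ?A" "\<forall>c\<in>?A. c = a \<or> in_lex c a" by blast
  let ?B = "{y. \<exists>x. x \<in> \<Delta> \<and> split_at x v a y}"
  have "?B \<noteq> {}" "?B \<subseteq> {b. snk_path v b}" using a(1) split_atD(6) by blast+
  from ex_out_lex_min_max(2)[OF this iv] obtain b where b: "b \<in> ?B" "\<forall>y\<in>?B. y = b \<or> out_lex y b" by blast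
  then obtain r where r: "r \<in> \<Delta>" "split_at r v a b" by blast
  let ?A' = "{c. \<exists>x y. x \<in> \<Delta> \<and> split_at x v c y \<and> last c = u}"
  have "?A' \<noteq> {}" "?A' \<subseteq> {a. src_path a v}"
    using maximal_in_arc[OF mc iv lcD(3)] split_atD(5) by blast+
  from ex_in_lex_min_max(1)[OF this iv] obtain a' where a': "a' \<in> ?A'" "\<forall>c\<in>?A'. c = a' \<or> in_lex a' c" by blast
  let ?B' = "{y. \<exists>x. x \<in> \<Delta> \<and> split_at x v a' y}"
  have "?B' \<noteq> {}" "?B' \<subseteq> {b. snk_path v b}" using a'(1) split_atD(6) by blast+
  from ex_out_lex_min_max(1)[OF this iv] obtain b' where b': "b' \<in> ?B'" "\<forall>y\<in>?B'. y = b' \<or> out_lex b' y" by blast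
  then obtain q where q: "q \<in> \<Delta>" "split_at q v a' b'" by blast
  have la: "last a = d" "last a' = u" using a(1) a'(1) by blast+
  then have aa': "in_lex a a'" using in_lex_lastI split_atD(7)[OF r(2)] split_atD(7)[OF q(2)] lcD(4) by blast
  have bb': "b = b' \<or> out_lex b b'" using clique_out_lex[OF cl r(1) q(1) r(2) q(2) aa'] .
  let ?t = "(fst r, a @ b')"
  have tv: "split_at ?t v a b'" using split_at_splice[OF r(2) q(2)] .
  have "?t \<in> \<Delta>"
  proof (rule maximal_memI[OF mc split_atD(1)[OF tv]])
    fix z assume z: "z \<in> \<Delta>"
    have "\<not> cw v ?t z \<and> \<not> cw v z ?t"
    proof (cases "\<exists>c y. split_at z v c y")
      case True
      then obtain c y where zv: "split_at z v c y" by blast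
      \<comment> \<open>Here it matters that \<open>d\<close> and \<open>u\<close> are consecutive:
        a prefix above \<open>a\<close> cannot end in \<open>d\<close>, so it ends in
        \<open>u\<close> or higher and is at least \<open>a'\<close>. Its suffix is then at least
        \<open>b'\<close>.\<close>
      have "\<not> (in_lex a c \<and> out_lex y b')"
      proof
        assume h: "in_lex a c \<and> out_lex y b'"
        have "last c \<noteq> d" using a(2) z zv h in_lex_asym by fastforce
        then have "(d, last c) \<in> in_rel \<Gamma>"
          using h in_lex_lastD[of a c] split_atD(7)[OF zv] split_atD(7)[OF r(2)] la by auto
        then have "\<not> (last c, d) \<in> in_rel \<Gamma>" "last c \<in> in_arcs G v"
          using transD[OF trans_in_rel] irrefl_in_rel split_atD(9,10)[OF zv] unfolding irrefl_def by auto
        then have "last c = u \<or> (u, last c) \<in> in_rel \<Gamma>" using lcD(5) \<open>last c \<noteq> d\<close> by blast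
        then have "c = a' \<or> in_lex a' c"
          using a'(2) z zv in_lex_lastI[of a' c] split_atD(7)[OF zv] split_atD(7)[OF q(2)] la by blast
        then have "y = b' \<or> out_lex b' y"
          using clique_out_lex[OF cl q(1) z q(2) zv] b'(2) z zv by blast
        with h show False using out_lex_asym by auto
      qed
      moreover have "\<not> (in_lex c a \<and> out_lex b' y)"
        using clique_out_lex[OF cl z r(1) zv r(2)] bb' out_lex_trans out_lex_asym by blast
      ultimately show ?thesis unfolding cw_split_at[OF tv zv] cw_split_at[OF zv tv] by blast
    qed (auto simp: cw_def)
    then show "coh ?t z"
      using tv r(2) q(2) cliqueD(2)[OF cl z r(1)] cliqueD(2)[OF cl z q(1)] by (rule coh_splice)
  qed
  with tv have "b' = b \<or> out_lex b' b" using b(2) by blast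
  with bb' have bb: "b' = b" using out_lex_asym by blast
  have co: "corner_suffix \<Delta> v d u b" unfolding corner_suffix_def using r q la bb by blast
  show ?thesis
  proof (rule that[OF r(1) q(1) r(2) _ la])
    show "split_at q v a' b" using q bb by simp
    show "corner_suffix \<Delta> v d u b" by (rule co)
    show "\<forall>x\<in>\<Delta>. \<forall>c y. split_at x v c y \<longrightarrow> last c = d \<longrightarrow> (c = a \<or> in_lex c a) \<and> (y = b \<or> out_lex y b)"
    proof (intro ballI allI impI)
      fix x c y assume x: "x \<in> \<Delta>" "split_at x v c y" "last c = d"
      have "c \<in> ?A" by (rule CollectI, intro exI conjI) (rule x)+
      then have "c = a \<or> in_lex c a" using a(2) by (rule bspec[rotated])
      with corner_suffix_lower[OF cl co lcD(4) x(1,2)] x(3) show "(c = a \<or> in_lex c a) \<and> (y = b \<or> out_lex y b)" by simp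
    qed
    show "\<forall>x\<in>\<Delta>. \<forall>c y. split_at x v c y \<longrightarrow> last c = u \<longrightarrow> (a' = c \<or> in_lex a' c) \<and> (b = y \<or> out_lex b y)"
    proof (intro ballI allI impI)
      fix x c y assume x: "x \<in> \<Delta>" "split_at x v c y" "last c = u"
      have "c \<in> ?A'" by (rule CollectI, intro exI conjI) (rule x)+
      then have "c = a' \<or> in_lex a' c" using a'(2) by (rule bspec[rotated])
      with corner_suffix_upper[OF cl co lcD(4) x(1,2)] x(3) show "(a' = c \<or> in_lex a' c) \<and> (b = y \<or> out_lex b y)" by auto
    qed
  qed
qed

lemma route_le_split_at: "split_at r v a b \<Longrightarrow> split_at t v a' b' \<Longrightarrow>
    route_le \<Gamma> v r t \<longleftrightarrow> (a = a' \<or> in_lex a a') \<and> (b = b' \<or> out_lex b b')"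
  unfolding route_le_def in_le_def out_le_def in_less_def out_less_def
  by (simp add: split_at_prefix split_at_suffix)

text \<open>The definite descriptions are resolved by antisymmetry: two routes that bound each other
  at \<open>v\<close> have equal halves there, hence are equal.\<close>

lemma cornering_subroute_corner_suffix:
  assumes mc: "maximal_clique \<Gamma> \<Delta>" and lc: "left_corner \<Gamma> (v, d, u)" and co: "corner_suffix \<Delta> v d u \<sigma>"
  shows "cornering_subroute \<Gamma> \<Delta> (v, d, u) = ((v, d, u), \<sigma>)"
proof -
  note lcD = left_cornerD[OF lc]
  have cl: "clique \<Gamma> \<Delta>" using mc maximalD by blast
  have split_at_arc: "\<exists>c y. split_at x v c y \<and> last c = e" if "x \<in> \<Delta>" "e \<in> set (snd x)" "e \<in> in_arcs G v" for x e
    using path_verts_arc[OF cliqueD(1)[OF cl that(1)] lcD(1) that(2)] that(3) by simp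
  obtain r q a a' \<sigma>' where h: "r \<in> \<Delta>" "q \<in> \<Delta>" "split_at r v a \<sigma>'" "split_at q v a' \<sigma>'" "last a = d" "last a' = u"
    and L: "\<forall>x\<in>\<Delta>. \<forall>c y. split_at x v c y \<longrightarrow> last c = d \<longrightarrow> (c = a \<or> in_lex c a) \<and> (y = \<sigma>' \<or> out_lex y \<sigma>')"
    and U: "\<forall>x\<in>\<Delta>. \<forall>c y. split_at x v c y \<longrightarrow> last c = u \<longrightarrow> (a' = c \<or> in_lex a' c) \<and> (\<sigma>' = y \<or> out_lex \<sigma>' y)"
    and co': "corner_suffix \<Delta> v d u \<sigma>'"
    by (rule corner_suffix_extremal[OF mc lc])
  have [simp]: "\<sigma>' = \<sigma>" using corner_suffix_unique[OF cl co' co lcD(4)] .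
  have dr: "d \<in> set (snd r)" and uq: "u \<in> set (snd q)"
    using split_at_in_arc[OF h(3) lcD(2)] split_at_in_arc[OF h(4) lcD(3)] h(5,6) by simp_all
  have lo: "route_le \<Gamma> v x r" if x: "x \<in> \<Delta>" "d \<in> set (snd x)" for x
  proof -
    obtain c y where "split_at x v c y" "last c = d" using split_at_arc[OF x lcD(2)] by blast
    then show ?thesis using route_le_split_at[OF _ h(3)] L x(1) by simp
  qed
  have up: "route_le \<Gamma> v q x" if x: "x \<in> \<Delta>" "u \<in> set (snd x)" for x
  proof -
    obtain c y where "split_at x v c y" "last c = u" using split_at_arc[OF x lcD(3)] by blast
    then show ?thesis using route_le_split_at[OF h(4)] U x(1) by simp
  qed
  have anti: "x = z" if "x \<in> \<Delta>" "z \<in> \<Delta>" "split_at x v c y" "split_at z v c' y'" "route_le \<Gamma> v x z" "route_le \<Gamma> v z x" for x z c y c' y'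
  proof -
    have "c = c'" "y = y'"
      using that(5,6) in_lex_asym out_lex_asym unfolding route_le_split_at[OF that(3,4)] route_le_split_at[OF that(4,3)] by blast+
    then show ?thesis using that split_at_same by blast
  qed
  have "lower_cornering \<Gamma> \<Delta> (v, d, u) = r"
    unfolding lower_cornering.simps
  proof (rule the_equality)
    show "r \<in> \<Delta> \<and> d \<in> set (snd r) \<and> (\<forall>x\<in>\<Delta>. d \<in> set (snd x) \<longrightarrow> route_le \<Gamma> v x r)"
      using h dr lo by blast
    fix x assume x: "x \<in> \<Delta> \<and> d \<in> set (snd x) \<and> (\<forall>q\<in>\<Delta>. d \<in> set (snd q) \<longrightarrow> route_le \<Gamma> v q x)"
    then obtain c y where "split_at x v c y" using split_at_arc[OF _ _ lcD(2)] by blast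
    then show "x = r" using x anti[OF _ h(1) _ h(3)] lo h(1) dr by blast
  qed
  moreover have "upper_cornering \<Gamma> \<Delta> (v, d, u) = q"
    unfolding upper_cornering.simps
  proof (rule the_equality)
    show "q \<in> \<Delta> \<and> u \<in> set (snd q) \<and> (\<forall>x\<in>\<Delta>. u \<in> set (snd x) \<longrightarrow> route_le \<Gamma> v q x)"
      using h uq up by blast
    fix x assume x: "x \<in> \<Delta> \<and> u \<in> set (snd x) \<and> (\<forall>q\<in>\<Delta>. u \<in> set (snd q) \<longrightarrow> route_le \<Gamma> v x q)"
    then obtain c y where "split_at x v c y" using split_at_arc[OF _ _ lcD(3)] by blast
    then show "x = q" using x anti[OF _ h(2) _ h(4)] up h(2) uq by blast
  qed
  ultimately show ?thesis
    unfolding cornering_subroute_def using split_at_suffix[OF h(3)] split_at_suffix[OF h(4)] by simp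
qed

lemma CC_L_corner_suffix:
  assumes "maximal_clique \<Gamma> \<Delta>" "left_corner \<Gamma> (v, d, u)" "corner_suffix \<Delta> v d u \<sigma>"
  shows "CC_L \<Gamma> \<Delta> (v, d, u) = card {b. snk_path v b \<and> out_lex \<sigma> b}"
proof -
  have "{t \<in> left_cornered_routes \<Gamma> (v, d, u). cornered_less \<Gamma> ((v, d, u), \<sigma>) t} =
      Pair (v, d, u) ` {b. snk_path v b \<and> out_lex \<sigma> b}"
    unfolding left_cornered_routes_def cornered_less_def dipath_def by auto
  then show ?thesis
    unfolding CC_L_def cornering_subroute_corner_suffix[OF assms] by (simp add: card_image inj_on_def)
qed

lemma corner_suffix_snk_path: "corner_suffix \<Delta> v d u \<sigma> \<Longrightarrow> snk_path v \<sigma>"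
  unfolding corner_suffix_def using split_atD(6) by blast

text \<open>A corank in a finite linear order is strictly antitone, since the larger path is itself
  counted for the smaller one and not for itself. Hence the reversed inequality between
  suffixes.\<close>

lemma CC_L_le_iff:
  assumes mc: "maximal_clique \<Gamma> \<Delta>" "maximal_clique \<Gamma> \<Delta>'" and lc: "left_corner \<Gamma> (v, d, u)"
    and co: "corner_suffix \<Delta> v d u \<sigma>" "corner_suffix \<Delta>' v d u \<sigma>'"
  shows "CC_L \<Gamma> \<Delta> (v, d, u) \<le> CC_L \<Gamma> \<Delta>' (v, d, u) \<longleftrightarrow> \<sigma>' = \<sigma> \<or> out_lex \<sigma>' \<sigma>"
proof -
  let ?S = "\<lambda>\<sigma>. {b. snk_path v b \<and> out_lex \<sigma> b}"
  have f: "finite (?S x)" for x using finite_snk_paths finite_subset by (metis (no_types, lifting) Collect_mono)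
  have strict: "card (?S y) < card (?S x)" if "out_lex x y" "snk_path v y" for x y
  proof (rule psubset_card_mono[OF f], rule psubsetI)
    show "?S y \<subseteq> ?S x" using that out_lex_trans by blast
    show "?S y \<noteq> ?S x" using that out_lex_irrefl by blast
  qed
  note s = corner_suffix_snk_path[OF co(1)] corner_suffix_snk_path[OF co(2)]
  consider "\<sigma>' = \<sigma>" | "out_lex \<sigma>' \<sigma>" | "out_lex \<sigma> \<sigma>'"
    using out_lex_total[OF s _ left_cornerD(1)[OF lc]] by blast
  then show ?thesis
    unfolding CC_L_corner_suffix[OF mc(1) lc co(1)] CC_L_corner_suffix[OF mc(2) lc co(2)]
  proof cases
    case 2
    then show "card (?S \<sigma>) \<le> card (?S \<sigma>') \<longleftrightarrow> \<sigma>' = \<sigma> \<or> out_lex \<sigma>' \<sigma>"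
      using strict[OF 2 s(1)] by simp
  next
    case 3
    then show "card (?S \<sigma>) \<le> card (?S \<sigma>') \<longleftrightarrow> \<sigma>' = \<sigma> \<or> out_lex \<sigma>' \<sigma>"
      using strict[OF 3 s(2)] out_lex_asym[OF 3] by fastforce
  qed simp
qed

section \<open>Comparing cornering suffixes\<close>

text \<open>Diverging prefixes yield an arbitrary pair of incoming arcs, whereas a left corner needs
  consecutive ones. The least arc above \<open>d\<close> completes a corner without passing
  \<open>e\<close>.\<close>

lemma corner_above:
  assumes iv: "internal G v" and "d \<in> in_arcs G v" "e \<in> in_arcs G v" "(d, e) \<in> in_rel \<Gamma>"
  obtains u where "left_corner \<Gamma> (v, d, u)" "u = e \<or> (u, e) \<in> in_rel \<Gamma>"
proof -
  let ?S = "{x \<in> in_arcs G v. (d, x) \<in> in_rel \<Gamma>}"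
  have "finite ?S" by simp
  moreover have "?S \<noteq> {}" using assms by blast
  moreover have "asymp_on ?S (\<lambda>x y. (x, y) \<in> in_rel \<Gamma>)" "transp_on ?S (\<lambda>x y. (x, y) \<in> in_rel \<Gamma>)"
    using transD[OF trans_in_rel] irrefl_in_rel unfolding asymp_on_def transp_on_def irrefl_def by blast+
  ultimately obtain u where u: "u \<in> ?S" "\<forall>x\<in>?S. x \<noteq> u \<longrightarrow> (x, u) \<notin> in_rel \<Gamma>"
    using Finite_Set.bex_min_element[of ?S "\<lambda>x y. (x, y) \<in> in_rel \<Gamma>"] by blast
  have "(d, x) \<notin> in_ord \<Gamma> v" if "x \<in> in_arcs G v" "(x, u) \<in> in_ord \<Gamma> v" for x
  proof
    assume "(d, x) \<in> in_ord \<Gamma> v"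
    then have "x \<in> ?S" using that(1) in_ordD(7)[OF iv] by simp
    from bspec[OF u(2) this] in_ordD(5,7)[OF iv that(2)] show False by metis
  qed
  then have "left_corner \<Gamma> (v, d, u)"
    using assms u(1) by (auto simp: in_rel_iff)
  moreover have "u = e \<or> (u, e) \<in> in_rel \<Gamma>" using u(1) bspec[OF u(2), of e] assms in_total[OF iv, of u e] by auto
  ultimately show ?thesis using that by blast
qed

lemma corner_below:
  assumes iv: "internal G v" and "d \<in> in_arcs G v" "e \<in> in_arcs G v" "(d, e) \<in> in_rel \<Gamma>"
  obtains d' where "left_corner \<Gamma> (v, d', e)" "d' = d \<or> (d, d') \<in> in_rel \<Gamma>"
proof -
  let ?S = "{x \<in> in_arcs G v. (x, e) \<in> in_rel \<Gamma>}"
  have "finite ?S" by simp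
  moreover have "?S \<noteq> {}" using assms by blast
  moreover have "asymp_on ?S (\<lambda>x y. (x, y) \<in> in_rel \<Gamma>)" "transp_on ?S (\<lambda>x y. (x, y) \<in> in_rel \<Gamma>)"
    using transD[OF trans_in_rel] irrefl_in_rel unfolding asymp_on_def transp_on_def irrefl_def by blast+
  ultimately obtain u where u: "u \<in> ?S" "\<forall>x\<in>?S. x \<noteq> u \<longrightarrow> (u, x) \<notin> in_rel \<Gamma>"
    using Finite_Set.bex_max_element[of ?S "\<lambda>x y. (x, y) \<in> in_rel \<Gamma>"] by blast
  have "(x, e) \<notin> in_ord \<Gamma> v" if "x \<in> in_arcs G v" "(u, x) \<in> in_ord \<Gamma> v" for x
  proof
    assume "(x, e) \<in> in_ord \<Gamma> v"
    then have "x \<in> ?S" using that(1) in_ordD(7)[OF iv] by simp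
    from bspec[OF u(2) this] in_ordD(5,7)[OF iv that(2)] show False by metis
  qed
  then have "left_corner \<Gamma> (v, u, e)"
    using assms u(1) by (auto simp: in_rel_iff)
  moreover have "u = d \<or> (d, u) \<in> in_rel \<Gamma>" using u(1) bspec[OF u(2), of d] assms in_total[OF iv, of u d] by auto
  ultimately show ?thesis using that by blast
qed

section \<open>Comparing maximal cliques corner by corner\<close>

text \<open>The suffixes are compared in the opposite direction because coordinates are
  coranks.\<close>

definition corner_le :: "'e dipath set \<Rightarrow> 'e dipath set \<Rightarrow> bool" where
  "corner_le \<Delta> \<Delta>' \<longleftrightarrow> (\<forall>v d u \<sigma> \<sigma>'. left_corner \<Gamma> (v, d, u) \<longrightarrow> corner_suffix \<Delta> v d u \<sigma> \<longrightarrow> corner_suffix \<Delta>' v d u \<sigma>' \<longrightarrow>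
     \<sigma>' = \<sigma> \<or> out_lex \<sigma>' \<sigma>)"

lemma corner_leD: "corner_le \<Delta> \<Delta>' \<Longrightarrow> left_corner \<Gamma> (v, d, u) \<Longrightarrow> corner_suffix \<Delta> v d u \<sigma> \<Longrightarrow> corner_suffix \<Delta>' v d u \<sigma>' \<Longrightarrow>
    \<sigma>' = \<sigma> \<or> out_lex \<sigma>' \<sigma>"
  unfolding corner_le_def by blast

lemma corner_suffix_ex:
  assumes "maximal_clique \<Gamma> \<Delta>" "left_corner \<Gamma> (v, d, u)"
  obtains \<sigma> where "corner_suffix \<Delta> v d u \<sigma>"
  by (rule corner_suffix_extremal[OF assms])

lemma CC_L_le_corner_le:
  assumes mc: "maximal_clique \<Gamma> \<Delta>" "maximal_clique \<Gamma> \<Delta>'"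
  shows "(\<forall>c. left_corner \<Gamma> c \<longrightarrow> CC_L \<Gamma> \<Delta> c \<le> CC_L \<Gamma> \<Delta>' c) \<longleftrightarrow> corner_le \<Delta> \<Delta>'"
proof
  assume h: "\<forall>c. left_corner \<Gamma> c \<longrightarrow> CC_L \<Gamma> \<Delta> c \<le> CC_L \<Gamma> \<Delta>' c"
  show "corner_le \<Delta> \<Delta>'" unfolding corner_le_def using h CC_L_le_iff[OF mc] by blast
next
  assume h: "corner_le \<Delta> \<Delta>'"
  show "\<forall>c. left_corner \<Gamma> c \<longrightarrow> CC_L \<Gamma> \<Delta> c \<le> CC_L \<Gamma> \<Delta>' c"
  proof (intro allI impI)
    fix c assume lc: "left_corner \<Gamma> c"
    obtain v d u where c: "c = (v, d, u)" using prod_cases3 by blast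
    obtain \<sigma> where s: "corner_suffix \<Delta> v d u \<sigma>" using corner_suffix_ex[OF mc(1) lc[unfolded c]] .
    obtain \<sigma>' where s': "corner_suffix \<Delta>' v d u \<sigma>'" using corner_suffix_ex[OF mc(2) lc[unfolded c]] .
    show "CC_L \<Gamma> \<Delta> c \<le> CC_L \<Gamma> \<Delta>' c"
      using corner_leD[OF h lc[unfolded c] s s'] CC_L_le_iff[OF mc lc[unfolded c] s s'] c by blast
  qed
qed

text \<open>At the vertex where the two prefixes part, a corner separates the arcs of
  \<open>r\<close> and \<open>t\<close>. From there on \<open>r\<close> is at most the cornering
  suffix of \<Delta>, which is at most that of \<Delta>', which is at most the rest of
  \<open>t\<close>; so the suffixes are ordered like the prefixes.\<close>

lemma corner_le_no_cw:
  assumes mc: "maximal_clique \<Gamma> \<Delta>" "maximal_clique \<Gamma> \<Delta>'" and le: "corner_le \<Delta>' \<Delta>"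
    and r: "r \<in> \<Delta>" and t: "t \<in> \<Delta>'"
  shows "\<not> cw y r t"
proof
  assume "cw y r t"
  then obtain a b a' b' where h: "split_at r y a b" "split_at t y a' b'" "in_lex a a'" "out_lex b' b"
    unfolding cw_def by blast
  have ne: "a \<noteq> a'" using h(3) by auto
  from src_split[OF split_atD(5)[OF h(1)] split_atD(5)[OF h(2)] ne split_atD(2)[OF h(1)]]
  obtain m w a1 a1' where d: "a = a1 @ m" "a' = a1' @ m" "a1 \<noteq> []" "a1' \<noteq> []" "last a1 \<noteq> last a1'"
    "awalk w m y" "internal G w" "last a1 \<in> in_arcs G w" "last a1' \<in> in_arcs G w" by metis
  have "in_lex a1 a1'" using h(3) d by simp
  then have lt: "(last a1, last a1') \<in> in_rel \<Gamma>" using in_lex_lastD d by blast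
  obtain u where u: "left_corner \<Gamma> (w, last a1, u)" "u = last a1' \<or> (u, last a1') \<in> in_rel \<Gamma>"
    using corner_above[OF d(7-9) lt] .
  note du = left_cornerD(4)[OF u(1)]
  obtain \<sigma> where s: "corner_suffix \<Delta> w (last a1) u \<sigma>" using corner_suffix_ex[OF mc(1) u(1)] .
  obtain \<sigma>' where s': "corner_suffix \<Delta>' w (last a1) u \<sigma>'" using corner_suffix_ex[OF mc(2) u(1)] .
  have "split_at r w a1 (m @ b)" "split_at t w a1' (m @ b')" using h(1,2) d(1,2,6,7) split_at_bwd by blast+
  then have "m @ b = \<sigma> \<or> out_lex (m @ b) \<sigma>" "m @ b' = \<sigma>' \<or> out_lex \<sigma>' (m @ b')"
    using corner_suffix_lower[OF maximalD[OF mc(1)] s du r] corner_suffix_upper[OF maximalD[OF mc(2)] s' du t] u(2) by auto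
  moreover have "\<sigma> = \<sigma>' \<or> out_lex \<sigma> \<sigma>'" using corner_leD[OF le u(1) s' s] .
  ultimately have "m @ b = m @ b' \<or> out_lex (m @ b) (m @ b')" using out_lex_trans by metis
  then have "b = b' \<or> out_lex b b'" by simp
  with h(4) show False using out_lex_asym by auto
qed

text \<open>No conflict remains between a route of one clique and a route of the other, so each
  maximal clique absorbs the other.\<close>

lemma corner_le_antisym:
  assumes mc: "maximal_clique \<Gamma> \<Delta>" "maximal_clique \<Gamma> \<Delta>'" and le: "corner_le \<Delta> \<Delta>'" "corner_le \<Delta>' \<Delta>"
  shows "\<Delta> = \<Delta>'"
proof -
  have c: "coh r t" if "r \<in> \<Delta>" "t \<in> \<Delta>'" for r t
    using corner_le_no_cw[OF mc le(2) that] corner_le_no_cw[OF mc(2,1) le(1) that(2,1)] by blast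
  have "\<Delta>' \<subseteq> \<Delta>"
    using maximal_memI[OF mc(1)] c cliqueD(1)[OF maximalD[OF mc(2)]] by blast
  moreover have "\<Delta> \<subseteq> \<Delta>'"
    using maximal_memI[OF mc(2)] c cliqueD(1)[OF maximalD[OF mc(1)]] by blast
  ultimately show ?thesis by blast
qed

text \<open>The resolvent of \<open>r\<close> and \<open>r'\<close> at their last conflict lies in both cliques, and it inherits the
  earlier conflicts of \<open>r\<close> with \<open>r'\<close> in the other direction.\<close>

lemma exchange_last_conflict:
  assumes mc: "maximal_clique \<Gamma> \<Delta>" "maximal_clique \<Gamma> \<Delta>'"
    and ex: "\<Delta> - \<Delta>' = {r}" "\<Delta>' - \<Delta> = {r'}"
    and w: "cw w r r'" "\<And>y. w < y \<Longrightarrow> \<not> cw y r r' \<and> \<not> cw y r' r"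
  shows "\<not> cw y r' r"
proof
  assume y: "cw y r' r"
  note cl = maximalD[OF mc(1)] maximalD[OF mc(2)]
  obtain a b a' b' where h: "split_at r w a b" "split_at r' w a' b'" "in_lex a a'" "out_lex b' b"
    using w(1) unfolding cw_def by blast
  let ?p = "(fst r, a @ b')"
  have pw: "split_at ?p w a b'" using split_at_splice[OF h(1,2)] .
  have "?p \<in> \<Delta>"
  proof (rule maximal_memI[OF mc(1) split_atD(1)[OF pw]])
    fix z assume z: "z \<in> \<Delta>"
    show "coh ?p z"
    proof (cases "z = r")
      case True
      \<comment> \<open>Coherence with \<open>r\<close> itself cannot come from
        \<open>coh_splice\<close>, as \<open>r\<close> conflicts with \<open>r'\<close>. Before
        \<open>w\<close> the splice agrees with \<open>r\<close>; after \<open>w\<close> it agrees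
        with \<open>r'\<close>, which has no further conflict with \<open>r\<close> because
        \<open>w\<close> is the last one.\<close>
      have n: "\<not> cw w ?p r" "\<not> cw w r ?p" unfolding cw_split_at[OF pw h(1)] cw_split_at[OF h(1) pw] by simp_all
      show ?thesis unfolding True
      proof
        fix x show "\<not> cw x ?p r \<and> \<not> cw x r ?p"
        proof (cases x w rule: linorder_cases)
          case less
          then show ?thesis
            using swap_suffix[OF pw h(1), of x r] n coh_self by (meson less_imp_le)
        next
          case greater
          then show ?thesis
            using swap_prefix[OF pw h(2), of x r] n w(2)[OF greater] by (meson less_imp_le)
        qed (use n in simp)
      qed
    next
      case False
      then have "z \<in> \<Delta>'" using z ex by blast
      then have zc: "coh z r" "coh z r'" using cliqueD(2)[OF cl(1) z] cliqueD(2)[OF cl(2)] ex by blast+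
      have "\<not> cw w ?p z \<and> \<not> cw w z ?p"
      proof (cases "\<exists>c d. split_at z w c d")
        case True
        then obtain c d where zw: "split_at z w c d" by blast
        have "\<not> (in_lex a c \<and> out_lex d b)" "\<not> (in_lex c a' \<and> out_lex b' d)"
          using zc(1)[THEN spec, of w] zc(2)[THEN spec, of w]
          unfolding cw_split_at[OF h(1) zw] cw_split_at[OF zw h(2)] by simp_all
        then show ?thesis
          using in_lex_trans[OF _ h(3), of c] out_lex_trans[OF _ h(4), of d]
          unfolding cw_split_at[OF pw zw] cw_split_at[OF zw pw] by blast
      qed (auto simp: cw_def)
      then show ?thesis using pw h(1,2) zc by (rule coh_splice)
    qed
  qed
  moreover have "?p \<noteq> r"
  proof
    assume eq: "?p = r"
    have "b' = b" using split_at_unique[OF pw[unfolded eq] h(1)] by blast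
    with h(4) show False by simp
  qed
  ultimately have "?p \<in> \<Delta>'" using ex(1) by blast
  then have pc: "coh ?p r'" using cliqueD(2)[OF cl(2)] ex(2) by blast
  have "y \<le> w" using w(2) y by (meson not_le)
  then show False using swap_suffix(2)[OF h(1) pw _ y] spec[OF pc, of y] cw_asym[OF w(1)] by simp
qed

text \<open>The last conflict of the two routes may have either direction.
  \<open>exchange_last_conflict\<close> applies to it as it stands or with the cliques interchanged,
  and the conflict at \<open>v\<close> then excludes the second case.\<close>

lemma exchange_direction:
  assumes mc: "maximal_clique \<Gamma> \<Delta>" "maximal_clique \<Gamma> \<Delta>'"
    and ex: "\<Delta> - \<Delta>' = {r}" "\<Delta>' - \<Delta> = {r'}" and c: "cw v r r'"
  shows "\<not> cw y r' r"
proof -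
  let ?C = "{x. cw x r r' \<or> cw x r' r}"
  have "x \<in> verts G" if "cw x p q" for x p q
    using that split_atD(2) unfolding cw_def internal_def by blast
  then have "?C \<subseteq> verts G" by blast
  then have f: "finite ?C" using finite_verts finite_subset by blast
  have "v \<in> ?C" using c by simp
  then have "Max ?C \<in> ?C" using f Max_in by blast
  moreover have m: "\<not> cw y r r' \<and> \<not> cw y r' r" if "Max ?C < y" for y
    using Max_ge[OF f, of y] that by fastforce
  ultimately consider "cw (Max ?C) r r'" | "cw (Max ?C) r' r" by blast
  then show ?thesis
  proof cases
    case 1
    then show ?thesis using exchange_last_conflict[OF mc ex 1] m by blast
  next
    case 2
    then show ?thesis using exchange_last_conflict[OF mc(2,1) ex(2,1) 2] m c by blast
  qed
qed

lemma framing_cover_corner_le: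
  assumes "framing_cover \<Gamma> \<Delta> \<Delta>'"
  shows "corner_le \<Delta> \<Delta>'"
proof -
  from assms obtain r r' s where mc: "maximal_clique \<Gamma> \<Delta>" "maximal_clique \<Gamma> \<Delta>'"
    and ex: "\<Delta> - \<Delta>' = {r}" "\<Delta>' - \<Delta> = {r'}" and s: "conflict_subroute \<Gamma> r r' s" "clockwise_on \<Gamma> s r r'"
    unfolding framing_cover_def by blast
  note cl = maximalD[OF mc(1)] maximalD[OF mc(2)]
  have rr: "r \<in> \<Delta>" "r' \<in> \<Delta>'" using ex by blast+
  then have rt: "route \<Gamma> r" "route \<Gamma> r'" using cliqueD(1) cl by blast+
  from s obtain v where v: "incoherent_at \<Gamma> v r r'" "clockwise \<Gamma> v r r'"
    unfolding conflict_subroute_def clockwise_on_def by blast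
  obtain a b a' b' where t: "split_at r v a b" "split_at r' v a' b'"
    using v(1) unfolding incoherent_at_iff[OF rt] cw_def by blast
  have c: "cw v r r'" using v(2) unfolding clockwise_split_at[OF t] cw_split_at[OF t] .
  show ?thesis
    unfolding corner_le_def
  proof (intro allI impI)
    fix w d u \<sigma> \<sigma>'
    assume lc: "left_corner \<Gamma> (w, d, u)" and co: "corner_suffix \<Delta> w d u \<sigma>" and co': "corner_suffix \<Delta>' w d u \<sigma>'"
    show "\<sigma>' = \<sigma> \<or> out_lex \<sigma>' \<sigma>"
    proof (rule ccontr)
      assume n: "\<not> ?thesis"
      then have o: "out_lex \<sigma> \<sigma>'"
        using out_lex_total[OF corner_suffix_snk_path[OF co] corner_suffix_snk_path[OF co'] _ left_cornerD(1)[OF lc]] by blast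
      note du = left_cornerD(4)[OF lc]
      obtain x p where x: "x \<in> \<Delta>" "split_at x w p \<sigma>" "last p = u" using co unfolding corner_suffix_def by blast
      obtain y q where y: "y \<in> \<Delta>'" "split_at y w q \<sigma>'" "last q = d" using co' unfolding corner_suffix_def by blast
      \<comment> \<open>In \<Delta>' every route entering by \<open>u\<close> continues at least as
        high as \<sigma>', and in \<Delta> every route entering by \<open>d\<close> continues at
        most as high as \<sigma>. So both witnesses must be the exchanged routes.\<close>
      have "x \<notin> \<Delta>'" using corner_suffix_upper[OF cl(2) co' du _ x(2)] x(3) n by blast
      then have xr: "x = r" using x(1) ex by blast
      have "y \<notin> \<Delta>" using corner_suffix_lower[OF cl(1) co du _ y(2)] y(3) n by blast
      then have yr: "y = r'" using y(1) ex by blast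
      have "in_lex q p" using in_lex_lastI split_atD(7)[OF x(2)] split_atD(7)[OF y(2)] x(3) y(3) du by blast
      then have "cw w r' r" using cw_split_at[OF y(2) x(2)] o xr yr by blast
      then show False using exchange_direction[OF mc ex c] by blast
    qed
  qed
qed

end

section \<open>Exchanging a lower cornering route\<close>

text \<open>
  The routes \<open>p\<close>, \<open>r\<close>, \<open>q\<close> are consecutive in \<open>\<Delta>\<close> at \<open>v\<close>. The route that replaces \<open>r\<close> crosses from
  \<open>p\<close> to \<open>q\<close> in the opposite way: \<open>r\<close> has the prefix of \<open>p\<close> and the suffix of \<open>q\<close>.
\<close>

locale flip = framed +
  fixes \<Delta> v d u r q p a a' \<sigma> \<tau>
  assumes mc: "maximal_clique \<Gamma> \<Delta>" and lc: "left_corner \<Gamma> (v, d, u)"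
    and mem: "r \<in> \<Delta>" "q \<in> \<Delta>" "p \<in> \<Delta>"
    and rv: "split_at r v a \<sigma>" and qv: "split_at q v a' \<sigma>" and pv: "split_at p v a \<tau>"
    and la: "last a = d" "last a' = u"
    and L: "\<forall>x\<in>\<Delta>. \<forall>c y. split_at x v c y \<longrightarrow> last c = d \<longrightarrow> (c = a \<or> in_lex c a) \<and> (y = \<sigma> \<or> out_lex y \<sigma>)"
    and U: "\<forall>x\<in>\<Delta>. \<forall>c y. split_at x v c y \<longrightarrow> last c = u \<longrightarrow> (a' = c \<or> in_lex a' c) \<and> (\<sigma> = y \<or> out_lex \<sigma> y)"
    and ts: "out_lex \<tau> \<sigma>"
    and M: "\<forall>x\<in>\<Delta>. \<forall>y. split_at x v a y \<longrightarrow> out_lex y \<sigma> \<longrightarrow> y = \<tau> \<or> out_lex y \<tau>"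
begin

definition "new_route = (fst q, a' @ \<tau>)"

definition "flipped = insert new_route (\<Delta> - {r})"

lemmas lcD = left_cornerD[OF lc]

lemma cl: "clique \<Gamma> \<Delta>"
  using maximalD mc by blast

lemma corner_in_lex: "in_lex a a'"
  using in_lex_lastI split_atD(7)[OF rv] split_atD(7)[OF qv] la lcD(4) by blast

lemma split_at_new_route: "split_at new_route v a' \<tau>"
  unfolding new_route_def using split_at_splice[OF qv pv] .

lemma cw_old_new: "cw v r new_route"
  unfolding cw_split_at[OF rv split_at_new_route] using corner_in_lex ts by blast

lemma not_r: "p \<noteq> r" "q \<noteq> r" "new_route \<noteq> r"
proof -
  have ne: "\<tau> \<noteq> \<sigma>" "a' \<noteq> a" using ts corner_in_lex in_lex_irrefl out_lex_irrefl by metis+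
  show "p \<noteq> r" using split_at_unique[OF rv, of a \<tau>] pv ne by blast
  show "q \<noteq> r" using split_at_unique[OF rv, of a' \<sigma>] qv ne by blast
  show "new_route \<noteq> r" using split_at_unique[OF rv, of a' \<tau>] split_at_new_route ne by blast
qed

text \<open>\<open>a\<close> is the largest prefix ending in \<open>d\<close> and \<open>a'\<close>
  the smallest ending in \<open>u\<close>. As these arcs are consecutive, no route of \<Delta> has a
  prefix strictly between.\<close>

lemma above_lower_prefix:
  assumes z: "z \<in> \<Delta>" "split_at z v c y" and ac: "in_lex a c"
  shows "(c = a' \<or> in_lex a' c) \<and> (y = \<sigma> \<or> out_lex \<sigma> y)"
proof -
  have "last c \<noteq> d"
  proof
    assume "last c = d"
    with L z have "c = a \<or> in_lex c a" by blast
    with ac in_lex_asym[OF ac] show False by auto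
  qed
  then have "(d, last c) \<in> in_rel \<Gamma>"
    using ac in_lex_lastD[of a c] split_atD(7)[OF z(2)] split_atD(7)[OF rv] la by auto
  then have "\<not> (last c, d) \<in> in_rel \<Gamma>" "last c \<in> in_arcs G v"
    using transD[OF trans_in_rel] irrefl_in_rel split_atD(9,10)[OF z(2)] unfolding irrefl_def by auto
  then consider "last c = u" | "(u, last c) \<in> in_rel \<Gamma>" using lcD(5) \<open>last c \<noteq> d\<close> by blast
  then show ?thesis
  proof cases
    case 1
    then show ?thesis using U z by blast
  next
    case 2
    then have "in_lex a' c" using in_lex_lastI split_atD(7)[OF z(2)] split_atD(7)[OF qv] la by blast
    then show ?thesis using clique_out_lex[OF cl mem(2) z(1) qv z(2)] by auto
  qed
qed

lemma coh_new_route: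
  assumes z: "z \<in> \<Delta>" "z \<noteq> r"
  shows "coh new_route z"
proof -
  have "\<not> cw v new_route z \<and> \<not> cw v z new_route"
  proof (cases "\<exists>c y. split_at z v c y")
    case True
    then obtain c y where zv: "split_at z v c y" by blast
    have "\<not> (in_lex a' c \<and> out_lex y \<tau>)"
      using clique_out_lex[OF cl mem(2) z(1) qv zv] ts out_lex_trans out_lex_asym by metis
    \<comment> \<open>Such a route is squeezed to the prefix \<open>a\<close> and to a suffix above
      \<tau> and at most \<sigma>. By \<open>M\<close> the only one is \<open>r\<close>.\<close>
    moreover have "\<not> (in_lex c a' \<and> out_lex \<tau> y)"
    proof
      assume h: "in_lex c a' \<and> out_lex \<tau> y"
      have "\<not> in_lex c a"
        using clique_out_lex[OF cl z(1) mem(3) zv pv] h out_lex_asym by auto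
      moreover have "\<not> in_lex a c"
        using above_lower_prefix[OF z(1) zv] h in_lex_asym by auto
      ultimately have ca: "c = a" using split_at_in_lex_total[OF zv rv] by blast
      then have "y \<noteq> \<sigma>" using zv rv z(2) split_at_same by blast
      then have "out_lex y \<sigma>"
        using clique_out_lex[OF cl z(1) mem(2) zv qv] h by blast
      then have "y = \<tau> \<or> out_lex y \<tau>" using M z(1) zv ca by blast
      with h show False using out_lex_asym by auto
    qed
    ultimately show ?thesis unfolding cw_split_at[OF split_at_new_route zv] cw_split_at[OF zv split_at_new_route] by blast
  qed (auto simp: cw_def)
  then show ?thesis
    using split_at_new_route qv pv cliqueD(2)[OF cl z(1) mem(2)] cliqueD(2)[OF cl z(1) mem(3)] by (rule coh_splice)
qed

lemma new_route_notin: "new_route \<notin> \<Delta>"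
  using cliqueD(2)[OF cl mem(1)] cw_old_new by blast

lemma clique_flipped: "clique \<Gamma> flipped"
proof (rule cliqueI)
  fix x assume "x \<in> flipped"
  then show "route \<Gamma> x" unfolding flipped_def using cliqueD(1)[OF cl] split_atD(1)[OF split_at_new_route] by blast
next
  fix x y assume "x \<in> flipped" "y \<in> flipped"
  then consider "x \<in> \<Delta>" "y \<in> \<Delta>" | "x = new_route" "y = new_route" | "x = new_route" "y \<in> \<Delta>" "y \<noteq> r"
    | "y = new_route" "x \<in> \<Delta>" "x \<noteq> r" unfolding flipped_def by blast
  then show "coh x y"
  proof cases
    case 1
    then show ?thesis using cliqueD(2)[OF cl] by blast
  next
    case 2
    then show ?thesis using coh_self by blast
  next
    case 3
    then show ?thesis using coh_new_route by blast
  next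
    case 4
    then show ?thesis using coh_new_route by blast
  qed
qed

text \<open>
  A route \<open>t\<close> that is coherent with the exchanged clique but not with \<open>r\<close> passes \<open>v\<close> between \<open>r\<close> and
  \<open>q\<close>. Splicing it with \<open>p\<close> or \<open>q\<close> gives a route of \<open>\<Delta>\<close> strictly between two of \<open>p\<close>, \<open>r\<close>, \<open>q\<close>.
\<close>

lemma flipped_extension:
  assumes t: "route \<Gamma> t" and ct: "\<And>z. z \<in> flipped \<Longrightarrow> coh t z"
  shows "t \<in> flipped"
proof (rule ccontr)
  assume tn: "t \<notin> flipped"
  have ctz: "coh z t" if "z \<in> \<Delta>" "z \<noteq> r" for z using ct[of z] that unfolding flipped_def by blast
  have ctr': "coh new_route t" using ct[of new_route] unfolding flipped_def by blast
  have tp: "coh t p" and tq: "coh t q" using ctz mem not_r by blast+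
  have pq: "coh p q" using cliqueD(2)[OF cl] mem by blast
  have "\<not> coh t r"
  proof
    assume c: "coh t r"
    have "t \<in> \<Delta>"
    proof (rule maximal_memI[OF mc t])
      fix z assume "z \<in> \<Delta>"
      then show "coh t z" using c ctz by blast
    qed
    then have "t = r" using tn unfolding flipped_def by blast
    then show False using ctr' cw_old_new by blast
  qed
  then have "\<not> coh r t" using coh_sym by blast
  \<comment> \<open>\<open>r\<close> is the splice of \<open>p\<close> and \<open>q\<close> at
    \<open>v\<close>, and \<open>t\<close> is coherent with both, so the conflict shows at
    \<open>v\<close>.\<close>
  then have "cw v r t \<or> cw v t r"
    using coh_splice[OF _ rv pv qv tp tq] by (metis (no_types))
  then obtain x y where tv: "split_at t v x y" unfolding cw_def by blast
  note pq_t = cw_split_at[OF pv tv] cw_split_at[OF tv pv] cw_split_at[OF qv tv] cw_split_at[OF tv qv]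
    cw_split_at[OF split_at_new_route tv] cw_split_at[OF tv split_at_new_route]
  have n: "\<not> (in_lex a x \<and> out_lex y \<tau>)" "\<not> (in_lex x a' \<and> out_lex \<sigma> y)" "\<not> (in_lex a' x \<and> out_lex y \<sigma>)" "\<not> (in_lex x a' \<and> out_lex \<tau> y)"
    using tp tq ctr' pq_t by blast+
  have "\<not> cw v t r" unfolding cw_split_at[OF tv rv] using n(2) in_lex_trans[OF _ corner_in_lex] by blast
  then have "cw v r t" using \<open>cw v r t \<or> cw v t r\<close> by blast
  then have ax: "in_lex a x" and ys: "out_lex y \<sigma>" unfolding cw_split_at[OF rv tv] by blast+
  have "x = a' \<or> in_lex x a'" using n(3) ys split_at_in_lex_total[OF tv qv] by blast
  then show False
  proof
    assume xa: "x = a'"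
    have "y \<noteq> \<tau>"
    proof
      assume "y = \<tau>"
      then have "t = new_route" using xa tv split_at_new_route split_at_same by blast
      with tn show False unfolding flipped_def by blast
    qed
    then have ty: "out_lex \<tau> y" using n(1) ax split_at_out_lex_total[OF tv pv] by blast
    \<comment> \<open>At the prefix \<open>a\<close> this route has a suffix strictly between \<tau>
      and \<sigma>, which \<open>M\<close> excludes from \<Delta>.\<close>
    let ?t = "(fst p, a @ y)"
    have tv': "split_at ?t v a y" using split_at_splice[OF pv tv] .
    have "\<not> cw v ?t p \<and> \<not> cw v p ?t" unfolding cw_split_at[OF tv' pv] cw_split_at[OF pv tv'] by simp
    then have c1: "coh ?t p" using tv' pv tv coh_self coh_sym[OF tp] by (rule coh_splice)
    have "\<not> cw v ?t q \<and> \<not> cw v q ?t"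
      unfolding cw_split_at[OF tv' qv] cw_split_at[OF qv tv'] using out_lex_asym[OF ys] in_lex_asym[OF corner_in_lex] by simp
    then have c2: "coh ?t q" using tv' pv tv coh_sym[OF pq] coh_sym[OF tq] by (rule coh_splice)
    \<comment> \<open>Since \<open>t\<close> conflicts with \<open>r\<close>, coherence of
      \<open>?t\<close> with \<open>r\<close> is obtained from the other side: \<open>r\<close> is
      regarded as the splice of \<open>p\<close> and \<open>q\<close>.\<close>
    have "\<not> cw v r ?t \<and> \<not> cw v ?t r" unfolding cw_split_at[OF tv' rv] cw_split_at[OF rv tv'] by simp
    then have "coh r ?t" using rv pv qv c1 c2 by (rule coh_splice)
    then have c3: "coh ?t r" by (rule coh_sym)
    have "?t \<in> \<Delta>"
    proof (rule maximal_memI[OF mc split_atD(1)[OF tv']])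
      fix z assume z: "z \<in> \<Delta>"
      show "coh ?t z"
      proof (cases "z = r")
        case True
        then show ?thesis using c3 by blast
      next
        case False
        have "\<not> cw v ?t z \<and> \<not> cw v z ?t"
        proof (cases "\<exists>c y. split_at z v c y")
          case True
          then obtain c yz where zv: "split_at z v c yz" by blast
          have "\<not> (in_lex a c \<and> out_lex yz y)"
            using above_lower_prefix[OF z zv] ys out_lex_trans out_lex_asym by metis
          moreover have "\<not> (in_lex c a \<and> out_lex y yz)"
            using clique_out_lex[OF cl z mem(3) zv pv] ty out_lex_trans out_lex_asym by metis
          ultimately show ?thesis unfolding cw_split_at[OF tv' zv] cw_split_at[OF zv tv'] by blast
        qed (auto simp: cw_def)
        then show ?thesis
          using tv' pv tv cliqueD(2)[OF cl z mem(3)] ctz[OF z False] by (rule coh_splice)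
      qed
    qed
    then have "y = \<tau> \<or> out_lex y \<tau>" using M tv' ys by blast
    with ty show False using out_lex_asym by auto
  next
    assume xa: "in_lex x a'"
    then have yt: "y = \<tau>" using n(1,4) ax split_at_out_lex_total[OF tv pv] by blast
    \<comment> \<open>The prefix of this route lies strictly between \<open>a\<close> and
      \<open>a'\<close>, which \<open>above_lower_prefix\<close> excludes.\<close>
    let ?t = "(fst t, x @ \<sigma>)"
    have tv': "split_at ?t v x \<sigma>" using split_at_splice[OF tv qv] .
    have "\<not> cw v ?t p \<and> \<not> cw v p ?t"
      unfolding cw_split_at[OF tv' pv] cw_split_at[OF pv tv'] using in_lex_asym[OF ax] out_lex_asym[OF ts] by simp
    then have c1: "coh ?t p" using tv' tv qv coh_sym[OF tp] pq by (rule coh_splice)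
    have "\<not> cw v ?t q \<and> \<not> cw v q ?t" unfolding cw_split_at[OF tv' qv] cw_split_at[OF qv tv'] by simp
    then have c2: "coh ?t q" using tv' tv qv coh_sym[OF tq] coh_self by (rule coh_splice)
    have "\<not> cw v r ?t \<and> \<not> cw v ?t r" unfolding cw_split_at[OF tv' rv] cw_split_at[OF rv tv'] by simp
    then have "coh r ?t" using rv pv qv c1 c2 by (rule coh_splice)
    then have c3: "coh ?t r" by (rule coh_sym)
    have "?t \<in> \<Delta>"
    proof (rule maximal_memI[OF mc split_atD(1)[OF tv']])
      fix z assume z: "z \<in> \<Delta>"
      show "coh ?t z"
      proof (cases "z = r")
        case True
        then show ?thesis using c3 by blast
      next
        case False
        have "\<not> cw v ?t z \<and> \<not> cw v z ?t"
        proof (cases "\<exists>c y. split_at z v c y")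
          case True
          then obtain c yz where zv: "split_at z v c yz" by blast
          have "\<not> (in_lex x c \<and> out_lex yz \<sigma>)"
            using above_lower_prefix[OF z zv] in_lex_trans[OF ax] out_lex_asym by auto
          moreover have "\<not> (in_lex c x \<and> out_lex \<sigma> yz)"
            using clique_out_lex[OF cl z mem(2) zv qv] in_lex_trans[OF _ xa] out_lex_asym by auto
          ultimately show ?thesis unfolding cw_split_at[OF tv' zv] cw_split_at[OF zv tv'] by blast
        qed (auto simp: cw_def)
        then show ?thesis
          using tv' tv qv ctz[OF z False] cliqueD(2)[OF cl z mem(2)] by (rule coh_splice)
      qed
    qed
    then show False using above_lower_prefix[OF _ tv' ax] xa in_lex_asym by auto
  qed
qed

lemma maximal_flipped: "maximal_clique \<Gamma> flipped"
  unfolding maximal_clique_def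
proof (intro conjI allI impI)
  show "clique \<Gamma> flipped" by (rule clique_flipped)
  fix X assume X: "clique \<Gamma> X \<and> flipped \<subseteq> X"
  have "t \<in> flipped" if "t \<in> X" for t
    using flipped_extension[of t] cliqueD[of X] X that by blast
  with X show "X = flipped" by blast
qed

lemma exchange: "\<Delta> - flipped = {r}" "flipped - \<Delta> = {new_route}"
  unfolding flipped_def using mem not_r new_route_notin by blast+

text \<open>The subroute of conflict is the common beginning \<open>m\<close> of \<sigma> and
  \<tau>. It cannot be prolonged backwards because the routes enter \<open>v\<close> by the
  different arcs \<open>d\<close> and \<open>u\<close>, nor forwards because \<sigma> and \<tau>
  part after \<open>m\<close>.\<close>

lemma flip_cover: "framing_cover \<Gamma> \<Delta> flipped"
proof -
  have "\<sigma> \<noteq> \<tau>" using ts by auto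
  from snk_split[OF split_atD(6)[OF rv] split_atD(6)[OF pv] this lcD(1)]
  obtain m w e f x y where sp: "\<sigma> = m @ e # x" "\<tau> = m @ f # y" "e \<noteq> f" "awalk v m w" "internal G w"
    by metis
  have ef: "(f # y, e # x) \<in> lexord (out_rel \<Gamma>)" using ts sp by simp
  let ?s = "(v, m)"
  have rt: "route \<Gamma> r" "route \<Gamma> new_route" using split_atD(1) rv split_at_new_route by blast+
  have sub: "subpath G ?s t" if tv: "split_at t v c (m @ g)" for t c g
  proof -
    obtain z where "awalk v (m @ g) z" using split_atD(6)[OF tv] by blast
    then have "awalk w g z" using sp(4) by (auto simp: awalk_append dest: awalk_end)
    then show ?thesis
      unfolding subpath_def dipath_def
      using split_atD(3,4)[OF tv] sp(4) by (intro exI[of _ c] exI[of _ g] exI[of _ w] exI[of _ z]) simp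
  qed
  have "common_subpath \<Gamma> r new_route ?s"
    unfolding common_subpath_def using sub rv split_at_new_route sp by blast
  moreover have "s' = ?s" if s': "common_subpath \<Gamma> r new_route s'" "subpath G ?s s'" for s'
  proof -
    obtain v' l where s'_eq: "s' = (v', l)" by (cases s')
    obtain xs ys where l: "l = xs @ m @ ys" "awalk v' xs v"
      using s'(2) unfolding s'_eq subpath_def dipath_def by auto
    have ext: "c = X @ xs \<and> b = m @ ys @ Y"
      if tv: "split_at t v c b" and X: "snd t = X @ l @ Y" "awalk (fst t) X v'" for t c b X Y
    proof -
      have "awalk (fst t) (X @ xs) v" using X(2) l(2) by (auto simp: awalk_append)
      then have "split_at t v (X @ xs) (m @ ys @ Y)"
        unfolding split_at_def using X(1) l(1) split_atD(1,2)[OF tv] by simp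
      then show ?thesis using split_at_unique[OF tv] by blast
    qed
    obtain X Y where "snd r = X @ l @ Y" "awalk (fst r) X v'"
      using s'(1) unfolding s'_eq common_subpath_def subpath_def dipath_def by auto
    then have 1: "a = X @ xs" "\<sigma> = m @ ys @ Y" using ext[OF rv] by blast+
    obtain X' Y' where "snd new_route = X' @ l @ Y'" "awalk (fst new_route) X' v'"
      using s'(1) unfolding s'_eq common_subpath_def subpath_def dipath_def by auto
    then have 2: "a' = X' @ xs" "\<tau> = m @ ys @ Y'" using ext[OF split_at_new_route] by blast+
    have "d \<noteq> u" using lcD(4) irrefl_in_rel by (auto simp: irrefl_def)
    then have xs: "xs = []" using 1(1) 2(1) la by (cases "xs = []") auto
    then have "v' = v" using l(2) by (simp add: awalk_simps)
    moreover have "ys = []" using 1(2) 2(2) sp(1-3) by (cases ys) auto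
    ultimately show "s' = ?s" using s'_eq l(1) xs by simp
  qed
  moreover have "clockwise_on \<Gamma> ?s r new_route"
    unfolding clockwise_on_def
  proof
    fix x' assume "x' \<in> path_verts G ?s"
    then obtain m1 m2 where m: "m = m1 @ m2" "awalk v m1 x'"
      unfolding path_verts_def using set_awalk_verts_split[OF sp(4)] by auto
    obtain z where "awalk v (m1 @ m2 @ e # x) z" using split_atD(6)[OF rv] sp(1) m(1) by auto
    then have "awalk x' (m2 @ e # x) z" using m(2) by (auto simp: awalk_append dest: awalk_end)
    then have "internal G x'" using internal_fwd[OF lcD(1) m(2)] awalk_hd[of x' "m2 @ e # x" z] by blast
    then have "split_at r x' (a @ m1) (m2 @ e # x)" "split_at new_route x' (a' @ m1) (m2 @ f # y)"
      using split_at_fwd[OF _ m(2)] rv split_at_new_route sp(1,2) m(1) by simp_all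
    from clockwise_split_at[OF this] show "clockwise \<Gamma> x' r new_route" using corner_in_lex ef by simp
  qed
  moreover have "v \<in> path_verts G ?s"
    unfolding path_verts_def by (cases m) (use sp(4) in \<open>auto simp: awalk_simps\<close>)
  moreover have "incoherent_at \<Gamma> v r new_route" using incoherent_at_iff[OF rt] cw_old_new by blast
  ultimately have "conflict_subroute \<Gamma> r new_route ?s" "clockwise_on \<Gamma> ?s r new_route"
    unfolding conflict_subroute_def by blast+
  then show ?thesis
    unfolding framing_cover_def using mc maximal_flipped exchange by blast
qed

lemma corner_suffix_flip: "corner_suffix flipped v d u \<tau>"
  unfolding corner_suffix_def flipped_def using mem not_r pv split_at_new_route la by blast

text \<open>At a changed corner the suffix drops, so the witnesses entering by \<open>d0\<close> and
  \<open>u0\<close> are \<open>r\<close> and \<open>new_route\<close>, in conflict at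
  \<open>w\<close>. A conflict before \<open>v\<close> would pass to \<open>q\<close> unless
  \<open>r\<close> and \<open>new_route\<close> entered \<open>v\<close> by one arc; after
  \<open>v\<close> it would pass to \<open>p\<close> unless they entered \<open>w\<close> by one
  arc. Both exceptions fail.\<close>

lemma corner_suffix_other:
  assumes lc0: "left_corner \<Gamma> (w, d0, u0)" and co: "corner_suffix \<Delta> w d0 u0 \<rho>" "corner_suffix flipped w d0 u0 \<rho>'" and ne: "\<rho> \<noteq> \<rho>'"
  shows "w = v \<and> d0 = d \<and> u0 = u"
proof -
  note du = left_cornerD(4)[OF lc0]
  have lt: "out_lex \<rho>' \<rho>"
    using corner_leD[OF framing_cover_corner_le[OF flip_cover] lc0 co] ne by blast
  then have nle: "\<not> (\<rho> = \<rho>' \<or> out_lex \<rho> \<rho>')" using out_lex_asym by auto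
  obtain x c where x: "x \<in> \<Delta>" "split_at x w c \<rho>" "last c = d0" using co(1) unfolding corner_suffix_def by blast
  obtain y c' where y: "y \<in> flipped" "split_at y w c' \<rho>'" "last c' = u0" using co(2) unfolding corner_suffix_def by blast
  have "x \<notin> flipped" using corner_suffix_lower[OF clique_flipped co(2) du _ x(2)] x(3) nle by blast
  then have xr: "split_at r w c \<rho>" using x unfolding flipped_def by blast
  have "y \<notin> \<Delta>" using corner_suffix_upper[OF cl co(1) du _ y(2)] y(3) nle by blast
  then have yr: "split_at new_route w c' \<rho>'" using y unfolding flipped_def by blast
  have "in_lex c c'" using in_lex_lastI split_atD(7)[OF xr] split_atD(7)[OF yr] x(3) y(3) du by blast
  then have cww: "cw w r new_route" unfolding cw_split_at[OF xr yr] using lt by blast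
  have nd: "d \<noteq> u" "d0 \<noteq> u0" using lcD(4) du irrefl_in_rel by (auto simp: irrefl_def)
  have nq: "\<not> cw w r q" "\<not> cw w r p" using cliqueD(2)[OF cl] mem by blast+
  have "\<not> w < v"
  proof
    assume w: "w < v"
    then have "last a = last a'" using swap_suffix(2)[OF split_at_new_route qv less_imp_le[OF w] cww] nq(1) rv w by metis
    with la nd show False by simp
  qed
  moreover have "\<not> v < w"
  proof
    assume w: "v < w"
    then have "last c = last c'" using swap_prefix(2)[OF split_at_new_route pv less_imp_le[OF w] cww] nq(2) xr yr w by metis
    with x(3) y(3) nd show False by simp
  qed
  ultimately have "w = v" by simp
  then show ?thesis using split_at_unique[OF rv] split_at_unique[OF split_at_new_route] xr yr x(3) y(3) la by auto
qed

end

section \<open>Ascending exchanges\<close>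

context framed
begin

section \<open>Corners along a route whose suffix is shared by a neighbour\<close>

text \<open>Let \<open>c0\<close> be the largest prefix below \<alpha>. A route conflicting with
  \<open>c0\<close> followed by \<beta> would have a prefix strictly between \<open>c0\<close> and
  \<alpha>, or the prefix \<alpha> with a suffix below \<beta>; neither exists, so this splice lies
  in \<Delta>.\<close>

lemma pred_same_suffix:
  assumes mc: "maximal_clique \<Gamma> \<Delta>" and r: "r \<in> \<Delta>" "split_at r w \<alpha> \<beta>"
    and lo: "\<forall>x\<in>\<Delta>. \<forall>y. split_at x w \<alpha> y \<longrightarrow> \<not> out_lex y \<beta>"
    and z: "z \<in> \<Delta>" "split_at z w c y" "in_lex c \<alpha>"
  obtains t c' where "t \<in> \<Delta>" "split_at t w c' \<beta>" "in_lex c' \<alpha>"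
proof -
  have cl: "clique \<Gamma> \<Delta>" using mc maximalD by blast
  let ?X = "{c. \<exists>z\<in>\<Delta>. \<exists>y. split_at z w c y \<and> in_lex c \<alpha>}"
  have "?X \<noteq> {}" "?X \<subseteq> {a. src_path a w}" using z split_atD(5) by blast+
  from ex_in_lex_min_max(2)[OF this split_atD(2)[OF r(2)]]
  obtain c0 where c0: "c0 \<in> ?X" "\<forall>x\<in>?X. x = c0 \<or> in_lex x c0" by blast
  then obtain z0 y0 where z0: "z0 \<in> \<Delta>" "split_at z0 w c0 y0" "in_lex c0 \<alpha>" by blast
  let ?t = "(fst z0, c0 @ \<beta>)"
  have tv: "split_at ?t w c0 \<beta>" using split_at_splice[OF z0(2) r(2)] .
  have "?t \<in> \<Delta>"
  proof (rule maximal_memI[OF mc split_atD(1)[OF tv]])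
    fix s assume s: "s \<in> \<Delta>"
    have "\<not> cw w ?t s \<and> \<not> cw w s ?t"
    proof (cases "\<exists>c y. split_at s w c y")
      case True
      then obtain cs ys where sv: "split_at s w cs ys" by blast
      have "\<not> (in_lex c0 cs \<and> out_lex ys \<beta>)"
      proof
        assume h: "in_lex c0 cs \<and> out_lex ys \<beta>"
        then have "cs = \<alpha> \<or> in_lex cs \<alpha>" using clique_in_lex[OF cl s r(1) sv r(2)] by blast
        moreover have "cs \<noteq> \<alpha>" using lo s sv h by blast
        ultimately have "cs \<in> ?X" using s sv by blast
        then have "cs = c0 \<or> in_lex cs c0" using c0(2) by blast
        with h in_lex_asym show False by auto
      qed
      moreover have "\<not> (in_lex cs c0 \<and> out_lex \<beta> ys)"
        using clique_out_lex[OF cl s r(1) sv r(2)] in_lex_trans[OF _ z0(3)] out_lex_asym by auto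
      ultimately show ?thesis unfolding cw_split_at[OF tv sv] cw_split_at[OF sv tv] by blast
    qed (auto simp: cw_def)
    then show "coh ?t s"
      using tv z0(2) r(2) cliqueD(2)[OF cl s z0(1)] cliqueD(2)[OF cl s r(1)] by (rule coh_splice)
  qed
  then show ?thesis using that tv z0(3) by blast
qed

lemma succ_same_suffix:
  assumes mc: "maximal_clique \<Gamma> \<Delta>" and r: "r \<in> \<Delta>" "split_at r w \<alpha> \<beta>"
    and hi: "\<forall>x\<in>\<Delta>. \<forall>y. split_at x w \<alpha> y \<longrightarrow> \<not> out_lex \<beta> y"
    and z: "z \<in> \<Delta>" "split_at z w c y" "in_lex \<alpha> c"
  obtains t c' where "t \<in> \<Delta>" "split_at t w c' \<beta>" "in_lex \<alpha> c'"
proof -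
  have cl: "clique \<Gamma> \<Delta>" using mc maximalD by blast
  let ?X = "{c. \<exists>z\<in>\<Delta>. \<exists>y. split_at z w c y \<and> in_lex \<alpha> c}"
  have "?X \<noteq> {}" "?X \<subseteq> {a. src_path a w}" using z split_atD(5) by blast+
  from ex_in_lex_min_max(1)[OF this split_atD(2)[OF r(2)]]
  obtain c0 where c0: "c0 \<in> ?X" "\<forall>x\<in>?X. x = c0 \<or> in_lex c0 x" by blast
  then obtain z0 y0 where z0: "z0 \<in> \<Delta>" "split_at z0 w c0 y0" "in_lex \<alpha> c0" by blast
  let ?t = "(fst z0, c0 @ \<beta>)"
  have tv: "split_at ?t w c0 \<beta>" using split_at_splice[OF z0(2) r(2)] .
  have "?t \<in> \<Delta>"
  proof (rule maximal_memI[OF mc split_atD(1)[OF tv]])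
    fix s assume s: "s \<in> \<Delta>"
    have "\<not> cw w ?t s \<and> \<not> cw w s ?t"
    proof (cases "\<exists>c y. split_at s w c y")
      case True
      then obtain cs ys where sv: "split_at s w cs ys" by blast
      have "\<not> (in_lex cs c0 \<and> out_lex \<beta> ys)"
      proof
        assume h: "in_lex cs c0 \<and> out_lex \<beta> ys"
        then have "\<alpha> = cs \<or> in_lex \<alpha> cs" using clique_in_lex[OF cl r(1) s r(2) sv] by blast
        moreover have "cs \<noteq> \<alpha>" using hi s sv h by blast
        ultimately have "cs \<in> ?X" using s sv by blast
        then have "cs = c0 \<or> in_lex c0 cs" using c0(2) by blast
        with h in_lex_asym show False by auto
      qed
      moreover have "\<not> (in_lex c0 cs \<and> out_lex ys \<beta>)"
        using clique_out_lex[OF cl r(1) s r(2) sv] in_lex_trans[OF z0(3)] out_lex_asym by auto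
      ultimately show ?thesis unfolding cw_split_at[OF tv sv] cw_split_at[OF sv tv] by blast
    qed (auto simp: cw_def)
    then show "coh ?t s"
      using tv z0(2) r(2) cliqueD(2)[OF cl s z0(1)] cliqueD(2)[OF cl s r(1)] by (rule coh_splice)
  qed
  then show ?thesis using that tv z0(3) by blast
qed

text \<open>From the vertex where their prefixes part, \<open>t\<close> and \<open>r\<close> run
  together. A corner between their arcs has its suffix bounded from both sides by this common
  continuation.\<close>

lemma pred_corner:
  assumes mc: "maximal_clique \<Gamma> \<Delta>" and r: "r \<in> \<Delta>" "split_at r w \<alpha> \<beta>"
    and t: "t \<in> \<Delta>" "split_at t w c \<beta>" "in_lex c \<alpha>"
  obtains m v d \<alpha>1 where "\<alpha> = \<alpha>1 @ m" "awalk v m w" "internal G v"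
    "left_corner \<Gamma> (v, d, last \<alpha>1)" "corner_suffix \<Delta> v d (last \<alpha>1) (m @ \<beta>)"
proof -
  have cl: "clique \<Gamma> \<Delta>" using mc maximalD by blast
  have ne: "c \<noteq> \<alpha>" using t(3) by auto
  from src_split[OF split_atD(5)[OF t(2)] split_atD(5)[OF r(2)] ne split_atD(2)[OF r(2)]]
  obtain m v c1 \<alpha>1 where s: "c = c1 @ m" "\<alpha> = \<alpha>1 @ m" "c1 \<noteq> []" "\<alpha>1 \<noteq> []" "last c1 \<noteq> last \<alpha>1"
    "awalk v m w" "internal G v" "last c1 \<in> in_arcs G v" "last \<alpha>1 \<in> in_arcs G v" by metis
  have "in_lex c1 \<alpha>1" using t(3) s by simp
  then have lt: "(last c1, last \<alpha>1) \<in> in_rel \<Gamma>" using in_lex_lastD s by blast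
  obtain d where d: "left_corner \<Gamma> (v, d, last \<alpha>1)" "d = last c1 \<or> (last c1, d) \<in> in_rel \<Gamma>"
    using corner_below[OF s(7-9) lt] .
  obtain \<sigma> where co: "corner_suffix \<Delta> v d (last \<alpha>1) \<sigma>" using corner_suffix_ex[OF mc d(1)] .
  have "split_at r v \<alpha>1 (m @ \<beta>)" "split_at t v c1 (m @ \<beta>)" using r(2) t(2) s(1,2,6,7) split_at_bwd by blast+
  then have "m @ \<beta> = \<sigma> \<or> out_lex \<sigma> (m @ \<beta>)" "m @ \<beta> = \<sigma> \<or> out_lex (m @ \<beta>) \<sigma>"
    using corner_suffix_upper[OF cl co left_cornerD(4)[OF d(1)] r(1)] corner_suffix_lower[OF cl co left_cornerD(4)[OF d(1)] t(1)] d(2)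
    by auto
  then have "\<sigma> = m @ \<beta>" using out_lex_asym by metis
  with that[OF s(2,6,7) d(1)] co show ?thesis by blast
qed

lemma succ_corner:
  assumes mc: "maximal_clique \<Gamma> \<Delta>" and r: "r \<in> \<Delta>" "split_at r w \<alpha> \<beta>"
    and t: "t \<in> \<Delta>" "split_at t w c \<beta>" "in_lex \<alpha> c"
  obtains m v u \<alpha>1 c1 where "\<alpha> = \<alpha>1 @ m" "c = c1 @ m" "awalk v m w" "internal G v"
    "left_corner \<Gamma> (v, last \<alpha>1, u)" "corner_suffix \<Delta> v (last \<alpha>1) u (m @ \<beta>)"
proof -
  have cl: "clique \<Gamma> \<Delta>" using mc maximalD by blast
  have ne: "\<alpha> \<noteq> c" using t(3) by auto
  from src_split[OF split_atD(5)[OF r(2)] split_atD(5)[OF t(2)] ne split_atD(2)[OF r(2)]]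
  obtain m v \<alpha>1 c1 where s: "\<alpha> = \<alpha>1 @ m" "c = c1 @ m" "\<alpha>1 \<noteq> []" "c1 \<noteq> []" "last \<alpha>1 \<noteq> last c1"
    "awalk v m w" "internal G v" "last \<alpha>1 \<in> in_arcs G v" "last c1 \<in> in_arcs G v" by metis
  have "in_lex \<alpha>1 c1" using t(3) s by simp
  then have lt: "(last \<alpha>1, last c1) \<in> in_rel \<Gamma>" using in_lex_lastD s by blast
  obtain u where u: "left_corner \<Gamma> (v, last \<alpha>1, u)" "u = last c1 \<or> (u, last c1) \<in> in_rel \<Gamma>"
    using corner_above[OF s(7-9) lt] .
  obtain \<sigma> where co: "corner_suffix \<Delta> v (last \<alpha>1) u \<sigma>" using corner_suffix_ex[OF mc u(1)] .
  have "split_at r v \<alpha>1 (m @ \<beta>)" "split_at t v c1 (m @ \<beta>)" using r(2) t(2) s(1,2,6,7) split_at_bwd by blast+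
  then have "m @ \<beta> = \<sigma> \<or> out_lex (m @ \<beta>) \<sigma>" "m @ \<beta> = \<sigma> \<or> out_lex \<sigma> (m @ \<beta>)"
    using corner_suffix_lower[OF cl co left_cornerD(4)[OF u(1)] r(1)] corner_suffix_upper[OF cl co left_cornerD(4)[OF u(1)] t(1)] u(2)
    by auto
  then have "\<sigma> = m @ \<beta>" using out_lex_asym by metis
  with that[OF s(1,2,6,7) u(1)] co show ?thesis by blast
qed

section \<open>Termination measure and choice of the exchange\<close>

text \<open>The cardinality adds up, over all left corners, the ranks of the cornering suffixes. It
  decreases with each ascending exchange.\<close>

definition below :: "'e dipath set \<Rightarrow> ('e corner \<times> 'e list) set" where
  "below \<Delta> = {((v, d, u), \<tau>). left_corner \<Gamma> (v, d, u) \<and> snk_path v \<tau> \<and> (\<exists>\<sigma>. corner_suffix \<Delta> v d u \<sigma> \<and> out_lex \<tau> \<sigma>)}"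

lemma finite_below: "finite (below \<Delta>)"
proof (rule finite_subset)
  let ?P = "{xs. set xs \<subseteq> arcs G \<and> distinct xs}"
  show "below \<Delta> \<subseteq> (verts G \<times> arcs G \<times> arcs G) \<times> ?P"
    unfolding below_def using awalk_distinct by (auto simp: internal_def awalk_def)
  have "finite ?P" by (simp add: finite_subset_distinct)
  then show "finite ((verts G \<times> arcs G \<times> arcs G) \<times> ?P)" by simp
qed

lemma below_corner_le:
  assumes "maximal_clique \<Gamma> \<Delta>" and le: "corner_le \<Delta> \<Delta>1"
  shows "below \<Delta>1 \<subseteq> below \<Delta>"
proof
  fix x assume "x \<in> below \<Delta>1"
  then obtain v d u \<tau> \<sigma>1 where x: "x = ((v, d, u), \<tau>)" "left_corner \<Gamma> (v, d, u)" "snk_path v \<tau>"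
    "corner_suffix \<Delta>1 v d u \<sigma>1" "out_lex \<tau> \<sigma>1" unfolding below_def by blast
  obtain \<sigma> where s: "corner_suffix \<Delta> v d u \<sigma>" using corner_suffix_ex[OF assms(1) x(2)] .
  have "out_lex \<tau> \<sigma>" using corner_leD[OF le x(2) s x(4)] x(5) out_lex_trans by blast
  with x s show "x \<in> below \<Delta>" unfolding below_def by blast
qed

text \<open>These are the lower cornering routes in \<Delta> at the corners that still have to
  descend. Routes are collected instead of corners so that corners at different vertices become
  comparable through the whole arc list.\<close>

definition excess_routes :: "'e dipath set \<Rightarrow> 'e dipath set \<Rightarrow> 'e dipath set" where
  "excess_routes \<Delta> \<Delta>' = {r \<in> \<Delta>. \<exists>v d u \<sigma> \<sigma>' a. left_corner \<Gamma> (v, d, u) \<and> corner_suffix \<Delta> v d u \<sigma> \<and> corner_suffix \<Delta>' v d u \<sigma>' \<and>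
     out_lex \<sigma>' \<sigma> \<and> split_at r v a \<sigma> \<and> last a = d \<and>
     (\<forall>x\<in>\<Delta>. \<forall>c y. split_at x v c y \<longrightarrow> last c = d \<longrightarrow> c = a \<or> in_lex c a)}"

lemma excess_routesI:
  assumes mc: "maximal_clique \<Gamma> \<Delta>" and lc: "left_corner \<Gamma> (v, d, u)"
    and co: "corner_suffix \<Delta> v d u \<sigma>" "corner_suffix \<Delta>' v d u \<sigma>'" "out_lex \<sigma>' \<sigma>"
  obtains r a where "r \<in> excess_routes \<Delta> \<Delta>'" "split_at r v a \<sigma>" "last a = d"
proof -
  obtain r q a \<sigma>0 a' where h: "r \<in> \<Delta>" "q \<in> \<Delta>" "split_at r v a \<sigma>0" "split_at q v a' \<sigma>0" "last a = d" "last a' = u"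
    and L: "\<forall>x\<in>\<Delta>. \<forall>c y. split_at x v c y \<longrightarrow> last c = d \<longrightarrow> (c = a \<or> in_lex c a) \<and> (y = \<sigma>0 \<or> out_lex y \<sigma>0)"
    and U: "\<forall>x\<in>\<Delta>. \<forall>c y. split_at x v c y \<longrightarrow> last c = u \<longrightarrow> (a' = c \<or> in_lex a' c) \<and> (\<sigma>0 = y \<or> out_lex \<sigma>0 y)"
    and co0: "corner_suffix \<Delta> v d u \<sigma>0"
    by (rule corner_suffix_extremal[OF mc lc])
  have s: "\<sigma>0 = \<sigma>" using corner_suffix_unique[OF maximalD[OF mc] co0 co(1) left_cornerD(4)[OF lc]] .
  have "\<forall>x\<in>\<Delta>. \<forall>c y. split_at x v c y \<longrightarrow> last c = d \<longrightarrow> c = a \<or> in_lex c a" using L by blast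
  then have "r \<in> excess_routes \<Delta> \<Delta>'"
    unfolding excess_routes_def using lc co h(1,3,5) s by blast
  then show ?thesis using that h(3,5) s by blast
qed

lemma ex_minimal_excess_route:
  assumes mc: "maximal_clique \<Gamma> \<Delta>" "maximal_clique \<Gamma> \<Delta>'" and le: "corner_le \<Delta> \<Delta>'" and ne: "\<Delta> \<noteq> \<Delta>'"
  obtains r where "r \<in> excess_routes \<Delta> \<Delta>'" "\<forall>x\<in>excess_routes \<Delta> \<Delta>'. \<not> in_lex (snd x) (snd r)"
proof -
  have "\<not> corner_le \<Delta>' \<Delta>" using corner_le_antisym[OF mc le] ne by blast
  then obtain v d u \<sigma> \<sigma>' where h: "left_corner \<Gamma> (v, d, u)" "corner_suffix \<Delta> v d u \<sigma>" "corner_suffix \<Delta>' v d u \<sigma>'" "\<not> (\<sigma> = \<sigma>' \<or> out_lex \<sigma> \<sigma>')"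
    unfolding corner_le_def by blast
  then have "out_lex \<sigma>' \<sigma>" using corner_leD[OF le h(1-3)] by blast
  then have "excess_routes \<Delta> \<Delta>' \<noteq> {}" using excess_routesI[OF mc(1) h(1-3)] by blast
  moreover have "excess_routes \<Delta> \<Delta>' \<subseteq> {r. route \<Gamma> r}"
    unfolding excess_routes_def using split_atD(1) by blast
  then have "finite (excess_routes \<Delta> \<Delta>')" using finite_routes finite_subset by blast
  moreover have "asymp_on (excess_routes \<Delta> \<Delta>') (\<lambda>x y. in_lex (snd x) (snd y))"
    "transp_on (excess_routes \<Delta> \<Delta>') (\<lambda>x y. in_lex (snd x) (snd y))"
    unfolding asymp_on_def transp_on_def using in_lex_asym in_lex_trans by blast+
  ultimately obtain r where r: "r \<in> excess_routes \<Delta> \<Delta>'"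
      "\<forall>x\<in>excess_routes \<Delta> \<Delta>'. x \<noteq> r \<longrightarrow> \<not> in_lex (snd x) (snd r)"
    using Finite_Set.bex_min_element[of "excess_routes \<Delta> \<Delta>'" "\<lambda>x y. in_lex (snd x) (snd y)"] by blast
  have "\<not> in_lex (snd x) (snd r)" if "x \<in> excess_routes \<Delta> \<Delta>'" for x
    using r(2) that by (cases "x = r") auto
  with r(1) that show ?thesis by blast
qed

text \<open>Two points need an argument. That \<Delta> has a smaller suffix with the prefix
  \<open>a\<close> rests on the minimality of \<open>r\<close>; that the largest such suffix \<tau>
  does not fall below \<sigma>' rests on the corner inequalities along \<open>p\<close>.\<close>

lemma ascending_flip:
  assumes mc: "maximal_clique \<Gamma> \<Delta>" "maximal_clique \<Gamma> \<Delta>'" and le: "corner_le \<Delta> \<Delta>'" and ne: "\<Delta> \<noteq> \<Delta>'"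
  shows "\<exists>\<Delta>1. framing_cover \<Gamma> \<Delta> \<Delta>1 \<and> corner_le \<Delta>1 \<Delta>' \<and> card (below \<Delta>1) < card (below \<Delta>)"
proof -
  note cl = maximalD[OF mc(1)] maximalD[OF mc(2)]
  obtain r where r: "r \<in> excess_routes \<Delta> \<Delta>'"
    and rmin: "\<forall>x\<in>excess_routes \<Delta> \<Delta>'. \<not> in_lex (snd x) (snd r)"
    using ex_minimal_excess_route[OF mc le ne] .
  from r obtain v d u \<sigma> \<sigma>' a where rd: "r \<in> \<Delta>" and lc: "left_corner \<Gamma> (v, d, u)"
    and co: "corner_suffix \<Delta> v d u \<sigma>" and co': "corner_suffix \<Delta>' v d u \<sigma>'" and ss: "out_lex \<sigma>' \<sigma>"
    and rv: "split_at r v a \<sigma>" and la: "last a = d"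
    and amax: "\<forall>x\<in>\<Delta>. \<forall>c y. split_at x v c y \<longrightarrow> last c = d \<longrightarrow> c = a \<or> in_lex c a"
    unfolding excess_routes_def by blast
  note lcD = left_cornerD[OF lc]
  note du = lcD(4)
  \<comment> \<open>By minimality of \<open>r\<close>, the suffixes agree at each corner whose upper arc and suffix in \<open>\<Delta>\<close> lie on \<open>r\<close>.\<close>
  have key: False
    if lc1: "left_corner \<Gamma> (v1, d1, last \<alpha>1)" and co1: "corner_suffix \<Delta> v1 d1 (last \<alpha>1) \<rho>" "corner_suffix \<Delta>' v1 d1 (last \<alpha>1) \<rho>'"
      and lt: "out_lex \<rho>' \<rho>" and r1: "split_at r v1 \<alpha>1 \<rho>" for v1 d1 \<alpha>1 \<rho> \<rho>'
  proof -
    obtain x l where x: "x \<in> excess_routes \<Delta> \<Delta>'" "split_at x v1 l \<rho>" "last l = d1"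
      using excess_routesI[OF mc(1) lc1 co1 lt] .
    have "in_lex l \<alpha>1" using in_lex_lastI split_atD(7)[OF x(2)] split_atD(7)[OF r1] x(3) left_cornerD(4)[OF lc1] by blast
    then have "in_lex (snd x) (snd r)" using split_atD(3)[OF x(2)] split_atD(3)[OF r1] by simp
    with rmin x(1) show False by blast
  qed
  obtain y0 b where y0: "y0 \<in> \<Delta>'" "split_at y0 v b \<sigma>'" using co' unfolding corner_suffix_def by blast
  have "\<sigma> \<noteq> \<sigma>'" using ss by auto
  from snk_split[OF split_atD(6)[OF rv] split_atD(6)[OF y0(2)] this lcD(1)]
  obtain \<mu> w g g' x x' where sp: "\<sigma> = \<mu> @ g # x" "\<sigma>' = \<mu> @ g' # x'" "g \<noteq> g'" "awalk v \<mu> w" "internal G w"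
    "g \<in> out_arcs G w" "g' \<in> out_arcs G w" by metis
  have gg: "(g', g) \<in> out_rel \<Gamma>" using ss sp(1-3) by auto
  then have ngg: "(g, g') \<notin> out_rel \<Gamma>"
    using transD[OF trans_out_rel] irrefl_out_rel unfolding irrefl_def by blast
  have rw: "split_at r w (a @ \<mu>) (g # x)" using split_at_fwd[OF _ sp(4,5)] rv sp(1) by blast
  \<comment> \<open>At \<open>w\<close>, where \<sigma>' drops below \<sigma>, \<Delta> uses the
    smaller arc \<open>g'\<close> as well. If no such route shares the prefix of \<open>r\<close>,
    all of them have smaller prefixes, and \<open>pred_corner\<close> supplies a corner on
    \<open>r\<close>.\<close>
  have "\<exists>s\<in>\<Delta>. \<exists>y. split_at s w (a @ \<mu>) y \<and> out_lex y (g # x)"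
  proof (rule ccontr)
    assume "\<not> ?thesis"
    then have no: "\<forall>s\<in>\<Delta>. \<forall>y. split_at s w (a @ \<mu>) y \<longrightarrow> \<not> out_lex y (g # x)" by blast
    obtain z c yz where z: "z \<in> \<Delta>" "split_at z w c yz" "hd yz = g'"
      using maximal_out_arc[OF mc(1) sp(5) sp(7)] .
    have zo: "out_lex yz (g # x)" using out_lex_hdI[OF split_atD(8)[OF z(2)]] z(3) gg by simp
    then have "c = a @ \<mu> \<or> in_lex c (a @ \<mu>)" using clique_in_lex[OF cl(1) z(1) rd z(2) rw] by blast
    then have ci: "in_lex c (a @ \<mu>)" using no z(1,2) zo by blast
    obtain t c' where t: "t \<in> \<Delta>" "split_at t w c' (g # x)" "in_lex c' (a @ \<mu>)"
      using pred_same_suffix[OF mc(1) rd rw no z(1,2) ci] .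
    obtain m v1 d1 \<alpha>1 where k: "a @ \<mu> = \<alpha>1 @ m" "awalk v1 m w" "internal G v1"
      "left_corner \<Gamma> (v1, d1, last \<alpha>1)" "corner_suffix \<Delta> v1 d1 (last \<alpha>1) (m @ g # x)"
      using pred_corner[OF mc(1) rd rw t] .
    obtain \<rho>' where rho: "corner_suffix \<Delta>' v1 d1 (last \<alpha>1) \<rho>'" using corner_suffix_ex[OF mc(2) k(4)] .
    have r1: "split_at r v1 \<alpha>1 (m @ g # x)" using split_at_bwd[OF _ k(2,3)] rw k(1) by simp
    have re: "\<rho>' = m @ g # x" using corner_leD[OF le k(4,5) rho] key[OF k(4,5) rho _ r1] by blast
    \<comment> \<open>The agreement of the cliques at this corner is contradictory. After
      \<open>v\<close>, \<open>y0\<close> enters \<open>v1\<close> by its upper arc and continues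
      below \<rho>'. At or before \<open>v\<close>, a route of \<Delta>' follows \<open>r\<close>
      from \<open>v1\<close>, and so enters \<open>v\<close> by \<open>d\<close> and continues with
      \<sigma>, above \<sigma>'.\<close>
    show False
    proof (cases "v < v1")
      case True
      then obtain m' where m': "\<alpha>1 = a @ m'" "awalk v m' v1"
        using split_at_order[OF rv r1] by auto
      with True have "m' \<noteq> []" by (auto simp: awalk_simps)
      have mu: "\<mu> = m' @ m" using k(1) m'(1) by simp
      then have "split_at y0 v1 (b @ m') (m @ g' # x')" using split_at_fwd[OF _ m'(2) k(3)] y0(2) sp(2) by simp
      moreover have "last (b @ m') = last \<alpha>1" using m'(1) \<open>m' \<noteq> []\<close> by simp
      ultimately have "m @ g' # x' = \<rho>' \<or> out_lex \<rho>' (m @ g' # x')"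
        using corner_suffix_upper[OF cl(2) rho left_cornerD(4)[OF k(4)] y0(1)] by blast
      then show False using re ngg sp(3) by auto
    next
      case False
      then have "v1 \<le> v" by simp
      then obtain m' where m': "a = \<alpha>1 @ m'" "m @ g # x = m' @ \<sigma>" "awalk v1 m' v"
        using split_at_order[OF r1 rv] by auto
      obtain q' l where q': "q' \<in> \<Delta>'" "split_at q' v1 l (m' @ \<sigma>)" "last l = last \<alpha>1"
        using rho unfolding re m'(2) corner_suffix_def by blast
      have "split_at q' v (l @ m') \<sigma>" using split_at_fwd[OF q'(2) m'(3) lcD(1)] .
      moreover have "last (l @ m') = d" using la m'(1) q'(3) by (cases "m' = []") auto
      ultimately have "\<sigma> = \<sigma>' \<or> out_lex \<sigma> \<sigma>'" using corner_suffix_lower[OF cl(2) co' du q'(1)] by blast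
      then show False using ss out_lex_asym[OF ss] by auto
    qed
  qed
  then obtain s y where s: "s \<in> \<Delta>" "split_at s w (a @ \<mu>) y" "out_lex y (g # x)" by blast
  have sv: "split_at s v a (\<mu> @ y)" using split_at_bwd[OF s(2) sp(4) lcD(1)] .
  let ?T = "{y. \<exists>x\<in>\<Delta>. split_at x v a y \<and> out_lex y \<sigma>}"
  have "\<mu> @ y \<in> ?T" using s sv sp(1) by auto
  then have T: "?T \<noteq> {}" "?T \<subseteq> {b. snk_path v b}" using split_atD(6) by blast+
  from ex_out_lex_min_max(2)[OF this lcD(1)]
  obtain \<tau> where tau: "\<tau> \<in> ?T" "\<forall>y\<in>?T. y = \<tau> \<or> out_lex y \<tau>" by blast
  then obtain p where p: "p \<in> \<Delta>" "split_at p v a \<tau>" and ts: "out_lex \<tau> \<sigma>" by blast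
  have M: "\<forall>x\<in>\<Delta>. \<forall>y. split_at x v a y \<longrightarrow> out_lex y \<sigma> \<longrightarrow> y = \<tau> \<or> out_lex y \<tau>" using tau(2) by blast
  obtain r0 q a0 \<sigma>0 a' where h: "r0 \<in> \<Delta>" "q \<in> \<Delta>" "split_at r0 v a0 \<sigma>0" "split_at q v a' \<sigma>0" "last a0 = d" "last a' = u"
    and L0: "\<forall>x\<in>\<Delta>. \<forall>c y. split_at x v c y \<longrightarrow> last c = d \<longrightarrow> (c = a0 \<or> in_lex c a0) \<and> (y = \<sigma>0 \<or> out_lex y \<sigma>0)"
    and U0: "\<forall>x\<in>\<Delta>. \<forall>c y. split_at x v c y \<longrightarrow> last c = u \<longrightarrow> (a' = c \<or> in_lex a' c) \<and> (\<sigma>0 = y \<or> out_lex \<sigma>0 y)"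
    and co0: "corner_suffix \<Delta> v d u \<sigma>0"
    by (rule corner_suffix_extremal[OF mc(1) lc])
  have s0: "\<sigma>0 = \<sigma>" using corner_suffix_unique[OF cl(1) co0 co du] .
  have L: "\<forall>x\<in>\<Delta>. \<forall>c y. split_at x v c y \<longrightarrow> last c = d \<longrightarrow> (c = a \<or> in_lex c a) \<and> (y = \<sigma> \<or> out_lex y \<sigma>)"
    using L0 amax s0 by blast
  interpret F: flip \<Gamma> \<Delta> v d u r q p a a' \<sigma> \<tau>
    by unfold_locales (use mc(1) lc rd h(2) p rv h(4,6) la L U0 ts M s0 in simp_all)
  have \<tau>_ge: "\<sigma>' = \<tau> \<or> out_lex \<sigma>' \<tau>"
  proof (rule ccontr)
    assume n: "\<not> ?thesis"
    then have to: "out_lex \<tau> \<sigma>'" using split_at_out_lex_total[OF p(2) y0(2)] by blast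
    have "\<mu> @ y = \<tau> \<or> out_lex (\<mu> @ y) \<tau>" using tau(2) \<open>\<mu> @ y \<in> ?T\<close> by blast
    then obtain \<tau>2 where t2: "\<tau> = \<mu> @ \<tau>2"
      using lexord_between[OF irrefl_out_rel trans_out_rel, of \<mu> y \<tau> "g # x"] ts sp(1) by auto
    from snk_split[OF split_atD(6)[OF p(2)] split_atD(6)[OF y0(2)] _ lcD(1)] n
    obtain \<kappa> w2 h1 h2 y1 y2 where k: "\<tau> = \<kappa> @ h1 # y1" "\<sigma>' = \<kappa> @ h2 # y2" "h1 \<noteq> h2" "awalk v \<kappa> w2" "internal G w2"
      "h1 \<in> out_arcs G w2" "h2 \<in> out_arcs G w2" by metis
    have hh: "(h1, h2) \<in> out_rel \<Gamma>" using to k(1-3) by auto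
    then have nhh: "(h2, h1) \<notin> out_rel \<Gamma>"
      using transD[OF trans_out_rel] irrefl_out_rel unfolding irrefl_def by blast
    \<comment> \<open>\<tau> lies between two suffixes beginning with \<mu>, and \<sigma>' begins
      with \<mu> too, so \<tau> and \<sigma>' cannot part before \<open>w\<close>.\<close>
    have "\<exists>\<kappa>2. \<kappa> = \<mu> @ \<kappa>2"
    proof (rule ccontr)
      assume nk: "\<nexists>\<kappa>2. \<kappa> = \<mu> @ \<kappa>2"
      have "\<kappa> @ h1 # y1 = \<mu> @ \<tau>2" using k(1) t2 by simp
      then obtain e where e: "\<kappa> @ e = \<mu>" "h1 # y1 = e @ \<tau>2"
        using nk by (metis append_eq_append_conv2)
      then have "e \<noteq> []" using nk by auto
      moreover have "h2 # y2 = e @ g' # x'" using k(2) sp(2) e(1) by auto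
      ultimately have "h1 = h2" using e(2) by (cases e) auto
      with k(3) show False by simp
    qed
    then obtain \<kappa>2 where k2: "\<kappa> = \<mu> @ \<kappa>2" by blast
    have gk: "g' # x' = \<kappa>2 @ h2 # y2" using sp(2) k(2) k2 by simp
    have pw2: "split_at p w2 (a @ \<kappa>) (h1 # y1)" using split_at_fwd[OF _ k(4,5)] p(2) k(1) by simp
    \<comment> \<open>A route of this kind would give a suffix strictly between \<tau> and \<sigma>
      at the prefix \<open>a\<close>, against the choice of \<tau>.\<close>
    have N: False if "t \<in> \<Delta>" "split_at t w2 (a @ \<kappa>) y3" "out_lex (h1 # y1) y3" "out_lex (\<kappa>2 @ y3) (g # x)" for t y3
    proof -
      have "split_at t v a (\<kappa> @ y3)" using split_at_bwd[OF that(2) k(4) lcD(1)] .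
      moreover have "out_lex (\<kappa> @ y3) \<sigma>" using that(4) k2 sp(1) by simp
      ultimately have "\<kappa> @ y3 = \<tau> \<or> out_lex (\<kappa> @ y3) \<tau>" using M that(1) by blast
      then have "y3 = h1 # y1 \<or> out_lex y3 (h1 # y1)" using k(1) by simp
      then show False using out_lex_asym[OF that(3)] that(3) by auto
    qed
    obtain z c yz where z: "z \<in> \<Delta>" "split_at z w2 c yz" "hd yz = h2"
      using maximal_out_arc[OF mc(1) k(5) k(7)] .
    have zo: "out_lex (h1 # y1) yz" using out_lex_hdI[OF _ split_atD(8)[OF z(2)]] z(3) hh by simp
    have zc: "a @ \<kappa> = c \<or> in_lex (a @ \<kappa>) c" using clique_in_lex[OF cl(1) p(1) z(1) pw2 z(2) zo] .
    show False
    proof (cases \<kappa>2)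
      case Nil
      \<comment> \<open>With \<open>w2 = w\<close>, the route \<open>z\<close> leaves above
        \<open>p\<close> and below \<open>r\<close>. Its prefix is squeezed to their common one, and
        \<open>N\<close> applies.\<close>
      then have e: "\<kappa> = \<mu>" "h2 = g'" using k2 gk by simp_all
      then have "w2 = w" using k(4) sp(4) awalk_end by blast
      have "out_lex yz (g # x)" using out_lex_hdI[OF split_atD(8)[OF z(2)]] z(3) gg e by simp
      then have "c = a @ \<mu> \<or> in_lex c (a @ \<mu>)"
        using clique_in_lex[OF cl(1) z(1) rd _ rw] z(2) \<open>w2 = w\<close> by blast
      then have "c = a @ \<kappa>" using zc e(1) in_lex_asym by blast
      then show False using N[OF z(1) _ zo] z(2) \<open>out_lex yz (g # x)\<close> Nil by simp
    next
      case (Cons g2 \<nu>)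
      then have g2: "g2 = g'" using gk by simp
      \<comment> \<open>Past \<open>g'\<close> every continuation stays below \<open>g # x\<close>.
        By \<open>N\<close>, \<open>p\<close> therefore has the largest suffix among the routes with
        its prefix at \<open>w2\<close>, as \<open>succ_same_suffix\<close> demands.\<close>
      have "out_lex (\<kappa>2 @ y3) (g # x)" for y3 using Cons g2 gg by simp
      then have no: "\<forall>t\<in>\<Delta>. \<forall>y3. split_at t w2 (a @ \<kappa>) y3 \<longrightarrow> \<not> out_lex (h1 # y1) y3"
        using N by blast
      have ci: "in_lex (a @ \<kappa>) c" using zc no z(1,2) zo by blast
      obtain t c2 where t: "t \<in> \<Delta>" "split_at t w2 c2 (h1 # y1)" "in_lex (a @ \<kappa>) c2"
        using succ_same_suffix[OF mc(1) p(1) pw2 no z(1,2) ci] .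
      obtain m v1 u1 \<alpha>1 c1 where j: "a @ \<kappa> = \<alpha>1 @ m" "c2 = c1 @ m" "awalk v1 m w2" "internal G v1"
        "left_corner \<Gamma> (v1, last \<alpha>1, u1)" "corner_suffix \<Delta> v1 (last \<alpha>1) u1 (m @ h1 # y1)"
        using succ_corner[OF mc(1) p(1) pw2 t] .
      obtain \<rho>' where rho: "corner_suffix \<Delta>' v1 (last \<alpha>1) u1 \<rho>'" using corner_suffix_ex[OF mc(2) j(5)] .
      have rle: "\<rho>' = m @ h1 # y1 \<or> out_lex \<rho>' (m @ h1 # y1)" using corner_leD[OF le j(5,6) rho] .
      have p1: "split_at p v1 \<alpha>1 (m @ h1 # y1)" using split_at_bwd[OF _ j(3,4)] pw2 j(1) by simp
      have pw: "split_at p w (a @ \<mu>) (\<kappa>2 @ h1 # y1)" using split_at_fwd[OF _ sp(4,5)] p(2) k(1) k2 by simp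
      \<comment> \<open>After \<open>w\<close>, \<open>y0\<close> enters the corner by its lower arc
        and continues above \<open>p\<close>, though the suffix in \<Delta>' may not exceed that of
        \<open>p\<close>. At or before \<open>w\<close>, \<open>t\<close> reaches \<open>w\<close>
        with a larger prefix than \<open>r\<close> but leaves by \<open>g'\<close>, in conflict with
        \<open>r\<close> inside \<Delta>.\<close>
      show False
      proof (cases "w < v1")
        case True
        then obtain m' where m': "\<alpha>1 = (a @ \<mu>) @ m'" "awalk w m' v1"
          using split_at_order[OF pw p1] by auto
        with True have "m' \<noteq> []" by (auto simp: awalk_simps)
        have "\<kappa>2 = m' @ m" using j(1) m'(1) k2 by simp
        then have "split_at y0 v b ((\<mu> @ m') @ m @ h2 # y2)" using y0(2) k(2) k2 by simp
        moreover have "awalk v (\<mu> @ m') v1" using sp(4) m'(2) awalk_append by blast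
        ultimately have "split_at y0 v1 (b @ \<mu> @ m') (m @ h2 # y2)" using split_at_fwd j(4) by blast
        moreover have "last (b @ \<mu> @ m') = last \<alpha>1" using m'(1) \<open>m' \<noteq> []\<close> by simp
        ultimately have "m @ h2 # y2 = \<rho>' \<or> out_lex (m @ h2 # y2) \<rho>'"
          using corner_suffix_lower[OF cl(2) rho left_cornerD(4)[OF j(5)] y0(1)] by blast
        with rle have "m @ h2 # y2 = m @ h1 # y1 \<or> out_lex (m @ h2 # y2) (m @ h1 # y1)"
          using out_lex_trans by blast
        then show False using nhh k(3) by auto
      next
        case False
        then have "v1 \<le> w" by simp
        then obtain m' where m': "a @ \<mu> = \<alpha>1 @ m'" "m @ h1 # y1 = m' @ \<kappa>2 @ h1 # y1" "awalk v1 m' w"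
          using split_at_order[OF p1 pw] by auto
        have "split_at t v1 c1 (m @ h1 # y1)" using split_at_bwd[OF _ j(3,4)] t(2) j(2) by simp
        then have tw: "split_at t w (c1 @ m') (\<kappa>2 @ h1 # y1)"
          using split_at_fwd[OF _ m'(3) sp(5)] m'(2) by simp
        have "in_lex \<alpha>1 c1" using t(3) unfolding j(1,2) by simp
        then have "in_lex (a @ \<mu>) (c1 @ m')" unfolding m'(1) by simp
        then have "g # x = \<kappa>2 @ h1 # y1 \<or> out_lex (g # x) (\<kappa>2 @ h1 # y1)"
          using clique_out_lex[OF cl(1) rd t(1) rw tw] by blast
        then show False using Cons g2 ngg sp(3) by auto
      qed
    qed
  qed
  have le1: "corner_le F.flipped \<Delta>'"
    unfolding corner_le_def
  proof (intro allI impI)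
    fix w0 d0 u0 \<rho> \<rho>'
    assume l0: "left_corner \<Gamma> (w0, d0, u0)" and c1: "corner_suffix F.flipped w0 d0 u0 \<rho>" and c': "corner_suffix \<Delta>' w0 d0 u0 \<rho>'"
    show "\<rho>' = \<rho> \<or> out_lex \<rho>' \<rho>"
    proof (cases "w0 = v \<and> d0 = d \<and> u0 = u")
      case True
      then have "\<rho> = \<tau>" using corner_suffix_unique[OF F.clique_flipped _ F.corner_suffix_flip du] c1 by blast
      moreover have "\<rho>' = \<sigma>'" using True corner_suffix_unique[OF cl(2) _ co' du] c' by blast
      ultimately show ?thesis using \<tau>_ge by blast
    next
      case False
      obtain \<rho>0 where c0: "corner_suffix \<Delta> w0 d0 u0 \<rho>0" using corner_suffix_ex[OF mc(1) l0] .
      then have "\<rho>0 = \<rho>" using F.corner_suffix_other[OF l0 c0 c1] False by blast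
      then show ?thesis using corner_leD[OF le l0 c0 c'] by blast
    qed
  qed
  have "below F.flipped \<subseteq> below \<Delta>" using below_corner_le[OF mc(1) framing_cover_corner_le[OF F.flip_cover]] .
  \<comment> \<open>The measure drops because \<tau> is strictly below the old suffix and equal to
    the new one.\<close>
  moreover have "((v, d, u), \<tau>) \<in> below \<Delta>"
    unfolding below_def using lc split_atD(6)[OF p(2)] co ts by blast
  moreover have "((v, d, u), \<tau>) \<notin> below F.flipped"
  proof
    assume "((v, d, u), \<tau>) \<in> below F.flipped"
    then obtain \<sigma>1 where s1: "corner_suffix F.flipped v d u \<sigma>1" "out_lex \<tau> \<sigma>1" unfolding below_def by blast
    have "\<sigma>1 = \<tau>" using corner_suffix_unique[OF F.clique_flipped s1(1) F.corner_suffix_flip du] .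
    with s1(2) show False by simp
  qed
  ultimately have "below F.flipped \<subset> below \<Delta>" by blast
  then have "card (below F.flipped) < card (below \<Delta>)" using finite_below psubset_card_mono by blast
  with le1 F.flip_cover show ?thesis by blast
qed

section \<open>Chains of exchanges and the two implications\<close>

lemma corner_le_framing_le:
  assumes "maximal_clique \<Gamma> \<Delta>" "maximal_clique \<Gamma> \<Delta>'" "corner_le \<Delta> \<Delta>'"
  shows "framing_le \<Gamma> \<Delta> \<Delta>'"
  using assms
proof (induction "card (below \<Delta>)" arbitrary: \<Delta> rule: less_induct)
  case less
  show ?case
  proof (cases "\<Delta> = \<Delta>'")
    case True
    then show ?thesis unfolding framing_le_def by simp
  next
    case False
    obtain \<Delta>1 where d1: "framing_cover \<Gamma> \<Delta> \<Delta>1" "corner_le \<Delta>1 \<Delta>'" "card (below \<Delta>1) < card (below \<Delta>)"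
      using ascending_flip[OF less.prems False] by blast
    have "maximal_clique \<Gamma> \<Delta>1" using d1(1) unfolding framing_cover_def by blast
    then have "framing_le \<Gamma> \<Delta>1 \<Delta>'" using less.hyps[OF d1(3)] less.prems(2) d1(2) by blast
    with d1(1) show ?thesis unfolding framing_le_def by (rule converse_rtranclp_into_rtranclp)
  qed
qed

lemma corner_le_trans:
  assumes "corner_le \<Delta>1 \<Delta>2" "corner_le \<Delta>2 \<Delta>3" "maximal_clique \<Gamma> \<Delta>2"
  shows "corner_le \<Delta>1 \<Delta>3"
  unfolding corner_le_def
proof (intro allI impI)
  fix v d u \<sigma> \<sigma>'
  assume h: "left_corner \<Gamma> (v, d, u)" "corner_suffix \<Delta>1 v d u \<sigma>" "corner_suffix \<Delta>3 v d u \<sigma>'"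
  obtain \<tau> where t: "corner_suffix \<Delta>2 v d u \<tau>" using corner_suffix_ex[OF assms(3) h(1)] .
  show "\<sigma>' = \<sigma> \<or> out_lex \<sigma>' \<sigma>"
    using corner_leD[OF assms(1) h(1,2) t] corner_leD[OF assms(2) h(1) t h(3)] out_lex_trans by blast
qed

lemma framing_le_corner_le:
  assumes "framing_le \<Gamma> \<Delta> \<Delta>'" "maximal_clique \<Gamma> \<Delta>"
  shows "corner_le \<Delta> \<Delta>'"
  using assms(1) unfolding framing_le_def
proof (induction rule: rtranclp_induct)
  case base
  show ?case unfolding corner_le_def using corner_suffix_unique[OF maximalD[OF assms(2)]] left_cornerD(4) by blast
next
  case (step \<Delta>1 \<Delta>2)
  have "maximal_clique \<Gamma> \<Delta>1" using step.hyps(2) unfolding framing_cover_def by blast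
  then show ?case using corner_le_trans[OF step.IH framing_cover_corner_le[OF step.hyps(2)]] by blast
qed

end

theorem theorem4p9:
  fixes \<Gamma> :: "'e framed_digraph" and \<Delta> \<Delta>' :: "'e dipath set"
  assumes "framed_graph \<Gamma>"
    and "maximal_clique \<Gamma> \<Delta>"
    and "maximal_clique \<Gamma> \<Delta>'"
  shows "framing_le \<Gamma> \<Delta> \<Delta>' \<longleftrightarrow> (\<forall>c. left_corner \<Gamma> c \<longrightarrow> CC_L \<Gamma> \<Delta> c \<le> CC_L \<Gamma> \<Delta>' c)"
proof -
  interpret fin_digraph "graph \<Gamma>"
    using assms(1) unfolding framed_graph_def flow_graph_def by blast
  interpret framed \<Gamma>
    by unfold_locales (rule assms(1))
  show ?thesis
    unfolding CC_L_le_corner_le[OF assms(2,3)]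
    using corner_le_framing_le[OF assms(2,3)] framing_le_corner_le[OF _ assms(2)] by blast
qed

end
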